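(* Let $g\in\mathcal{M}(\mathbb{R})$ and let $a=\delta_{x_1=0}\otimes g\in\mathcal{M}(\mathbb{R}^2)$. Suppose that the Cauchy problem for the two-dimensional Burgers equation with datum $a$ admits a unique admissible solution $u$ (thus a self-similar one), and that $u$ is the limit of solutions $u_m(t)=S_ta_m$ associated with approximate data $a_m$ of $a$. Then $g$ is actually a function, which satisfies $$\|g\|_p\le(2c_\infty^2)^{1/p'}\,\|g\|_1^{\frac12\left(1+\frac1p\right)},\qquad\forall p>1,$$ where $\frac1p+\frac1{p'}=1$.
   Context: The two-dimensional Burgers equation is $$\partial_tu+\partial_1\frac{u^2}2+\partial_2\frac{u^3}3=0,\qquad t>0,\ x\in\mathbb{R}^2.$$ Write $f(u)=(u^2/2,u^3/3)$. $\mathcal{M}(\mathbb{R}^n)$ is the space of bounded (signed, finite) Radon measures with total variation norm $\|\cdot\|_{\mathcal M}$. $\delta_{x_1=0}\otimes g$ is the product measure: $\langle\delta_{x_1=0}\otimes g,\psi\rangle=\int\psi(0,x_2)\,dg(x_2)$. For $b\in L^1\cap L^\infty(\mathbb{R}^2)$, $S_tb:=u(t)$ denotes Kruzhkov's semigroup, that is, $u\in L^\infty(\mathbb{R}_+\times\mathbb{R}^2)\cap C(\mathbb{R}_+;L^1(\mathbb{R}^2))$ is the unique admissible (Kruzhkov entropy) solution with initial data $b$. The constant $c_\infty<\infty$ is a fixed universal constant for which the known dispersive estimate (Serre–Silvestre) holds: $\|S_tb\|_\infty\le c_\infty t^{-1/2}\|b\|_1^{1/4}$ for all $t>0$ and all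 $b\in L^1\cap L^\infty(\mathbb{R}^2)$. Entropy solution on $(0,\infty)\times\mathbb{R}^2$: a function $u$, bounded on $(\tau,\infty)\times\mathbb{R}^2$ for every $\tau>0$, satisfying $$\int_0^\infty\int_{\mathbb{R}^2}(u\,\partial_t\phi+f(u)\cdot\nabla_x\phi)\,dx\,dt=0\quad\text{for all }\phi\in C_c^\infty((0,\infty)\times\mathbb{R}^2),$$ and $$\int_0^\infty\int_{\mathbb{R}^2}\big(|u-k|\,\partial_t\phi+\mathrm{sgn}(u-k)(f(u)-f(k))\cdot\nabla_x\phi\big)\,dx\,dt\ge0$$ for all $k\in\mathbb{R}$ and all non-negative $\phi\in C_c^\infty((0,\infty)\times\mathbb{R}^2)$. Admissible solution with datum $a\in\mathcal{M}(\mathbb{R}^2)$: an entropy solution $u\in L^\infty(0,\infty;L^1(\mathbb{R}^2))$ on $(0,\infty)\times\mathbb{R}^2$ such that $u(t)\to a$ in the narrow sense as $t\to0+$ (for the essential limit in $t$), i.e. $\int u(t,x)\psi(x)\,dx\to\langle a,\psi\rangle$ for every bounded continuous $\psi$. Self-similar: $u$ is self-similar if for every $\mu>0$, $\sqrt\mu\,u(\mu t,\sqrt\mu\,x_1,x_2)=u(t,x_1,x_2)$ almost everywhere; equivalently $u(t,x)=t^{-1/2}W(x_1t^{-1/2},x_2)$ for some profile $W$. (The scaling $u\mapsto\sqrt\mu\,u(\mu t,\sqrt\mu\,x_1,x_2)$ maps entropy solutions to entropy solutions.) Approximate data of a measure $a$ supported by the vertical axis $\{x_1=0\}$: a sequence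 $a_m\in L^1\cap L^\infty(\mathbb{R}^2)$ converging narrowly to $a$, with ${\rm Supp}\,a_m\subset[-\frac1m,\frac1m]\times\mathbb{R}$ and $\|a_m\|_1\le\|a\|_{\mathcal M}$. "Limit" of $u_m$ means limit in the sense of distributions on $(0,\infty)\times\mathbb{R}^2$ (in particular this covers pointwise almost everywhere limits). *)

theory Defs
  imports "HOL-Analysis.Analysis" "HOL-Probability.Essential_Supremum"
begin

section \<open>Finite signed Radon measures\<close>

text \<open>
  An element of the space of finite signed measures is a real-valued, countably additive set
  function on the Borel sets (its values on other sets are irrelevant). On the Euclidean spaces
  used below every finite Borel measure is Radon.
\<close>

definition signed_measure :: "('a::topological_space set \<Rightarrow> real) \<Rightarrow> bool" where
  "signed_measure \<nu> \<longleftrightarrow>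
     (\<forall>A :: nat \<Rightarrow> 'a set. range A \<subseteq> sets borel \<longrightarrow> disjoint_family A \<longrightarrow>
        (\<lambda>i. \<nu> (A i)) sums \<nu> (\<Union>i. A i))"

text \<open>
  Jordan decomposition: the positive part of \<open>\<nu>\<close> is \<open>A \<mapsto> sup {\<nu> B | B \<subseteq> A}\<close>. The truncation
  of negative values by \<^const>\<open>ennreal\<close> is harmless, since \<open>B = {}\<close> contributes \<open>0\<close>.
\<close>

definition pos_variation :: "('a::topological_space set \<Rightarrow> real) \<Rightarrow> 'a measure" where
  "pos_variation \<nu> =
     measure_of UNIV (sets borel) (\<lambda>A. SUP B\<in>{B \<in> sets borel. B \<subseteq> A}. ennreal (\<nu> B))"

definition neg_variation :: "('a::topological_space set \<Rightarrow> real) \<Rightarrow> 'a measure" where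
  "neg_variation \<nu> = pos_variation (\<lambda>A. - \<nu> A)"

definition tv_norm :: "('a::topological_space set \<Rightarrow> real) \<Rightarrow> real" where
  "tv_norm \<nu> = measure (pos_variation \<nu>) UNIV + measure (neg_variation \<nu>) UNIV"

definition signed_integral :: "('a::topological_space set \<Rightarrow> real) \<Rightarrow> ('a \<Rightarrow> real) \<Rightarrow> real" where
  "signed_integral \<nu> \<psi> =
     (LINT x|pos_variation \<nu>. \<psi> x) - (LINT x|neg_variation \<nu>. \<psi> x)"

text \<open>The product of the Dirac mass at \<open>x\<^sub>1 = 0\<close> with \<open>g\<close>.\<close>

definition delta_axis :: "(real set \<Rightarrow> real) \<Rightarrow> (real \<times> real) set \<Rightarrow> real" where
  "delta_axis g A = g {y. (0, y) \<in> A}"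

text \<open>Narrow convergence of the measures \<open>w i dx\<close> to \<open>\<nu>\<close> along the filter \<open>F\<close>.\<close>

definition narrow_lim ::
  "('i \<Rightarrow> 'a::euclidean_space \<Rightarrow> real) \<Rightarrow> ('a set \<Rightarrow> real) \<Rightarrow> 'i filter \<Rightarrow> bool" where
  "narrow_lim w \<nu> F \<longleftrightarrow>
     (\<forall>\<psi> :: 'a \<Rightarrow> real. continuous_on UNIV \<psi> \<longrightarrow> bounded (range \<psi>) \<longrightarrow>
        ((\<lambda>i. LINT x|lborel. w i x * \<psi> x) \<longlongrightarrow> signed_integral \<nu> \<psi>) F)"

section \<open>Lebesgue spaces\<close>

text \<open>
  Classes of functions modulo null sets are represented by Borel functions. The exponent ranges
  over \<open>(0, \<infinity>]\<close>; the value is \<open>\<infinity>\<close> if \<open>f\<close> is not in the space.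
\<close>

definition Lp_norm :: "ereal \<Rightarrow> ('a::euclidean_space \<Rightarrow> real) \<Rightarrow> ereal" where
  "Lp_norm p f =
     (if p = \<infinity> then esssup lborel (\<lambda>x. ereal \<bar>f x\<bar>)
      else let I = (\<integral>\<^sup>+ x. ennreal (\<bar>f x\<bar> powr real_of_ereal p) \<partial>lborel)
           in if I = \<infinity> then \<infinity> else ereal (enn2real I powr (1 / real_of_ereal p)))"

abbreviation L1_norm :: "('a::euclidean_space \<Rightarrow> real) \<Rightarrow> real" where
  "L1_norm f \<equiv> LINT x|lborel. \<bar>f x\<bar>"

definition L1_Linf :: "('a::euclidean_space \<Rightarrow> real) \<Rightarrow> bool" where
  "L1_Linf b \<longleftrightarrow> integrable lborel b \<and> (\<exists>C. AE x in lborel. \<bar>b x\<bar> \<le> C)"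

definition ess_support :: "('a::euclidean_space \<Rightarrow> real) \<Rightarrow> 'a set" where
  "ess_support f = - \<Union>{U. open U \<and> (AE x in lborel. x \<in> U \<longrightarrow> f x = 0)}"

section \<open>Test functions\<close>

primrec C_k :: "nat \<Rightarrow> ('a::euclidean_space \<Rightarrow> real) \<Rightarrow> bool" where
  "C_k 0 \<phi> \<longleftrightarrow> continuous_on UNIV \<phi>"
| "C_k (Suc n) \<phi> \<longleftrightarrow>
     \<phi> differentiable_on UNIV \<and> (\<forall>v. C_k n (\<lambda>z. frechet_derivative \<phi> (at z) v))"

definition half_space :: "(real \<times> real \<times> real) set" where
  "half_space = {0<..} \<times> UNIV"

text \<open>Test functions on \<^const>\<open>half_space\<close>, extended by zero to all \<open>(t, x\<^sub>1, x\<^sub>2)\<close>.\<close>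

definition test_function :: "(real \<times> real \<times> real \<Rightarrow> real) \<Rightarrow> bool" where
  "test_function \<phi> \<longleftrightarrow>
     (\<forall>n. C_k n \<phi>) \<and> compact (closure {z. \<phi> z \<noteq> 0}) \<and> closure {z. \<phi> z \<noteq> 0} \<subseteq> half_space"

definition dt :: "(real \<times> real \<times> real \<Rightarrow> real) \<Rightarrow> real \<times> real \<times> real \<Rightarrow> real" where
  "dt \<phi> z = frechet_derivative \<phi> (at z) (1, 0, 0)"

definition grad_x :: "(real \<times> real \<times> real \<Rightarrow> real) \<Rightarrow> real \<times> real \<times> real \<Rightarrow> real \<times> real" where
  "grad_x \<phi> z =
     (frechet_derivative \<phi> (at z) (0, 1, 0), frechet_derivative \<phi> (at z) (0, 0, 1))"

section \<open>The two-dimensional Burgers equation\<close>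

text \<open>
  Solutions are functions \<open>u t x\<close>; their values for negative times are irrelevant.
\<close>

type_synonym field2 = "real \<Rightarrow> real \<times> real \<Rightarrow> real"

definition flux :: "real \<Rightarrow> real \<times> real" where
  "flux v = (v\<^sup>2 / 2, v ^ 3 / 3)"

definition entropy_solution :: "field2 \<Rightarrow> bool" where
  "entropy_solution u \<longleftrightarrow>
     set_borel_measurable lborel half_space (\<lambda>(t, x). u t x) \<and>
     (\<forall>\<tau>>0. \<exists>C. AE (t, x) in lborel. t > \<tau> \<longrightarrow> \<bar>u t x\<bar> \<le> C) \<and>
     (\<forall>\<phi>. test_function \<phi> \<longrightarrow>
        set_lebesgue_integral lborel half_space
          (\<lambda>(t, x). u t x * dt \<phi> (t, x) + flux (u t x) \<bullet> grad_x \<phi> (t, x)) = 0) \<and>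
     (\<forall>k \<phi>. test_function \<phi> \<longrightarrow> (\<forall>z. \<phi> z \<ge> 0) \<longrightarrow>
        set_lebesgue_integral lborel half_space
          (\<lambda>(t, x). \<bar>u t x - k\<bar> * dt \<phi> (t, x)
             + sgn (u t x - k) * ((flux (u t x) - flux k) \<bullet> grad_x \<phi> (t, x))) \<ge> 0)"

text \<open>
  Convergence along \<open>inf (at_right 0) (ae_filter lborel)\<close> is the essential limit as \<open>t \<rightarrow> 0+\<close>:
  for every neighbourhood of the limit there is \<open>\<delta> > 0\<close> such that almost every \<open>t \<in> (0, \<delta>)\<close>
  is mapped into it.
\<close>

definition admissible_solution :: "((real \<times> real) set \<Rightarrow> real) \<Rightarrow> field2 \<Rightarrow> bool" where
  "admissible_solution a u \<longleftrightarrow>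
     entropy_solution u \<and>
     (\<exists>C. AE t in lborel. t > 0 \<longrightarrow> integrable lborel (u t) \<and> L1_norm (u t) \<le> C) \<and>
     narrow_lim u a (inf (at_right 0) (ae_filter lborel))"

definition unique_admissible_solution :: "((real \<times> real) set \<Rightarrow> real) \<Rightarrow> field2 \<Rightarrow> bool" where
  "unique_admissible_solution a u \<longleftrightarrow>
     admissible_solution a u \<and>
     (\<forall>v. admissible_solution a v \<longrightarrow> (AE (t, x) in lborel. t > 0 \<longrightarrow> v t x = u t x))"

definition self_similar :: "field2 \<Rightarrow> bool" where
  "self_similar u \<longleftrightarrow>
     (\<forall>\<mu>>0. AE (t, x1, x2) in lborel. t > 0 \<longrightarrow>
        sqrt \<mu> * u (\<mu> * t) (sqrt \<mu> * x1, x2) = u t (x1, x2))"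

text \<open>
  \<open>kruzhkov_solution b u\<close> says that \<open>u t = S\<^sub>t b\<close> for all \<open>t \<ge> 0\<close>: the relation is the graph of
  the semigroup, which is well defined (up to null sets) by the theorem of Kruzhkov.
\<close>

definition kruzhkov_solution :: "(real \<times> real \<Rightarrow> real) \<Rightarrow> field2 \<Rightarrow> bool" where
  "kruzhkov_solution b u \<longleftrightarrow>
     entropy_solution u \<and>
     (\<exists>C. AE (t, x) in lborel. t > 0 \<longrightarrow> \<bar>u t x\<bar> \<le> C) \<and>
     (\<forall>t\<ge>0. integrable lborel (u t)) \<and>
     (\<forall>t\<ge>0. ((\<lambda>s. L1_norm (\<lambda>x. u s x - u t x)) \<longlongrightarrow> 0) (at t within {0..})) \<and>
     (AE x in lborel. u 0 x = b x)"

definition dispersive_estimate :: "real \<Rightarrow> bool" where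
  "dispersive_estimate c \<longleftrightarrow>
     (\<forall>b u t. L1_Linf b \<longrightarrow> kruzhkov_solution b u \<longrightarrow> t > 0 \<longrightarrow>
        Lp_norm \<infinity> (u t) \<le> ereal (c * t powr (- 1 / 2) * L1_norm b powr (1 / 4)))"

text \<open>The condition at index \<open>m\<close> is imposed for \<open>m \<ge> 1\<close> only, because of \<open>1 / m\<close>.\<close>

definition approximate_data ::
  "((real \<times> real) set \<Rightarrow> real) \<Rightarrow> (nat \<Rightarrow> real \<times> real \<Rightarrow> real) \<Rightarrow> bool" where
  "approximate_data a am \<longleftrightarrow>
     (\<forall>m\<ge>1. L1_Linf (am m) \<and>
        ess_support (am m) \<subseteq> {- 1 / real m..1 / real m} \<times> UNIV \<and>
        L1_norm (am m) \<le> tv_norm a) \<and>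
     narrow_lim am a sequentially"

definition distributional_limit :: "(nat \<Rightarrow> field2) \<Rightarrow> field2 \<Rightarrow> bool" where
  "distributional_limit um u \<longleftrightarrow>
     (\<forall>\<phi>. test_function \<phi> \<longrightarrow>
        (\<lambda>m. set_lebesgue_integral lborel half_space (\<lambda>(t, x). um m t x * \<phi> (t, x)))
          \<longlonglongrightarrow> set_lebesgue_integral lborel half_space (\<lambda>(t, x). u t x * \<phi> (t, x)))"

end

theory Submission
  imports Defs "HOL-Probability.Distribution_Functions"
begin

text \<open>
  Self-similarity follows from uniqueness, because the scaling maps admissible solutions with a
  datum carried by the axis to admissible solutions with the same datum.

  For the density, put \<open>M = \<bar>c\<^sub>\<infinity>\<bar> \<parallel>a\<parallel>\<^bsup>1/4\<^esup>\<close>. The dispersive estimate gives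
  \<open>\<bar>u\<^sub>m\<bar> \<le> M t\<^bsup>-1/2\<^esup>\<close>. The entropy inequality for \<open>k = 0\<close> transports \<open>\<bar>u\<^sub>m\<bar>\<close> in the direction \<open>x\<^sub>1\<close>
  with flux \<open>\<bar>u\<^sub>m\<bar> u\<^sub>m / 2\<close>, that is with speed at most \<open>M t\<^bsup>-1/2\<^esup> / 2\<close>, so that \<open>u\<^sub>m(t)\<close> is
  supported in \<open>\<bar>x\<^sub>1\<bar> \<le> 1/m + M t\<^bsup>1/2\<^esup>\<close>. Integrating in \<open>x\<^sub>1\<close> yields
  \<open>\<bar>\<integral> u\<^sub>m(t,x) \<psi>(x\<^sub>2) dx\<bar> \<le> 2 (1/m + M t\<^bsup>1/2\<^esup>) M t\<^bsup>-1/2\<^esup> \<parallel>\<psi>\<parallel>\<^sub>1\<close>, and \<open>m \<rightarrow> \<infinity>\<close>,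
  then \<open>t \<rightarrow> 0\<close>, show that \<open>g\<close> has a density bounded by \<open>2 M\<^sup>2 = 2 c\<^sub>\<infinity>\<^sup>2 \<parallel>g\<parallel>\<^bsup>1/2\<^esup>\<close>. The
  estimates for finite \<open>p\<close> are interpolations with the total mass.
\<close>

section \<open>Smooth cutoffs\<close>

text \<open>Two obstacles shape the proof. First, nothing is known about \<open>u\<close> at a
  single time: a distributional limit sees only integrals over space-time, and the datum is attained
  only as an essential limit in t. Hence the estimate for \<open>u\<close> is carried by products of
  smooth bumps in t, x1 and x2. The bump in x1 is opened up after m has gone to infinity, and the
  bump in t is finally placed on a short interval next to 0. Second, the front starts with unbounded
  speed at t = 0 and cannot be tested there. The cutoff therefore ignores times below 1/n, and the
  missing initial layer is controlled by the L1 continuity of the semigroup at time 0, because the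
  datum vanishes beyond the front. The flux in x2 causes no loss, since the cutoff depends on x2
  only through a bump of slope O(1/n). That t cancels between the height and the width of the cone
  is what leaves a finite bound as t tends to 0, and squaring \<open>M\<close> turns the exponent
  1/4 of the dispersive estimate into 1/2.\<close>

lemma C_k_SucI:
  assumes "\<And>z. (\<phi> has_derivative \<phi>' z) (at z)" and "\<And>v. C_k n (\<lambda>z. \<phi>' z v)"
  shows "C_k (Suc n) \<phi>"
proof -
  have "frechet_derivative \<phi> (at z) = \<phi>' z" for z
    using frechet_derivative_at[OF assms(1)] by simp
  then show ?thesis
    using assms by (auto simp: differentiable_on_def differentiable_def)
qed

text \<open>With the introduction rule above, this hides the chosen derivative
  \<open>frechet_derivative\<close>, so that inductions on the order can work with whatever
  derivative the calculus rules produce.\<close>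

lemma C_k_SucE:
  assumes "C_k (Suc n) \<phi>"
  obtains \<phi>' where "\<And>z. (\<phi> has_derivative \<phi>' z) (at z)" "\<And>v. C_k n (\<lambda>z. \<phi>' z v)"
proof
  show "(\<phi> has_derivative frechet_derivative \<phi> (at z)) (at z)" for z
    using assms by (auto simp: differentiable_on_def frechet_derivative_works)
  show "C_k n (\<lambda>z. frechet_derivative \<phi> (at z) v)" for v
    using assms by simp
qed

lemma C_k_Suc_D: "C_k (Suc n) \<phi> \<Longrightarrow> C_k n \<phi>"
proof (induction n arbitrary: \<phi>)
  case 0
  then show ?case by (auto intro: differentiable_imp_continuous_on)
next
  case (Suc n)
  then show ?case by (metis C_k.simps(2))
qed

lemma C_k_const: "C_k n (\<lambda>z. c)"
proof (induction n arbitrary: c)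
  case (Suc n)
  then show ?case by (intro C_k_SucI[where \<phi>' = "\<lambda>_ _. 0"]) auto
qed simp

lemma C_k_bounded_linear:
  assumes "bounded_linear l" shows "C_k n l"
proof (cases n)
  case 0
  then show ?thesis using assms by (simp add: linear_continuous_on)
next
  case (Suc k)
  then show ?thesis
    using C_k_SucI[of l "\<lambda>_. l" k] assms C_k_const bounded_linear_imp_has_derivative by blast
qed

lemma C_k_add:
  assumes "C_k n \<phi>" "C_k n \<psi>" shows "C_k n (\<lambda>z. \<phi> z + \<psi> z)"
  using assms
proof (induction n arbitrary: \<phi> \<psi>)
  case 0
  then show ?case by (auto intro: continuous_on_add)
next
  case (Suc n)
  obtain \<phi>' where 1: "\<And>z. (\<phi> has_derivative \<phi>' z) (at z)" "\<And>v. C_k n (\<lambda>z. \<phi>' z v)"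
    using Suc.prems(1) by (rule C_k_SucE) blast
  obtain \<psi>' where 2: "\<And>z. (\<psi> has_derivative \<psi>' z) (at z)" "\<And>v. C_k n (\<lambda>z. \<psi>' z v)"
    using Suc.prems(2) by (rule C_k_SucE) blast
  show ?case
    by (rule C_k_SucI[where \<phi>' = "\<lambda>z v. \<phi>' z v + \<psi>' z v"])
       (auto intro!: has_derivative_add Suc.IH 1 2)
qed

lemma C_k_mult:
  assumes "C_k n \<phi>" "C_k n \<psi>" shows "C_k n (\<lambda>z. \<phi> z * \<psi> z)"
  using assms
proof (induction n arbitrary: \<phi> \<psi>)
  case 0
  then show ?case by (auto intro: continuous_on_mult)
next
  case (Suc n)
  obtain \<phi>' where 1: "\<And>z. (\<phi> has_derivative \<phi>' z) (at z)" "\<And>v. C_k n (\<lambda>z. \<phi>' z v)"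
    using Suc.prems(1) by (rule C_k_SucE) blast
  obtain \<psi>' where 2: "\<And>z. (\<psi> has_derivative \<psi>' z) (at z)" "\<And>v. C_k n (\<lambda>z. \<psi>' z v)"
    using Suc.prems(2) by (rule C_k_SucE) blast
  \<comment> \<open>The product rule leaves one factor undifferentiated in each term. The induction
    hypothesis wants it at order \<open>n\<close> only, which \<open>C_k_Suc_D\<close>
    provides.\<close>
  show ?case
    by (rule C_k_SucI[where \<phi>' = "\<lambda>z v. \<phi> z * \<psi>' z v + \<phi>' z v * \<psi> z"])
       (auto intro!: has_derivative_mult C_k_add Suc.IH 1 2 Suc.prems[THEN C_k_Suc_D])
qed

text \<open>A smooth function is given together with all its derivatives. The chain rule then
  becomes an induction on the order with arbitrary \<open>i\<close>, since the derivative of a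
  member is again a member.\<close>

definition smooth_seq :: "(nat \<Rightarrow> real \<Rightarrow> real) \<Rightarrow> bool" where
  "smooth_seq F \<longleftrightarrow> (\<forall>i x. (F i has_real_derivative F (Suc i) x) (at x))"

lemma C_k_smooth_compose:
  assumes F: "smooth_seq F" and G: "C_k n G"
  shows "C_k n (\<lambda>z. F i (G z))"
  using G
proof (induction n arbitrary: i)
  case 0
  have "continuous_on UNIV (F i)"
    using F by (intro DERIV_continuous_on[where D = "F (Suc i)"]) (simp add: smooth_seq_def)
  then show ?case
    using 0 continuous_on_compose2[of UNIV "F i" UNIV G] by simp
next
  case (Suc n)
  obtain G' where G': "\<And>z. (G has_derivative G' z) (at z)" "\<And>v. C_k n (\<lambda>z. G' z v)"
    using Suc.prems by (rule C_k_SucE) blast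
  have "(F i has_derivative (\<lambda>v. v * F (Suc i) x)) (at x)" for x
    using F by (simp add: smooth_seq_def has_field_derivative_def mult_commute_abs)
  then have "((\<lambda>z. F i (G z)) has_derivative (\<lambda>v. G' z v * F (Suc i) (G z))) (at z)" for z
    using has_derivative_compose[OF G'(1)] by blast
  then show ?case
    by (rule C_k_SucI) (intro C_k_mult G' Suc.IH C_k_Suc_D[OF Suc.prems])
qed

lemma C_k_compose_linear:
  fixes \<phi> :: "'b::euclidean_space \<Rightarrow> real" and l :: "'a::euclidean_space \<Rightarrow> 'b"
  assumes l: "bounded_linear l" and "C_k n \<phi>"
  shows "C_k n (\<lambda>z. \<phi> (l z))"
  using assms(2)
proof (induction n arbitrary: \<phi>)
  case 0
  then show ?case
    using continuous_on_compose2[OF _ linear_continuous_on[OF l], of UNIV \<phi>] by simp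
next
  case (Suc n)
  obtain \<phi>' where 1: "\<And>z. (\<phi> has_derivative \<phi>' z) (at z)" "\<And>v. C_k n (\<lambda>z. \<phi>' z v)"
    using Suc.prems by (rule C_k_SucE) blast
  have "((\<lambda>z. \<phi> (l z)) has_derivative (\<lambda>v. \<phi>' (l z) (l v))) (at z)" for z
    using has_derivative_compose[OF bounded_linear_imp_has_derivative[OF l] 1(1)] .
  then show ?case
    by (rule C_k_SucI) (intro Suc.IH 1)
qed

lemma C_k_poly:
  assumes "C_k n G" shows "C_k n (\<lambda>z. poly p (G z))"
proof -
  have "smooth_seq (\<lambda>i. poly ((pderiv ^^ i) p))"
    by (auto simp: smooth_seq_def poly_DERIV)
  from C_k_smooth_compose[OF this assms, of 0] show ?thesis by simp
qed

text \<open>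
  Functions of this form are closed under differentiation, which makes \<open>exp (-1/x)\<close> smooth at \<open>0\<close>.
\<close>

definition flat_poly :: "real poly \<Rightarrow> real \<Rightarrow> real" where
  "flat_poly p x = (if x \<le> 0 then 0 else poly p (1 / x) * exp (- (1 / x)))"

text \<open>With y = 1/x, the derivative of p(y) exp(-y) with respect to x is y^2 (p(y) - p'(y))
  exp(-y).\<close>

definition flat_op :: "real poly \<Rightarrow> real poly" where
  "flat_op p = monom 1 2 * (p - pderiv p)"

lemma tendsto_poly_mult_exp_neg: "((\<lambda>y::real. poly p y * exp (- y)) \<longlongrightarrow> 0) at_top"
proof -
  have "((\<lambda>y::real. \<Sum>i\<le>degree p. coeff p i * (y ^ i / exp y)) \<longlongrightarrow> (\<Sum>i\<le>degree p. coeff p i * 0)) at_top"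
    by (intro tendsto_intros tendsto_power_div_exp_0)
  then show ?thesis
    by (simp add: poly_altdef sum_distrib_right exp_minus divide_inverse mult.assoc)
qed

text \<open>This is the difference quotient at 0. Dividing by x multiplies the polynomial in 1/x by
  its variable, whence \<open>pCons 0 p\<close>, and the exponential still dominates.\<close>

lemma flat_poly_over_tendsto: "((\<lambda>x. flat_poly p x / x) \<longlongrightarrow> 0) (at 0)"
proof -
  have *: "((\<lambda>y. poly (pCons 0 p) y * exp (- y)) \<longlongrightarrow> 0) at_top"
    by (rule tendsto_poly_mult_exp_neg)
  have "((\<lambda>x. poly (pCons 0 p) (inverse x) * exp (- inverse x)) \<longlongrightarrow> 0) (at_right (0::real))"
    using filterlim_compose[OF * filterlim_inverse_at_top_right] .
  moreover have "\<forall>\<^sub>F x::real in at_right 0.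
      poly (pCons 0 p) (inverse x) * exp (- inverse x) = flat_poly p x / x"
    by (auto simp: eventually_at_filter flat_poly_def field_simps intro!: always_eventually)
  ultimately have r: "((\<lambda>x. flat_poly p x / x) \<longlongrightarrow> 0) (at_right 0)"
    by (rule Lim_transform_eventually)
  have "\<forall>\<^sub>F x::real in at_left 0. 0 = flat_poly p x / x"
    by (auto simp: eventually_at_filter flat_poly_def intro!: always_eventually)
  then have "((\<lambda>x. flat_poly p x / x) \<longlongrightarrow> 0) (at_left 0)"
    by (rule Lim_transform_eventually[OF tendsto_const])
  with r show ?thesis
    using filterlim_split_at_real by blast
qed

lemma flat_poly_DERIV: "(flat_poly p has_real_derivative flat_poly (flat_op p) x) (at x)"
proof -
  consider "x < 0" | "x = 0" | "x > 0" by linarith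
  then show ?thesis
  proof cases
    case 1
    have "((\<lambda>_. 0) has_real_derivative 0) (at x)" by simp
    moreover have "\<forall>\<^sub>F y in nhds x. y \<in> {..<0}"
      using 1 by (intro eventually_nhds_in_open) auto
    then have "\<forall>\<^sub>F y in nhds x. flat_poly p y = 0"
      by eventually_elim (simp add: flat_poly_def)
    ultimately show ?thesis
      using 1 DERIV_cong_ev[of x x "flat_poly p" "\<lambda>_. 0" "flat_poly (flat_op p) x" 0]
      by (simp add: flat_poly_def)
  next
    case 2
    then show ?thesis
      using flat_poly_over_tendsto[of p] by (simp add: DERIV_def flat_poly_def)
  next
    case 3
    have "((\<lambda>x. poly p (1 / x) * exp (- (1 / x))) has_real_derivative flat_poly (flat_op p) x) (at x)"
      using 3
      by (auto intro!: derivative_eq_intros DERIV_chain'[OF _ poly_DERIV]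
          simp: flat_poly_def flat_op_def poly_monom field_simps power2_eq_square)
    moreover have "\<forall>\<^sub>F y in nhds x. y \<in> {0<..}"
      using 3 by (intro eventually_nhds_in_open) auto
    then have "\<forall>\<^sub>F y in nhds x. flat_poly p y = poly p (1 / y) * exp (- (1 / y))"
      by eventually_elim (simp add: flat_poly_def)
    ultimately show ?thesis
      using DERIV_cong_ev[of x x "flat_poly p" "\<lambda>y. poly p (1 / y) * exp (- (1 / y))"] by simp
  qed
qed

definition flat :: "real \<Rightarrow> real" where "flat = flat_poly 1"
definition flat' :: "real \<Rightarrow> real" where "flat' = flat_poly (flat_op 1)"

lemma flat_eq: "flat x = (if x \<le> 0 then 0 else exp (- (1 / x)))"
  by (simp add: flat_def flat_poly_def)

lemma flat'_eq: "flat' x = (if x \<le> 0 then 0 else (1 / x)\<^sup>2 * exp (- (1 / x)))"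
  by (simp add: flat'_def flat_poly_def flat_op_def poly_monom)

lemma flat_DERIV: "(flat has_real_derivative flat' x) (at x)"
  unfolding flat_def flat'_def by (rule flat_poly_DERIV)

lemmas flat_DERIV_chain [derivative_intros] = DERIV_chain'[OF _ flat_DERIV]

lemma C_k_flat: "C_k n G \<Longrightarrow> C_k n (\<lambda>z. flat (G z))"
  using C_k_smooth_compose[of "\<lambda>i. flat_poly ((flat_op ^^ i) 1)" n G 0]
  by (simp add: smooth_seq_def flat_poly_DERIV flat_def)

lemma flat_continuous: "continuous_on S flat"
  by (rule DERIV_continuous_on[OF has_field_derivative_at_within[OF flat_DERIV]])

lemma flat'_continuous: "continuous_on S flat'"
  unfolding flat'_def by (rule DERIV_continuous_on[OF has_field_derivative_at_within[OF flat_poly_DERIV]])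

lemmas flat_continuous_compose [continuous_intros] =
  continuous_on_compose2[OF flat_continuous[of UNIV]]

lemma flat_borel [measurable]: "flat \<in> borel_measurable borel"
  by (intro borel_measurable_continuous_onI flat_continuous)

lemma flat'_borel [measurable]: "flat' \<in> borel_measurable borel"
  by (intro borel_measurable_continuous_onI flat'_continuous)

lemma flat_nonneg [simp]: "0 \<le> flat x" and flat_le_1 [simp]: "flat x \<le> 1"
  and flat_pos_iff [simp]: "0 < flat x \<longleftrightarrow> 0 < x" and flat_eq_0_iff [simp]: "flat x = 0 \<longleftrightarrow> x \<le> 0"
  by (auto simp: flat_eq)

lemma flat'_nonneg [simp]: "0 \<le> flat' x" and flat'_pos: "0 < x \<Longrightarrow> 0 < flat' x"
  and flat'_eq_0 [simp]: "x \<le> 0 \<Longrightarrow> flat' x = 0"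
  by (auto simp: flat'_eq)

text \<open>With y = 1/x this reads y^2 <= 2 exp y, which the quadratic Taylor bound gives. Any
  uniform bound would do for the dominated limits below.\<close>

lemma flat'_le_2: "flat' x \<le> 2"
proof (cases "x \<le> 0")
  case False
  have "1 + 1 / x + (1 / x)\<^sup>2 / 2 \<le> exp (1 / x)"
    using False by (intro exp_lower_Taylor_quadratic) auto
  then have "(1 / x)\<^sup>2 \<le> 2 * exp (1 / x)"
    using False by (smt (verit) divide_pos_pos field_sum_of_halves)
  then show ?thesis
    using False by (simp add: flat'_eq exp_minus field_simps)
qed (simp add: flat'_eq)

lemma flat_tendsto_1: "filterlim X at_top F \<Longrightarrow> ((\<lambda>i. flat (X i)) \<longlongrightarrow> 1) F"
proof -
  assume X: "filterlim X at_top F"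
  have "((\<lambda>x::real. exp (- (1 / x))) \<longlongrightarrow> exp (- 0)) at_top"
    by (intro tendsto_intros tendsto_divide_0[OF tendsto_const] filterlim_at_top_imp_at_infinity filterlim_ident)
  moreover have "\<forall>\<^sub>F x in at_top. exp (- (1 / x)) = flat x"
    using eventually_gt_at_top[of 0] by eventually_elim (simp add: flat_eq)
  ultimately have "(flat \<longlongrightarrow> 1) at_top"
    using Lim_transform_eventually by fastforce
  from filterlim_compose[OF this X] show ?thesis .
qed

text \<open>Since \<open>flat\<close> approaches 1 only at infinity, a bump never reaches 1. For
  growing \<open>s\<close> it tends to the indicator of the interval, and with small
  \<open>s\<close> on a wide interval its slope is small; both regimes occur below.\<close>

definition bump :: "real \<Rightarrow> real \<Rightarrow> real \<Rightarrow> real \<Rightarrow> real" where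
  "bump c d s x = flat (s * (x - c)) * flat (s * (d - x))"

lemma bump_nonneg [simp]: "0 \<le> bump c d s x" and bump_le_1 [simp]: "bump c d s x \<le> 1"
  by (auto simp: bump_def mult_le_one)

lemma bump_outside: "0 < s \<Longrightarrow> x \<le> c \<or> d \<le> x \<Longrightarrow> bump c d s x = 0"
  by (auto simp: bump_def mult_nonneg_nonpos)

lemma bump_le_indicator: "0 < s \<Longrightarrow> bump c d s x \<le> indicator {c<..<d} x"
  using bump_outside[of s x c d] by (auto simp: indicator_def not_less)

lemma bump_pos: "0 < s \<Longrightarrow> c < x \<Longrightarrow> x < d \<Longrightarrow> 0 < bump c d s x"
  by (auto simp: bump_def)

lemma bump_continuous: "continuous_on S (bump c d s)"
  unfolding bump_def by (intro continuous_intros) auto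

lemma bump_borel [measurable]: "bump c d s \<in> borel_measurable borel"
  by (intro borel_measurable_continuous_onI bump_continuous)

lemma C_k_diff: "C_k n \<phi> \<Longrightarrow> C_k n \<psi> \<Longrightarrow> C_k n (\<lambda>z. \<phi> z - \<psi> z)"
  using C_k_add[of n \<phi> "\<lambda>z. - 1 * \<psi> z"] C_k_mult[OF C_k_const] by fastforce

lemma C_k_bump: "C_k n G \<Longrightarrow> C_k n (\<lambda>z. bump c d s (G z))"
  unfolding bump_def by (intro C_k_mult C_k_flat C_k_diff C_k_const)

definition bump' :: "real \<Rightarrow> real \<Rightarrow> real \<Rightarrow> real \<Rightarrow> real" where
  "bump' c d s x = s * flat' (s * (x - c)) * flat (s * (d - x)) - s * flat' (s * (d - x)) * flat (s * (x - c))"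

lemma bump_DERIV: "(bump c d s has_real_derivative bump' c d s x) (at x)"
  unfolding bump_def bump'_def by (auto intro!: derivative_eq_intros simp: algebra_simps)

lemma bump'_abs_le: "\<bar>bump' c d s x\<bar> \<le> 4 * \<bar>s\<bar>"
proof -
  have "\<bar>s * flat' y * flat z\<bar> \<le> 2 * \<bar>s\<bar>" for y z
  proof -
    have "flat' y * flat z \<le> 2 * 1"
      by (intro mult_mono flat'_le_2) auto
    then have "\<bar>s\<bar> * (flat' y * flat z) \<le> \<bar>s\<bar> * (2 * 1)"
      by (rule mult_left_mono) simp
    then show ?thesis
      by (simp add: abs_mult mult.assoc)
  qed
  from this[of "s * (x - c)" "s * (d - x)"] this[of "s * (d - x)" "s * (x - c)"]
  show ?thesis
    unfolding bump'_def by linarith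
qed

lemmas bump_DERIV_chain [derivative_intros] = DERIV_chain'[OF _ bump_DERIV]

section \<open>Test functions and their derivatives\<close>

lemma test_functionI:
  assumes "\<And>n. C_k n \<phi>" "0 < t0"
    and "\<And>t x y. \<phi> (t, x, y) \<noteq> 0 \<Longrightarrow> t \<in> {t0..t1} \<and> x \<in> {x0..x1} \<and> y \<in> {y0..y1}"
  shows "test_function \<phi>"
proof -
  let ?K = "{t0..t1} \<times> {x0..x1} \<times> {y0..y1}"
  have K: "compact ?K" by (intro compact_Times) auto
  have "closure {z. \<phi> z \<noteq> 0} \<subseteq> ?K"
    using assms(3) by (intro closure_minimal compact_imp_closed[OF K]) auto
  moreover from this have "compact (closure {z. \<phi> z \<noteq> 0})"
    using K by (metis closed_closure compact_Int_closed inf.absorb_iff2)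
  moreover have "?K \<subseteq> half_space"
    using assms(2) by (auto simp: half_space_def)
  ultimately show ?thesis
    using assms(1) unfolding test_function_def by blast
qed

lemma test_function_has_derivative:
  assumes "test_function \<phi>"
  shows "(\<phi> has_derivative frechet_derivative \<phi> (at z)) (at z)"
proof -
  have "C_k (Suc 0) \<phi>" using assms unfolding test_function_def by blast
  then have "\<phi> differentiable at z" by (simp add: differentiable_on_def del: split_paired_All)
  then show ?thesis by (simp add: frechet_derivative_works)
qed

text \<open>Reduces \<open>dt\<close> and \<open>grad_x\<close> of an explicit test function to
  one-variable calculus, by uniqueness of derivatives.\<close>

lemma test_function_partial_derivatives:
  assumes "test_function \<phi>"
  shows "((\<lambda>s. \<phi> (s, x, y)) has_real_derivative dt \<phi> (t, x, y)) (at t)"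
    and "((\<lambda>s. \<phi> (t, s, y)) has_real_derivative fst (grad_x \<phi> (t, x, y))) (at x)"
    and "((\<lambda>s. \<phi> (t, x, s)) has_real_derivative snd (grad_x \<phi> (t, x, y))) (at y)"
proof -
  let ?D = "frechet_derivative \<phi> (at (t, x, y))"
  note D = test_function_has_derivative[OF assms, of "(t, x, y)"]
  interpret D: bounded_linear ?D using D by (rule has_derivative_bounded_linear)
  have "((\<lambda>s. \<phi> (s, x, y)) has_derivative (\<lambda>h. ?D (h, 0, 0))) (at t)"
    by (rule has_derivative_compose[where f = "\<lambda>s. (s, x, y)" and g = \<phi>])
       (auto intro!: derivative_eq_intros D simp: zero_prod_def)
  moreover have "?D (h, 0, 0) = dt \<phi> (t, x, y) * h" for h
    using D.scaleR[of h "(1, 0, 0)"] by (simp add: dt_def)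
  ultimately show "((\<lambda>s. \<phi> (s, x, y)) has_real_derivative dt \<phi> (t, x, y)) (at t)"
    by (simp add: has_field_derivative_def)
  have "((\<lambda>s. \<phi> (t, s, y)) has_derivative (\<lambda>h. ?D (0, h, 0))) (at x)"
    by (rule has_derivative_compose[where f = "\<lambda>s. (t, s, y)" and g = \<phi>])
       (auto intro!: derivative_eq_intros D)
  moreover have "?D (0, h, 0) = fst (grad_x \<phi> (t, x, y)) * h" for h
    using D.scaleR[of h "(0, 1, 0)"] by (simp add: grad_x_def)
  ultimately show "((\<lambda>s. \<phi> (t, s, y)) has_real_derivative fst (grad_x \<phi> (t, x, y))) (at x)"
    by (simp add: has_field_derivative_def)
  have "((\<lambda>s. \<phi> (t, x, s)) has_derivative (\<lambda>h. ?D (0, 0, h))) (at y)"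
    by (rule has_derivative_compose[where f = "\<lambda>s. (t, x, s)" and g = \<phi>])
       (auto intro!: derivative_eq_intros D)
  moreover have "?D (0, 0, h) = snd (grad_x \<phi> (t, x, y)) * h" for h
    using D.scaleR[of h "(0, 0, 1)"] by (simp add: grad_x_def)
  ultimately show "((\<lambda>s. \<phi> (t, x, s)) has_real_derivative snd (grad_x \<phi> (t, x, y))) (at y)"
    by (simp add: has_field_derivative_def)
qed

lemma test_function_derivatives_continuous:
  assumes "test_function \<phi>"
  shows "continuous_on UNIV (dt \<phi>)" "continuous_on UNIV (grad_x \<phi>)"
proof -
  have "C_k (Suc 0) \<phi>" using assms unfolding test_function_def by blast
  then have "\<forall>v. continuous_on UNIV (\<lambda>z. frechet_derivative \<phi> (at z) v)"
    by (simp del: split_paired_All)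
  then show "continuous_on UNIV (dt \<phi>)" "continuous_on UNIV (grad_x \<phi>)"
    unfolding dt_def[abs_def] grad_x_def[abs_def] by (auto intro!: continuous_on_Pair)
qed

lemma test_function_derivatives_bounded:
  assumes \<phi>: "test_function \<phi>"
  obtains B where "\<And>z. \<bar>dt \<phi> z\<bar> \<le> B" "\<And>z. \<bar>fst (grad_x \<phi> z)\<bar> \<le> B" "\<And>z. \<bar>snd (grad_x \<phi> z)\<bar> \<le> B"
proof -
  let ?K = "closure {z. \<phi> z \<noteq> 0}"
  have K: "compact ?K" using \<phi> by (simp add: test_function_def)
  have zero: "frechet_derivative \<phi> (at z) = (\<lambda>_. 0)" if "z \<notin> ?K" for z
  proof -
    have "((\<lambda>_. 0) has_derivative (\<lambda>_. 0)) (at z)" by simp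
    then have "(\<phi> has_derivative (\<lambda>_. 0)) (at z)"
    proof (rule has_derivative_transform_within_open)
      show "open (- ?K)" by (rule open_Compl) simp
      show "0 = \<phi> y" if "y \<in> - ?K" for y
        using that closure_subset[of "{z. \<phi> z \<noteq> 0}"] by auto
    qed (use that in simp)
    from frechet_derivative_at[OF this] show ?thesis by simp
  qed
  have "continuous_on UNIV (\<lambda>z. (dt \<phi> z, grad_x \<phi> z))"
    using test_function_derivatives_continuous[OF \<phi>] by (rule continuous_on_Pair)
  then have "continuous_on ?K (\<lambda>z. (dt \<phi> z, grad_x \<phi> z))"
    by (rule continuous_on_subset) simp
  from compact_imp_bounded[OF compact_continuous_image[OF this K]]
  have "\<exists>B. \<forall>x\<in>?K. norm (dt \<phi> x, grad_x \<phi> x) \<le> B"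
    unfolding bounded_iff by (simp only: ball_simps)
  then obtain B where B: "\<And>z. z \<in> ?K \<Longrightarrow> norm (dt \<phi> z, grad_x \<phi> z) \<le> B"
    by blast
  have le: "\<bar>dt \<phi> z\<bar> \<le> B" "norm (grad_x \<phi> z) \<le> B" if "z \<in> ?K" for z
    using order_trans[OF norm_fst_le B[OF that]] order_trans[OF norm_snd_le B[OF that]] by simp_all
  have c: "\<bar>fst p\<bar> \<le> norm p" "\<bar>snd p\<bar> \<le> norm p" for p :: "real \<times> real"
    using norm_fst_le[of "fst p" "snd p"] norm_snd_le[of "snd p" "fst p"] by simp_all
  \<comment> \<open>The support may be empty, and then nothing prevents \<open>B\<close> from being
    negative.\<close>
  show ?thesis
  proof (rule that[of "max B 0"])
    fix z
    show "\<bar>dt \<phi> z\<bar> \<le> max B 0"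
      using le(1)[of z] zero[of z] by (cases "z \<in> ?K") (auto simp: dt_def)
    have "norm (grad_x \<phi> z) \<le> max B 0"
      using le(2)[of z] zero[of z] by (cases "z \<in> ?K") (auto simp: grad_x_def)
    then show "\<bar>fst (grad_x \<phi> z)\<bar> \<le> max B 0" "\<bar>snd (grad_x \<phi> z)\<bar> \<le> max B 0"
      using c[of "grad_x \<phi> z"] by linarith+
  qed
qed

section \<open>Finite signed measures\<close>

lemma signed_measure_sums:
  assumes "signed_measure \<nu>" "range A \<subseteq> sets borel" "disjoint_family A"
  shows "(\<lambda>i. \<nu> (A i)) sums \<nu> (\<Union>i. A i)"
  using assms unfolding signed_measure_def by blast

lemma signed_measure_empty:
  assumes "signed_measure \<nu>" shows "\<nu> {} = 0"
proof -
  have "(\<lambda>i::nat. \<nu> {}) sums \<nu> (\<Union>i::nat. {})"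
    by (rule signed_measure_sums[OF assms]) (auto simp: disjoint_family_on_def)
  then show ?thesis
    using sums_summable summable_const_iff by blast
qed

lemma signed_measure_Un:
  assumes \<nu>: "signed_measure \<nu>" and "A \<in> sets borel" "B \<in> sets borel" "A \<inter> B = {}"
  shows "\<nu> (A \<union> B) = \<nu> A + \<nu> B"
proof -
  have "(\<lambda>i. \<nu> (binaryset A B i)) sums \<nu> (\<Union>i. binaryset A B i)"
    using assms(2-4)
    by (intro signed_measure_sums[OF \<nu>]) (auto simp: range_binaryset_eq disjoint_family_on_def binaryset_def)
  moreover have "(\<lambda>i. \<nu> (binaryset A B i)) sums (\<nu> A + \<nu> B)"
    by (rule binaryset_sums) (rule signed_measure_empty[OF \<nu>])
  ultimately show ?thesis
    by (simp add: UN_binaryset_eq sums_unique2)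
qed

lemma signed_measure_Diff:
  assumes "signed_measure \<nu>" and "A \<in> sets borel" "B \<in> sets borel" "B \<subseteq> A"
  shows "\<nu> (A - B) = \<nu> A - \<nu> B"
proof -
  have "\<nu> (B \<union> (A - B)) = \<nu> B + \<nu> (A - B)"
    using assms by (intro signed_measure_Un) auto
  moreover have "B \<union> (A - B) = A" using assms(4) by blast
  ultimately show ?thesis by simp
qed

lemma signed_measure_uminus: "signed_measure \<nu> \<Longrightarrow> signed_measure (\<lambda>A. - \<nu> A)"
  unfolding signed_measure_def using sums_minus by blast

text \<open>
  If \<open>\<nu>\<close> were unbounded, one could split off disjoint sets of mass at least \<open>1\<close> in absolute value
  for ever, contradicting the convergence of the series of their masses.
\<close>

lemma signed_measure_bounded:
  assumes \<nu>: "signed_measure (\<nu> :: 'a::topological_space set \<Rightarrow> real)"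
  obtains K where "\<And>A. A \<in> sets borel \<Longrightarrow> \<bar>\<nu> A\<bar> \<le> K"
proof -
  define unb where "unb E \<longleftrightarrow> (\<forall>K. \<exists>B\<in>sets borel. B \<subseteq> E \<and> K < \<bar>\<nu> B\<bar>)" for E
  have split: "\<exists>E'. (E' \<in> sets borel \<and> unb E') \<and> E' \<subseteq> E \<and> 1 \<le> \<bar>\<nu> (E - E')\<bar>"
    if E: "E \<in> sets borel \<and> unb E" for E
  proof -
    \<comment> \<open>The margin \<open>1 + \<bar>\<nu> E\<bar>\<close> gives both \<open>A\<close>
      and \<open>E - A\<close> a mass of at least 1 in absolute value. Whichever of them stays
      unbounded is kept, and the other one is split off.\<close>
    obtain A where A: "A \<in> sets borel" "A \<subseteq> E" "1 + \<bar>\<nu> E\<bar> < \<bar>\<nu> A\<bar>"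
      using E unfolding unb_def by blast
    have AE: "\<nu> (E - A) = \<nu> E - \<nu> A" and EA: "E - (E - A) = A"
      using signed_measure_Diff[OF \<nu>] A E by auto
    show ?thesis
    proof (cases "unb (E - A)")
      case True
      then show ?thesis using A E EA AE by (intro exI[of _ "E - A"]) auto
    next
      case False
      then obtain K where K: "\<And>B. B \<in> sets borel \<Longrightarrow> B \<subseteq> E - A \<Longrightarrow> \<bar>\<nu> B\<bar> \<le> K"
        unfolding unb_def by (meson not_le)
      have "unb A"
        unfolding unb_def
      proof
        fix L
        obtain B where B: "B \<in> sets borel" "B \<subseteq> E" "L + K < \<bar>\<nu> B\<bar>"
          using E unfolding unb_def by blast
        have "\<nu> ((B \<inter> A) \<union> (B - A)) = \<nu> (B \<inter> A) + \<nu> (B - A)"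
          using A B by (intro signed_measure_Un[OF \<nu>]) auto
        moreover have "(B \<inter> A) \<union> (B - A) = B" by blast
        ultimately have "\<nu> B = \<nu> (B \<inter> A) + \<nu> (B - A)" by simp
        moreover have "\<bar>\<nu> (B - A)\<bar> \<le> K" using A B by (intro K) auto
        ultimately have "L < \<bar>\<nu> (B \<inter> A)\<bar>" using B(3) by linarith
        then show "\<exists>B\<in>sets borel. B \<subseteq> A \<and> L < \<bar>\<nu> B\<bar>"
          using A B by (intro bexI[of _ "B \<inter> A"]) auto
      qed
      then show ?thesis using A E AE by (intro exI[of _ A]) auto
    qed
  qed
  have "\<not> unb UNIV"
  proof
    assume "unb UNIV"
    then have "\<exists>E. \<forall>n. (E n \<in> sets borel \<and> unb (E n)) \<and> E (Suc n) \<subseteq> E n \<and> 1 \<le> \<bar>\<nu> (E n - E (Suc n))\<bar>"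
      using split by (intro dependent_nat_choice) auto
    then obtain E where E: "\<And>n. E n \<in> sets borel" "\<And>n. E (Suc n) \<subseteq> E n"
      "\<And>n. 1 \<le> \<bar>\<nu> (E n - E (Suc n))\<bar>" by blast
    have dec: "E n \<subseteq> E m" if "m \<le> n" for m n
      using that E(2) by (rule lift_Suc_antimono_le[rotated])
    have "(E m - E (Suc m)) \<inter> (E n - E (Suc n)) = {}" if "m < n" for m n
      using dec[of "Suc m" n] that by auto
    then have "disjoint_family (\<lambda>n. E n - E (Suc n))"
      unfolding disjoint_family_on_def by (metis Int_commute linorder_neqE_nat)
    then have "(\<lambda>n. \<nu> (E n - E (Suc n))) sums \<nu> (\<Union>n. E n - E (Suc n))"
      using E(1) by (intro signed_measure_sums[OF \<nu>]) auto
    then have "(\<lambda>n. \<nu> (E n - E (Suc n))) \<longlonglongrightarrow> 0"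
      using sums_summable summable_LIMSEQ_zero by blast
    then have "\<forall>\<^sub>F n in sequentially. dist (\<nu> (E n - E (Suc n))) 0 < 1"
      by (rule tendstoD) simp
    then obtain n where "\<bar>\<nu> (E n - E (Suc n))\<bar> < 1"
      by (auto simp: eventually_sequentially)
    then show False using E(3)[of n] by simp
  qed
  then show ?thesis
    using that unfolding unb_def by (meson not_le subset_UNIV)
qed

section \<open>Jordan decomposition\<close>

lemma sets_pos_variation [simp, measurable_cong]: "sets (pos_variation \<nu>) = sets borel"
  and space_pos_variation [simp]: "space (pos_variation \<nu>) = UNIV"
  unfolding pos_variation_def
  using sets.sigma_sets_eq[of borel] by (simp_all add: sets_measure_of_conv space_measure_of_conv)

lemma sets_neg_variation [simp, measurable_cong]: "sets (neg_variation \<nu>) = sets borel"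
  and space_neg_variation [simp]: "space (neg_variation \<nu>) = UNIV"
  by (simp_all add: neg_variation_def)

text \<open>\<open>measure_of\<close> yields the intended values only once the supremum is known to
  be countably additive. Uniting competitors in disjoint sets gives superadditivity, and cutting one
  competitor along the family gives the reverse inequality.\<close>

lemma emeasure_pos_variation:
  assumes \<nu>: "signed_measure \<nu>" and "A \<in> sets borel"
  shows "emeasure (pos_variation \<nu>) A = (SUP B\<in>{B \<in> sets borel. B \<subseteq> A}. ennreal (\<nu> B))"
proof -
  define v where "v A = (SUP B\<in>{B \<in> sets borel. B \<subseteq> A}. ennreal (\<nu> B))" for A
  have upper: "ennreal (\<nu> B) \<le> v A" if "B \<in> sets borel" "B \<subseteq> A" for A B
    unfolding v_def using that by (intro SUP_upper) auto
  have v_empty: "v {} = 0"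
    unfolding v_def by (intro antisym SUP_least) (auto simp: signed_measure_empty[OF \<nu>])
  have v_mono: "v A \<le> v B" if "A \<subseteq> B" for A B
    unfolding v_def using that by (intro SUP_subset_mono) auto
  have v_super: "v A + v B \<le> v (A \<union> B)" if "A \<inter> B = {}" for A B
  proof -
    have *: "ennreal (\<nu> C) + ennreal (\<nu> D) \<le> v (A \<union> B)"
      if "C \<in> sets borel" "D \<in> sets borel" "C \<subseteq> A" "D \<subseteq> B" for C D
    \<comment> \<open>If one value is negative, \<open>ennreal\<close> truncates it to 0 and the sum
      may exceed the value at \<open>C \<union> D\<close>. The other set alone is then the right
      competitor.\<close>
    proof (cases "\<nu> C \<le> 0 \<or> \<nu> D \<le> 0")
      case True
      then show ?thesis
        using upper[of C "A \<union> B"] upper[of D "A \<union> B"] that by (auto simp: ennreal_neg le_supI1 le_supI2)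
    next
      case False
      then have "ennreal (\<nu> C) + ennreal (\<nu> D) = ennreal (\<nu> (C \<union> D))"
        using that \<open>A \<inter> B = {}\<close> by (subst signed_measure_Un[OF \<nu>]) (auto simp: ennreal_plus)
      then show ?thesis
        using that upper[of "C \<union> D" "A \<union> B"] by auto
    qed
    have ne: "{C \<in> sets borel. C \<subseteq> E} \<noteq> {}" for E :: "'a set" by auto
    have "v A + v B = (SUP C\<in>{C \<in> sets borel. C \<subseteq> A}. ennreal (\<nu> C) + v B)"
      unfolding v_def[of A] by (rule ennreal_SUP_add_left[OF ne, symmetric])
    also have "\<dots> = (SUP C\<in>{C \<in> sets borel. C \<subseteq> A}. SUP D\<in>{D \<in> sets borel. D \<subseteq> B}.
        ennreal (\<nu> C) + ennreal (\<nu> D))"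
      unfolding v_def[of B] by (simp only: ennreal_SUP_add_right[OF ne])
    also have "\<dots> \<le> v (A \<union> B)"
      by (intro SUP_least) (auto intro: *)
    finally show ?thesis .
  qed
  have "countably_additive (sets borel) v"
    unfolding countably_additive_def
  proof (intro allI impI)
    fix A :: "nat \<Rightarrow> 'a set"
    assume A: "range A \<subseteq> sets borel" "disjoint_family A"
    have "(\<Sum>i<n. v (A i)) \<le> v (\<Union>i<n. A i)" for n
    proof (induction n)
      case (Suc n)
      have "A i \<inter> A n = {}" if "i < n" for i
        using A(2) that by (intro disjoint_family_onD[of A UNIV]) auto
      then have "(\<Union>i<n. A i) \<inter> A n = {}" by blast
      from v_super[OF this] Suc show ?case
        using order_trans[OF add_left_mono[OF Suc, of "v (A n)"]]
        by (simp add: lessThan_Suc Un_commute add.commute)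
    qed (simp add: v_empty)
    then have "(\<Sum>i<n. v (A i)) \<le> v (\<Union>i. A i)" for n
      using v_mono[of "\<Union>i<n. A i" "\<Union>i. A i"] order_trans by blast
    then have 1: "(\<Sum>i. v (A i)) \<le> v (\<Union>i. A i)"
      by (intro suminf_le_const) auto
    have 2: "v (\<Union>i. A i) \<le> (\<Sum>i. v (A i))"
      unfolding v_def[of "\<Union>i. A i"]
    proof (intro SUP_least)
      fix B assume "B \<in> {B \<in> sets borel. B \<subseteq> (\<Union>i. A i)}"
      then have B: "B \<in> sets borel" "(\<Union>i. B \<inter> A i) = B" by auto
      have "(\<lambda>i. \<nu> (B \<inter> A i)) sums \<nu> (\<Union>i. B \<inter> A i)"
        using A B by (intro signed_measure_sums[OF \<nu>]) (auto simp: disjoint_family_on_def)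
      then have "(\<lambda>n. ennreal (\<Sum>i<n. \<nu> (B \<inter> A i))) \<longlonglongrightarrow> ennreal (\<nu> B)"
        unfolding B sums_def by (rule tendsto_ennrealI)
      then show "ennreal (\<nu> B) \<le> (\<Sum>i. v (A i))"
      proof (rule LIMSEQ_le_const2, intro exI allI impI)
        fix n :: nat
        \<comment> \<open>Because of the truncation, \<open>ennreal\<close> is only subadditive on
          real sums of mixed sign; this is the direction required here.\<close>
        have "ennreal (\<Sum>i<n. \<nu> (B \<inter> A i)) \<le> (\<Sum>i<n. ennreal (\<nu> (B \<inter> A i)))"
        proof (induction n)
          case (Suc n)
          have "ennreal (x + y) \<le> ennreal x + ennreal y" for x y
            by (cases "0 \<le> x"; cases "0 \<le> y") (auto simp: ennreal_plus ennreal_neg intro!: ennreal_leI)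
          from this[of "\<Sum>i<n. \<nu> (B \<inter> A i)" "\<nu> (B \<inter> A n)"] show ?case
            using order_trans[OF _ add_right_mono[OF Suc, of "ennreal (\<nu> (B \<inter> A n))"]] by simp
        qed simp
        also have "\<dots> \<le> (\<Sum>i<n. v (A i))"
          using A B by (intro sum_mono upper) auto
        also have "\<dots> \<le> (\<Sum>i. v (A i))"
          by (intro sum_le_suminf) auto
        finally show "ennreal (\<Sum>i<n. \<nu> (B \<inter> A i)) \<le> (\<Sum>i. v (A i))" .
      qed
    qed
    from 1 2 show "(\<Sum>i. v (A i)) = v (\<Union>i. A i)" by (rule antisym)
  qed
  then have cadd: "countably_additive (sets (pos_variation \<nu>)) v" by simp
  have "emeasure (pos_variation \<nu>) A = v A"
  proof (rule emeasure_measure_of[OF _ _ _ cadd])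
    show "pos_variation \<nu> = measure_of UNIV (sets borel) v"
      unfolding pos_variation_def v_def[abs_def] ..
    show "positive (sets (pos_variation \<nu>)) v" by (simp add: positive_def v_empty)
  qed (use assms(2) in auto)
  then show ?thesis unfolding v_def .
qed

lemma finite_measure_pos_variation:
  assumes "signed_measure \<nu>" shows "finite_measure (pos_variation \<nu>)"
proof -
  obtain K where "\<And>A. A \<in> sets borel \<Longrightarrow> \<bar>\<nu> A\<bar> \<le> K"
    using signed_measure_bounded[OF assms] by blast
  then have "emeasure (pos_variation \<nu>) UNIV \<le> ennreal K"
    by (subst emeasure_pos_variation[OF assms]) (auto intro!: SUP_least ennreal_leI dest: abs_le_D1)
  then show ?thesis
    by (intro finite_measureI) (auto simp: top_unique)
qed

lemma pos_variation_upper: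
  assumes "signed_measure \<nu>" "A \<in> sets borel" "B \<in> sets borel" "B \<subseteq> A"
  shows "\<nu> B \<le> measure (pos_variation \<nu>) A"
proof -
  interpret finite_measure "pos_variation \<nu>" by (rule finite_measure_pos_variation) fact
  have "ennreal (\<nu> B) \<le> emeasure (pos_variation \<nu>) A"
    using assms by (subst emeasure_pos_variation) (auto intro: SUP_upper)
  then show ?thesis
    using measure_nonneg[of "pos_variation \<nu>" A] unfolding emeasure_eq_measure ennreal_le_iff2 by linarith
qed

lemma pos_variation_least:
  assumes "signed_measure \<nu>" "A \<in> sets borel" "0 \<le> K"
    and "\<And>B. B \<in> sets borel \<Longrightarrow> B \<subseteq> A \<Longrightarrow> \<nu> B \<le> K"
  shows "measure (pos_variation \<nu>) A \<le> K"
proof -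
  have "emeasure (pos_variation \<nu>) A \<le> ennreal K"
    using assms by (subst emeasure_pos_variation) (auto intro!: SUP_least ennreal_leI)
  then show ?thesis
    using assms(3) by (simp add: enn2real_leI measure_def)
qed

text \<open>For \<open>B\<close> inside \<open>A\<close>, the value at \<open>B\<close> is that at
  \<open>A\<close> minus that at \<open>A - B\<close>, hence at most \<open>\<nu> A\<close> plus the
  negative variation of \<open>A\<close>. The supremum over \<open>B\<close> gives one inequality,
  and the same argument for \<open>-\<nu>\<close> gives the other.\<close>

lemma signed_measure_eq_variations:
  assumes \<nu>: "signed_measure \<nu>" and A: "A \<in> sets borel"
  shows "\<nu> A = measure (pos_variation \<nu>) A - measure (neg_variation \<nu>) A"
proof -
  have le: "measure (pos_variation \<mu>) A \<le> \<mu> A + measure (pos_variation (\<lambda>A. - \<mu> A)) A"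
    if \<mu>: "signed_measure \<mu>" for \<mu>
  proof (rule pos_variation_least[OF \<mu> A])
    have \<mu>': "signed_measure (\<lambda>A. - \<mu> A)" by (rule signed_measure_uminus) fact
    show "0 \<le> \<mu> A + measure (pos_variation (\<lambda>A. - \<mu> A)) A"
      using pos_variation_upper[OF \<mu>' A A] by simp
    show "\<mu> B \<le> \<mu> A + measure (pos_variation (\<lambda>A. - \<mu> A)) A" if "B \<in> sets borel" "B \<subseteq> A" for B
      using pos_variation_upper[OF \<mu>' A, of "A - B"] signed_measure_Diff[OF \<mu> A that] that A by auto
  qed
  show ?thesis
    using le[OF \<nu>] le[OF signed_measure_uminus[OF \<nu>]] by (simp add: neg_variation_def)
qed

section \<open>Measures carried by the axis\<close>

lemma measurable_axis [measurable]: "(\<lambda>y. (0::real, y::real)) \<in> borel_measurable borel"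
  by (intro borel_measurable_continuous_onI continuous_intros)

lemma signed_measure_delta_axis:
  assumes g: "signed_measure g" shows "signed_measure (delta_axis g)"
  unfolding signed_measure_def
proof (intro allI impI)
  fix A :: "nat \<Rightarrow> (real \<times> real) set"
  assume A: "range A \<subseteq> sets borel" "disjoint_family A"
  have "(\<lambda>y. (0, y)) -` A i \<in> sets borel" for i
    using measurable_sets[OF measurable_axis, of "A i"] A(1) by auto
  then have "(\<lambda>i. g ((\<lambda>y. (0, y)) -` A i)) sums g (\<Union>i. (\<lambda>y. (0, y)) -` A i)"
    using A(2) by (intro signed_measure_sums[OF g]) (auto simp: disjoint_family_on_def)
  moreover have "(\<Union>i. (\<lambda>y. (0, y)) -` A i) = {y. (0, y) \<in> (\<Union>i. A i)}" by auto
  ultimately show "(\<lambda>i. delta_axis g (A i)) sums delta_axis g (\<Union>i. A i)"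
    by (simp only: delta_axis_def vimage_def)
qed

text \<open>Both suprema run over the same values: slicing at x1 = 0 maps the Borel subsets of
  \<open>A\<close> onto those of its slice, a preimage of \<open>B\<close> being the part of
  \<open>A\<close> that lies over \<open>B\<close>.\<close>

lemma pos_variation_delta_axis:
  assumes g: "signed_measure g"
  shows "pos_variation (delta_axis g) = distr (pos_variation g) borel (\<lambda>y. (0, y))"
proof (rule measure_eqI)
  fix A assume "A \<in> sets (pos_variation (delta_axis g))"
  then have A: "A \<in> sets borel" by simp
  then have A': "(\<lambda>y. (0, y)) -` A \<in> sets borel"
    using measurable_sets[OF measurable_axis, of A] by auto
  have img: "(\<lambda>B. {y. (0, y) \<in> B}) ` {B \<in> sets borel. B \<subseteq> A} = {B \<in> sets borel. B \<subseteq> (\<lambda>y. (0, y)) -` A}"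
  proof (intro equalityI subsetI)
    fix B assume "B \<in> {B \<in> sets borel. B \<subseteq> (\<lambda>y. (0, y)) -` A}"
    then have B: "B \<in> sets borel" "B \<subseteq> (\<lambda>y. (0, y)) -` A" by auto
    have "snd \<in> borel_measurable (borel :: (real \<times> real) measure)"
      by (intro borel_measurable_continuous_onI continuous_intros)
    from measurable_sets[OF this B(1)] have "(snd -` B :: (real \<times> real) set) \<in> sets borel"
      by simp
    then show "B \<in> (\<lambda>B. {y. (0, y) \<in> B}) ` {B \<in> sets borel. B \<subseteq> A}"
      using A B by (intro image_eqI[of _ _ "A \<inter> snd -` B"]) auto
  next
    fix C assume "C \<in> (\<lambda>B. {y. (0, y) \<in> B}) ` {B \<in> sets borel. B \<subseteq> A}"
    then obtain B where B: "B \<in> sets borel" "B \<subseteq> A" "C = (\<lambda>y. (0, y)) -` B"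
      by (auto simp: vimage_def)
    then show "C \<in> {B \<in> sets borel. B \<subseteq> (\<lambda>y. (0, y)) -` A}"
      using measurable_sets[OF measurable_axis, of B] by auto
  qed
  have "(SUP B\<in>{B \<in> sets borel. B \<subseteq> A}. ennreal (delta_axis g B)) =
      (SUP B\<in>{B \<in> sets borel. B \<subseteq> (\<lambda>y. (0, y)) -` A}. ennreal (g B))"
    unfolding img[symmetric] image_image delta_axis_def ..
  then show "emeasure (pos_variation (delta_axis g)) A =
      emeasure (distr (pos_variation g) borel (\<lambda>y. (0, y))) A"
    using A A' measurable_axis
    by (subst emeasure_distr)
       (auto simp: emeasure_pos_variation[OF g] emeasure_pos_variation[OF signed_measure_delta_axis[OF g]]
          measurable_cong_sets[OF sets_pos_variation refl])
qed simp

lemma neg_variation_delta_axis: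
  assumes "signed_measure g"
  shows "neg_variation (delta_axis g) = distr (neg_variation g) borel (\<lambda>y. (0, y))"
  using pos_variation_delta_axis[OF signed_measure_uminus[OF assms]]
  by (simp add: neg_variation_def delta_axis_def[abs_def])

lemma signed_integral_delta_axis:
  assumes "signed_measure g" and "\<psi> \<in> borel_measurable borel"
  shows "signed_integral (delta_axis g) \<psi> = signed_integral g (\<lambda>y. \<psi> (0, y))"
  using assms measurable_axis
  by (simp add: signed_integral_def pos_variation_delta_axis neg_variation_delta_axis integral_distr
      measurable_cong_sets[OF sets_pos_variation refl] measurable_cong_sets[OF sets_neg_variation refl])

lemma tv_norm_delta_axis:
  assumes "signed_measure g" shows "tv_norm (delta_axis g) = tv_norm g"
  using assms measurable_axis
  by (simp add: tv_norm_def pos_variation_delta_axis neg_variation_delta_axis measure_distr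
      measurable_cong_sets[OF sets_pos_variation refl] measurable_cong_sets[OF sets_neg_variation refl])

section \<open>Scaling and self-similarity\<close>

text \<open>One interface for the dilations of time, of space and of space-time, with Jacobian
  \<open>k\<close>. The right inverse \<open>T'\<close> carries measurability of the composite back
  to \<open>f\<close>, so that \<open>integral_scale\<close> holds for all functions: both sides are
  0 by convention when \<open>f\<close> is not measurable.\<close>

locale lborel_scaling =
  fixes T T' :: "'a::euclidean_space \<Rightarrow> 'a" and k :: real
  assumes T [measurable]: "T \<in> borel_measurable borel"
    and T' [measurable]: "T' \<in> borel_measurable borel"
    and T_T' [simp]: "\<And>x. T (T' x) = x"
    and k_pos: "0 < k"
    and lborel_eq: "lborel = density (distr lborel borel T) (\<lambda>_. ennreal k)"
begin

lemma AE_scale: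
  assumes "AE x in lborel. P x" shows "AE x in lborel. P (T x)"
proof -
  have "AE x in density (distr lborel borel T) (\<lambda>_. ennreal k). P x"
    using assms unfolding lborel_eq[symmetric] .
  then have "AE x in distr lborel borel T. P x"
    using k_pos by (subst (asm) AE_density) auto
  then show ?thesis
    by (rule AE_distrD[rotated]) simp
qed

lemma borel_measurable_scale:
  assumes "(\<lambda>x. f (T x)) \<in> borel_measurable borel" shows "f \<in> borel_measurable borel"
  using measurable_compose[OF T' assms] by simp

lemma integrable_scale:
  fixes f :: "'a \<Rightarrow> real"
  assumes "f \<in> borel_measurable borel"
  shows "integrable lborel f \<longleftrightarrow> integrable lborel (\<lambda>x. f (T x))"
proof -
  have "integrable lborel f \<longleftrightarrow> integrable (density (distr lborel borel T) (\<lambda>_. ennreal k)) f"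
    by (subst lborel_eq) (rule refl)
  also have "\<dots> \<longleftrightarrow> integrable lborel (\<lambda>x. k *\<^sub>R f (T x))"
    using assms k_pos by (subst integrable_density) (auto simp: integrable_distr_eq)
  finally show ?thesis using k_pos by simp
qed

lemma integral_scale:
  fixes f :: "'a \<Rightarrow> real"
  shows "integral\<^sup>L lborel f = k * (\<integral>x. f (T x) \<partial>lborel)"
proof (cases "f \<in> borel_measurable borel")
  case True
  have "integral\<^sup>L lborel f = integral\<^sup>L (density (distr lborel borel T) (\<lambda>_. ennreal k)) f"
    by (subst lborel_eq) (rule refl)
  also have "\<dots> = (\<integral>x. k *\<^sub>R f (T x) \<partial>lborel)"
    using True k_pos by (subst integral_density) (auto simp: integral_distr)
  finally show ?thesis by simp
next
  case False
  moreover have "h \<in> borel_measurable borel" if "integrable lborel h" for h :: "'a \<Rightarrow> real"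
    using borel_measurable_integrable[OF that] by simp
  ultimately have "\<not> integrable lborel f" "\<not> integrable lborel (\<lambda>x. f (T x))"
    using borel_measurable_scale[of f] by blast+
  then show ?thesis by (simp add: not_integrable_integral_eq)
qed

end

section \<open>The dilations of the equation\<close>

lemma lborel_scaling_real:
  "0 < \<mu> \<Longrightarrow> lborel_scaling (\<lambda>t::real. \<mu> * t) (\<lambda>t. t / \<mu>) \<mu>"
  using lborel_affine_euclidean[of "\<lambda>_::real. \<mu>" 0]
  by unfold_locales (auto simp: mult.commute)

definition scale2 :: "real \<Rightarrow> real \<times> real \<Rightarrow> real \<times> real" where
  "scale2 \<mu> x = (sqrt \<mu> * fst x, snd x)"

definition scale3 :: "real \<Rightarrow> real \<times> real \<times> real \<Rightarrow> real \<times> real \<times> real" where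
  "scale3 \<mu> z = (\<mu> * fst z, scale2 \<mu> (snd z))"

lemma linear_scale2: "bounded_linear (scale2 \<mu>)" and linear_scale3: "bounded_linear (scale3 \<mu>)"
  unfolding scale2_def[abs_def] scale3_def[abs_def]
  by (auto intro!: bounded_linear_Pair bounded_linear_const_mult bounded_linear_fst bounded_linear_snd
      bounded_linear_compose[OF bounded_linear_fst bounded_linear_snd]
      bounded_linear_compose[OF bounded_linear_snd bounded_linear_snd])

lemma scale2_measurable [measurable]: "scale2 \<mu> \<in> borel_measurable borel"
  and scale3_measurable [measurable]: "scale3 \<mu> \<in> borel_measurable borel"
  using linear_scale2 linear_scale3
  by (auto intro!: borel_measurable_continuous_onI linear_continuous_on)

lemma scale2_inverse: "0 < \<mu> \<Longrightarrow> scale2 \<mu> (scale2 (1 / \<mu>) x) = x" "0 < \<mu> \<Longrightarrow> scale2 (1 / \<mu>) (scale2 \<mu> x) = x"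
  by (auto simp: scale2_def real_sqrt_divide)

lemma scale3_inverse: "0 < \<mu> \<Longrightarrow> scale3 \<mu> (scale3 (1 / \<mu>) z) = z" "0 < \<mu> \<Longrightarrow> scale3 (1 / \<mu>) (scale3 \<mu> z) = z"
  by (auto simp: scale3_def scale2_inverse)

lemma lborel_scaling_2:
  assumes "0 < \<mu>" shows "lborel_scaling (scale2 \<mu>) (scale2 (1 / \<mu>)) (sqrt \<mu>)"
proof
  define c :: "real \<times> real \<Rightarrow> real" where "c j = (if j = (1, 0) then sqrt \<mu> else 1)" for j
  have B: "(Basis :: (real \<times> real) set) = {(1, 0), (0, 1)}"
    by (auto simp: Basis_prod_def)
  have "(\<lambda>x. 0 + (\<Sum>j\<in>Basis. (c j * (x \<bullet> j)) *\<^sub>R j)) = scale2 \<mu>"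
    by (auto simp: B c_def scale2_def)
  moreover have "(\<Prod>j\<in>Basis. \<bar>c j\<bar>) = sqrt \<mu>"
    using assms by (auto simp: B c_def)
  moreover have "\<And>j. j \<in> Basis \<Longrightarrow> c j \<noteq> 0"
    using assms by (auto simp: c_def)
  ultimately show "lborel = density (distr lborel borel (scale2 \<mu>)) (\<lambda>_. ennreal (sqrt \<mu>))"
    using lborel_affine_euclidean[of c 0] by simp
qed (use assms in \<open>auto simp: scale2_inverse\<close>)

lemma lborel_scaling_3:
  assumes "0 < \<mu>" shows "lborel_scaling (scale3 \<mu>) (scale3 (1 / \<mu>)) (\<mu> * sqrt \<mu>)"
proof
  define c :: "real \<times> real \<times> real \<Rightarrow> real"
    where "c j = (if j = (1, 0, 0) then \<mu> else if j = (0, 1, 0) then sqrt \<mu> else 1)" for j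
  have B: "(Basis :: (real \<times> real \<times> real) set) = {(1, 0, 0), (0, 1, 0), (0, 0, 1)}"
    by (auto simp: Basis_prod_def zero_prod_def)
  have "(\<lambda>x. 0 + (\<Sum>j\<in>Basis. (c j * (x \<bullet> j)) *\<^sub>R j)) = scale3 \<mu>"
    by (auto simp: B c_def scale2_def scale3_def)
  moreover have "(\<Prod>j\<in>Basis. \<bar>c j\<bar>) = \<mu> * sqrt \<mu>"
    using assms by (auto simp: B c_def)
  moreover have "\<And>j. j \<in> Basis \<Longrightarrow> c j \<noteq> 0"
    using assms by (auto simp: c_def)
  ultimately show "lborel = density (distr lborel borel (scale3 \<mu>)) (\<lambda>_. ennreal (\<mu> * sqrt \<mu>))"
    using lborel_affine_euclidean[of c 0] by simp
qed (use assms in \<open>auto simp: scale3_inverse\<close>)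

text \<open>The support is the image of the old one under the inverse dilation, an injective linear
  map that carries closures to closures and the half space into itself.\<close>

lemma test_function_scale3:
  assumes \<phi>: "test_function \<phi>" and "0 < \<mu>"
  shows "test_function (\<lambda>z. \<phi> (scale3 \<mu> z))"
proof -
  let ?T = "scale3 \<mu>" and ?S = "scale3 (1 / \<mu>)"
  have "{z. \<phi> (?T z) \<noteq> 0} = ?S ` {z. \<phi> z \<noteq> 0}"
    using scale3_inverse[OF \<open>0 < \<mu>\<close>] by (auto intro!: image_eqI[of _ ?S "?T _"])
  moreover have "closure (?S ` {z. \<phi> z \<noteq> 0}) = ?S ` closure {z. \<phi> z \<noteq> 0}"
    using linear_scale3 scale3_inverse[OF \<open>0 < \<mu>\<close>]
    by (intro closure_injective_linear_image[symmetric])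
       (auto simp: bounded_linear.linear intro: inj_on_inverseI[of _ ?T])
  moreover have "compact (?S ` closure {z. \<phi> z \<noteq> 0})"
    using \<phi> linear_scale3
    by (intro compact_continuous_image linear_continuous_on) (auto simp: test_function_def)
  moreover have "?S ` half_space \<subseteq> half_space"
    using \<open>0 < \<mu>\<close> by (auto simp: half_space_def scale3_def)
  ultimately show ?thesis
    using \<phi> C_k_compose_linear[OF linear_scale3]
    unfolding test_function_def by (metis (no_types, lifting) image_mono order_trans)
qed

lemma frechet_derivative_scale3:
  assumes "test_function \<phi>"
  shows "frechet_derivative (\<lambda>z. \<phi> (scale3 \<mu> z)) (at z) v =
    frechet_derivative \<phi> (at (scale3 \<mu> z)) (scale3 \<mu> v)"
proof -
  have "((\<lambda>z. \<phi> (scale3 \<mu> z)) has_derivative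
      (\<lambda>v. frechet_derivative \<phi> (at (scale3 \<mu> z)) (scale3 \<mu> v))) (at z)"
    by (rule has_derivative_compose[OF bounded_linear_imp_has_derivative[OF linear_scale3]
          test_function_has_derivative[OF assms]])
  from frechet_derivative_at[OF this] show ?thesis by metis
qed

lemma derivatives_scale3:
  assumes \<phi>: "test_function \<phi>"
  shows "dt (\<lambda>z. \<phi> (scale3 \<mu> z)) z = \<mu> * dt \<phi> (scale3 \<mu> z)"
    and "fst (grad_x (\<lambda>z. \<phi> (scale3 \<mu> z)) z) = sqrt \<mu> * fst (grad_x \<phi> (scale3 \<mu> z))"
    and "snd (grad_x (\<lambda>z. \<phi> (scale3 \<mu> z)) z) = snd (grad_x \<phi> (scale3 \<mu> z))"
proof -
  interpret D: bounded_linear "frechet_derivative \<phi> (at (scale3 \<mu> z))"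
    using test_function_has_derivative[OF \<phi>] by (rule has_derivative_bounded_linear)
  have "scale3 \<mu> (1, 0, 0) = \<mu> *\<^sub>R (1, 0, 0)" "scale3 \<mu> (0, 1, 0) = sqrt \<mu> *\<^sub>R (0, 1, 0)"
    "scale3 \<mu> (0, 0, 1) = (0, 0, 1)"
    by (simp_all add: scale3_def scale2_def)
  then show "dt (\<lambda>z. \<phi> (scale3 \<mu> z)) z = \<mu> * dt \<phi> (scale3 \<mu> z)"
    and "fst (grad_x (\<lambda>z. \<phi> (scale3 \<mu> z)) z) = sqrt \<mu> * fst (grad_x \<phi> (scale3 \<mu> z))"
    and "snd (grad_x (\<lambda>z. \<phi> (scale3 \<mu> z)) z) = snd (grad_x \<phi> (scale3 \<mu> z))"
    by (simp_all only: dt_def grad_x_def frechet_derivative_scale3[OF \<phi>] D.scaleR fst_conv snd_conv real_scaleR_def)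
qed

definition rescale :: "real \<Rightarrow> field2 \<Rightarrow> field2" where
  "rescale \<mu> u t x = sqrt \<mu> * u (\<mu> * t) (scale2 \<mu> x)"

lemma indicator_half_space_scale3:
  "0 < \<mu> \<Longrightarrow> indicator half_space (scale3 \<mu> z) = indicator half_space z"
  by (cases z) (auto simp: half_space_def scale3_def indicator_def zero_less_mult_iff)

lemma rescale_eq: "(case z of (t, x) \<Rightarrow> rescale \<mu> u t x) = sqrt \<mu> * (case scale3 \<mu> z of (t, x) \<Rightarrow> u t x)"
  by (cases z) (simp add: rescale_def scale3_def)

lemma set_integral_half_space_scale:
  assumes "0 < \<mu>" and "\<And>z. F z = \<mu> * sqrt \<mu> * G (scale3 \<mu> z)"
  shows "set_lebesgue_integral lborel half_space F = set_lebesgue_integral lborel half_space G"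
proof -
  interpret lborel_scaling "scale3 \<mu>" "scale3 (1 / \<mu>)" "\<mu> * sqrt \<mu>"
    by (rule lborel_scaling_3) fact
  show ?thesis
    unfolding set_lebesgue_integral_def
    by (subst (2) integral_scale) (simp add: assms indicator_half_space_scale3 mult.left_commute mult.assoc)
qed

text \<open>The time derivative times u, the x1 derivative times u^2 and the x2 derivative times u^3
  all pick up the factor \<open>\<mu> * sqrt \<mu>\<close>, which is exactly the Jacobian of
  \<open>scale3 \<mu>\<close>. Constants scale like u, so the entropy inequality for
  \<open>k\<close> comes from the one for \<open>k / sqrt \<mu>\<close>.\<close>

lemma entropy_solution_rescale:
  assumes u: "entropy_solution u" and \<mu>: "0 < \<mu>"
  shows "entropy_solution (rescale \<mu> u)"
  unfolding entropy_solution_def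
proof (intro conjI allI impI)
  interpret S: lborel_scaling "scale3 \<mu>" "scale3 (1 / \<mu>)" "\<mu> * sqrt \<mu>"
    by (rule lborel_scaling_3) fact
  have s: "sqrt \<mu> * sqrt \<mu> = \<mu>" "0 < sqrt \<mu>" using \<mu> by auto
  have [measurable]: "(\<lambda>z. indicator half_space z *\<^sub>R (case z of (t, x) \<Rightarrow> u t x)) \<in> borel_measurable borel"
    using u by (simp add: entropy_solution_def set_borel_measurable_def)
  have "(\<lambda>z. sqrt \<mu> * (indicator half_space (scale3 \<mu> z) *\<^sub>R (case scale3 \<mu> z of (t, x) \<Rightarrow> u t x)))
      \<in> borel_measurable borel"
    by measurable
  then show "set_borel_measurable lborel half_space (\<lambda>(t, x). rescale \<mu> u t x)"
    by (simp add: set_borel_measurable_def rescale_eq indicator_half_space_scale3[OF \<mu>] mult.left_commute)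
  show "\<exists>C. AE (t, x) in lborel. t > \<tau> \<longrightarrow> \<bar>rescale \<mu> u t x\<bar> \<le> C" if "0 < \<tau>" for \<tau>
  proof -
    have "\<forall>\<tau>>0. \<exists>C. AE (t, x) in lborel. t > \<tau> \<longrightarrow> \<bar>u t x\<bar> \<le> C"
      using u unfolding entropy_solution_def by blast
    from this[rule_format, OF mult_pos_pos[OF \<mu> that]]
    obtain C where C: "AE z in lborel. fst z > \<mu> * \<tau> \<longrightarrow> \<bar>u (fst z) (snd z)\<bar> \<le> C"
      by (auto simp: split_beta)
    from S.AE_scale[OF C] have "AE z in lborel. fst z > \<tau> \<longrightarrow> \<bar>rescale \<mu> u (fst z) (snd z)\<bar> \<le> sqrt \<mu> * C"
    proof eventually_elim
      case (elim z)
      then show ?case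
        using \<mu> mult_left_mono[of "\<bar>u (\<mu> * fst z) (scale2 \<mu> (snd z))\<bar>" C "sqrt \<mu>"]
        by (auto simp: scale3_def rescale_def abs_mult)
    qed
    then show ?thesis unfolding split_beta by blast
  qed
  fix \<phi> assume \<phi>: "test_function \<phi>"
  define \<eta> where "\<eta> z = \<phi> (scale3 (1 / \<mu>) z)" for z
  have \<eta>: "test_function \<eta>"
    unfolding \<eta>_def using \<phi> \<mu> by (intro test_function_scale3) auto
  have eq: "\<phi> = (\<lambda>z. \<eta> (scale3 \<mu> z))"
    by (simp add: \<eta>_def scale3_inverse \<mu>)
  show "set_lebesgue_integral lborel half_space
      (\<lambda>(t, x). rescale \<mu> u t x * dt \<phi> (t, x) + flux (rescale \<mu> u t x) \<bullet> grad_x \<phi> (t, x)) = 0"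
  proof -
    let ?G = "\<lambda>(t, x). u t x * dt \<eta> (t, x) + flux (u t x) \<bullet> grad_x \<eta> (t, x)"
    have "set_lebesgue_integral lborel half_space
      (\<lambda>(t, x). rescale \<mu> u t x * dt \<phi> (t, x) + flux (rescale \<mu> u t x) \<bullet> grad_x \<phi> (t, x)) =
      set_lebesgue_integral lborel half_space ?G"
    proof (rule set_integral_half_space_scale[OF \<mu>])
      fix z :: "real \<times> real \<times> real"
      obtain t x where z: "z = (t, x)" by (cases z)
      define w where "w = u (\<mu> * t) (scale2 \<mu> x)"
      have "rescale \<mu> u t x * dt \<phi> z + flux (rescale \<mu> u t x) \<bullet> grad_x \<phi> z =
        (sqrt \<mu> * w) * (\<mu> * dt \<eta> (scale3 \<mu> z)) + ((sqrt \<mu> * w)\<^sup>2 / 2) * (sqrt \<mu> * fst (grad_x \<eta> (scale3 \<mu> z)))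
        + ((sqrt \<mu> * w) ^ 3 / 3) * snd (grad_x \<eta> (scale3 \<mu> z))"
        unfolding eq derivatives_scale3[OF \<eta>] inner_prod_def
        by (simp add: rescale_def w_def flux_def)
      also have "\<dots> = \<mu> * sqrt \<mu> * (w * dt \<eta> (scale3 \<mu> z) + w\<^sup>2 / 2 * fst (grad_x \<eta> (scale3 \<mu> z))
        + w ^ 3 / 3 * snd (grad_x \<eta> (scale3 \<mu> z)))"
        using s by (simp add: power_mult_distrib power3_eq_cube power2_eq_square algebra_simps)
      also have "\<dots> = \<mu> * sqrt \<mu> * ?G (scale3 \<mu> z)"
        by (simp add: z scale3_def w_def flux_def inner_prod_def)
      finally show "(case z of (t, x) \<Rightarrow> rescale \<mu> u t x * dt \<phi> (t, x) + flux (rescale \<mu> u t x) \<bullet> grad_x \<phi> (t, x)) =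
        \<mu> * sqrt \<mu> * ?G (scale3 \<mu> z)"
        by (simp add: z)
    qed
    also have "\<dots> = 0"
      using u \<eta> unfolding entropy_solution_def by blast
    finally show ?thesis .
  qed
  fix k :: real assume nn: "\<forall>z. \<phi> z \<ge> 0"
  show "set_lebesgue_integral lborel half_space
          (\<lambda>(t, x). \<bar>rescale \<mu> u t x - k\<bar> * dt \<phi> (t, x)
             + sgn (rescale \<mu> u t x - k) * ((flux (rescale \<mu> u t x) - flux k) \<bullet> grad_x \<phi> (t, x))) \<ge> 0"
  proof -
    define l where "l = k / sqrt \<mu>"
    have k: "k = sqrt \<mu> * l" using s by (simp add: l_def)
    let ?G = "\<lambda>(t, x). \<bar>u t x - l\<bar> * dt \<eta> (t, x)
             + sgn (u t x - l) * ((flux (u t x) - flux l) \<bullet> grad_x \<eta> (t, x))"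
    have "set_lebesgue_integral lborel half_space
          (\<lambda>(t, x). \<bar>rescale \<mu> u t x - k\<bar> * dt \<phi> (t, x)
             + sgn (rescale \<mu> u t x - k) * ((flux (rescale \<mu> u t x) - flux k) \<bullet> grad_x \<phi> (t, x))) =
      set_lebesgue_integral lborel half_space ?G"
    proof (rule set_integral_half_space_scale[OF \<mu>])
      fix z :: "real \<times> real \<times> real"
      obtain t x where z: "z = (t, x)" by (cases z)
      define w where "w = u (\<mu> * t) (scale2 \<mu> x)"
      have d: "sqrt \<mu> * w - k = sqrt \<mu> * (w - l)" by (simp add: k algebra_simps)
      have "\<bar>rescale \<mu> u t x - k\<bar> * dt \<phi> z
             + sgn (rescale \<mu> u t x - k) * ((flux (rescale \<mu> u t x) - flux k) \<bullet> grad_x \<phi> z) =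
        sqrt \<mu> * \<bar>w - l\<bar> * (\<mu> * dt \<eta> (scale3 \<mu> z)) + sgn (w - l) *
        (((sqrt \<mu> * w)\<^sup>2 / 2 - (sqrt \<mu> * l)\<^sup>2 / 2) * (sqrt \<mu> * fst (grad_x \<eta> (scale3 \<mu> z)))
        + ((sqrt \<mu> * w) ^ 3 / 3 - (sqrt \<mu> * l) ^ 3 / 3) * snd (grad_x \<eta> (scale3 \<mu> z)))"
        unfolding eq derivatives_scale3[OF \<eta>] inner_prod_def rescale_def w_def[symmetric] d
        using s by (simp add: flux_def abs_mult sgn_mult k)
      also have "\<dots> = \<mu> * sqrt \<mu> * (\<bar>w - l\<bar> * dt \<eta> (scale3 \<mu> z) + sgn (w - l) * ((w\<^sup>2 / 2 - l\<^sup>2 / 2) * fst (grad_x \<eta> (scale3 \<mu> z))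
        + (w ^ 3 / 3 - l ^ 3 / 3) * snd (grad_x \<eta> (scale3 \<mu> z))))"
        using s by (simp add: power_mult_distrib power3_eq_cube power2_eq_square algebra_simps)
      also have "\<dots> = \<mu> * sqrt \<mu> * ?G (scale3 \<mu> z)"
        by (simp add: z scale3_def w_def flux_def inner_prod_def)
      finally show "(case z of (t, x) \<Rightarrow> \<bar>rescale \<mu> u t x - k\<bar> * dt \<phi> (t, x)
             + sgn (rescale \<mu> u t x - k) * ((flux (rescale \<mu> u t x) - flux k) \<bullet> grad_x \<phi> (t, x))) =
        \<mu> * sqrt \<mu> * ?G (scale3 \<mu> z)"
        by (simp add: z)
    qed
    moreover have "\<dots> \<ge> 0"
      using u \<eta> nn unfolding entropy_solution_def \<eta>_def by blast
    ultimately show ?thesis by simp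
  qed
qed

text \<open>A dilation pulls null sets back to null sets and right neighbourhoods of 0 back to right
  neighbourhoods of 0, which are the two ingredients of the essential limit.\<close>

lemma filterlim_scale_ess_at_right:
  fixes \<mu> :: real
  assumes \<mu>: "0 < \<mu>"
  shows "filterlim (\<lambda>t. \<mu> * t) (inf (at_right 0) (ae_filter lborel)) (inf (at_right 0) (ae_filter lborel))"
  unfolding filterlim_iff
proof (intro allI impI)
  interpret lborel_scaling "\<lambda>t. \<mu> * t" "\<lambda>t. t / \<mu>" \<mu>
    by (rule lborel_scaling_real) fact
  fix P :: "real \<Rightarrow> bool" assume "\<forall>\<^sub>F t in inf (at_right 0) (ae_filter lborel). P t"
  then obtain Q R where Q: "\<forall>\<^sub>F t in at_right (0::real). Q t" and R: "AE t in lborel. R t"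
    and P: "\<And>t. Q t \<Longrightarrow> R t \<Longrightarrow> P t"
    unfolding eventually_inf by blast
  obtain b where b: "0 < b" "\<And>t. 0 < t \<Longrightarrow> t < b \<Longrightarrow> Q t"
    using Q eventually_at_right[of 0 "1::real" Q] by auto
  have "\<forall>\<^sub>F t in at_right 0. Q (\<mu> * t)"
    using b \<mu> eventually_at_right[of 0 "1::real" "\<lambda>t. Q (\<mu> * t)"]
    by (auto simp: field_simps intro!: exI[of _ "b / \<mu>"])
  moreover have "AE t in lborel. R (\<mu> * t)"
    using R by (rule AE_scale)
  ultimately show "\<forall>\<^sub>F t in inf (at_right 0) (ae_filter lborel). P (\<mu> * t)"
    unfolding eventually_inf using P by blast
qed

text \<open>The factor \<open>sqrt \<mu>\<close> in front of u is the Jacobian of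
  \<open>scale2 \<mu>\<close>, so the L1 norm is preserved. The datum is invariant because the
  dilation fixes every point of the axis.\<close>

lemma admissible_solution_rescale:
  assumes u: "admissible_solution (delta_axis g) u" and g: "signed_measure g" and \<mu>: "0 < \<mu>"
  shows "admissible_solution (delta_axis g) (rescale \<mu> u)"
  unfolding admissible_solution_def
proof (intro conjI)
  interpret T: lborel_scaling "\<lambda>t. \<mu> * t" "\<lambda>t. t / \<mu>" \<mu>
    by (rule lborel_scaling_real) fact
  interpret X: lborel_scaling "scale2 \<mu>" "scale2 (1 / \<mu>)" "sqrt \<mu>"
    by (rule lborel_scaling_2) fact
  show "entropy_solution (rescale \<mu> u)"
    using u \<mu> by (simp add: admissible_solution_def entropy_solution_rescale)
  obtain C where "AE t in lborel. t > 0 \<longrightarrow> integrable lborel (u t) \<and> L1_norm (u t) \<le> C"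
    using u unfolding admissible_solution_def by blast
  from T.AE_scale[OF this]
  have "AE t in lborel. t > 0 \<longrightarrow> integrable lborel (rescale \<mu> u t) \<and> L1_norm (rescale \<mu> u t) \<le> C"
  proof eventually_elim
    case (elim t)
    show ?case
    proof
      assume "t > 0"
      then have i: "integrable lborel (u (\<mu> * t))" and n: "L1_norm (u (\<mu> * t)) \<le> C"
        using elim \<mu> by auto
      have "integrable lborel (\<lambda>x. u (\<mu> * t) (scale2 \<mu> x))"
        using i borel_measurable_integrable[OF i] by (subst X.integrable_scale[symmetric]) auto
      moreover have "L1_norm (rescale \<mu> u t) = L1_norm (u (\<mu> * t))"
        using \<mu> by (subst (2) X.integral_scale) (simp add: rescale_def abs_mult)
      ultimately show "integrable lborel (rescale \<mu> u t) \<and> L1_norm (rescale \<mu> u t) \<le> C"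
        using n by (simp add: rescale_def[abs_def])
    qed
  qed
  then show "\<exists>C. AE t in lborel. t > 0 \<longrightarrow> integrable lborel (rescale \<mu> u t) \<and> L1_norm (rescale \<mu> u t) \<le> C"
    by blast
  show "narrow_lim (rescale \<mu> u) (delta_axis g) (inf (at_right 0) (ae_filter lborel))"
    unfolding narrow_lim_def
  proof (intro allI impI)
    fix \<psi> :: "real \<times> real \<Rightarrow> real"
    assume \<psi>: "continuous_on UNIV \<psi>" "bounded (range \<psi>)"
    define \<eta> where "\<eta> x = \<psi> (scale2 (1 / \<mu>) x)" for x
    have \<eta>: "continuous_on UNIV \<eta>" "bounded (range \<eta>)"
      unfolding \<eta>_def using \<psi>(2)
      by (auto intro!: continuous_on_compose2[OF \<psi>(1) linear_continuous_on[OF linear_scale2]]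
          elim!: bounded_subset)
    have "((\<lambda>t. LINT x|lborel. u t x * \<eta> x) \<longlongrightarrow> signed_integral (delta_axis g) \<eta>)
        (inf (at_right 0) (ae_filter lborel))"
      using u \<eta> unfolding admissible_solution_def narrow_lim_def by blast
    from filterlim_compose[OF this filterlim_scale_ess_at_right[OF \<mu>]]
    have "((\<lambda>t. LINT x|lborel. u (\<mu> * t) x * \<eta> x) \<longlongrightarrow> signed_integral (delta_axis g) \<eta>)
        (inf (at_right 0) (ae_filter lborel))" .
    moreover have "(LINT x|lborel. u (\<mu> * t) x * \<eta> x) = (LINT x|lborel. rescale \<mu> u t x * \<psi> x)" for t
      by (subst X.integral_scale)
         (simp add: rescale_def \<eta>_def scale2_inverse \<mu> mult.assoc flip: integral_mult_right_zero)
    moreover have "signed_integral (delta_axis g) \<eta> = signed_integral (delta_axis g) \<psi>"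
      using \<psi> \<eta> by (simp add: signed_integral_delta_axis[OF g] borel_measurable_continuous_onI)
         (simp add: \<eta>_def scale2_def)
    ultimately show "((\<lambda>t. LINT x|lborel. rescale \<mu> u t x * \<psi> x) \<longlongrightarrow> signed_integral (delta_axis g) \<psi>)
        (inf (at_right 0) (ae_filter lborel))"
      by simp
  qed
qed

lemma unique_admissible_solution_self_similar:
  assumes "unique_admissible_solution (delta_axis g) u" and "signed_measure g"
  shows "self_similar u"
  unfolding self_similar_def
proof (intro allI impI)
  fix \<mu> :: real assume "0 < \<mu>"
  then have "AE (t, x) in lborel. t > 0 \<longrightarrow> rescale \<mu> u t x = u t x"
    using assms admissible_solution_rescale unfolding unique_admissible_solution_def by blast
  then show "AE (t, x1, x2) in lborel. t > 0 \<longrightarrow> sqrt \<mu> * u (\<mu> * t) (sqrt \<mu> * x1, x2) = u t (x1, x2)"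
    by (simp add: rescale_def scale2_def split_beta)
qed

section \<open>A moving cutoff function\<close>

text \<open>
  The front \<open>M t\<^bsup>1/2\<^esup>\<close> is replaced by a polynomial, which is smooth on all of \<open>\<real>\<close>. Its speed must
  not be smaller than that of the front.
\<close>

lemma sqrt_upper_polynomial:
  fixes \<tau> T M \<epsilon> :: real
  assumes \<tau>: "0 < \<tau>" and M: "0 \<le> M" and \<epsilon>: "0 < \<epsilon>"
  obtains p :: "real poly" where
    "\<And>t. t \<in> {\<tau>..T} \<Longrightarrow> M / (2 * sqrt t) \<le> poly (pderiv p) t"
    "\<And>t. t \<in> {\<tau>..T} \<Longrightarrow> M * sqrt t \<le> poly p t"
    "\<And>t. t \<in> {\<tau>..T} \<Longrightarrow> poly p t \<le> M * sqrt t + \<epsilon>"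
proof -
  \<comment> \<open>Approximating the speed raised by \<open>\<eta>\<close> to within
    \<open>\<eta>\<close> keeps \<open>q\<close> between the speed and the speed plus
    \<open>2 * \<eta>\<close>. Its antiderivative, started on the front at \<open>\<tau>\<close>,
    then exceeds the front by at most \<open>2 * \<eta> * (T - \<tau>)\<close>. The absolute value
    and the \<open>+ 1\<close> keep \<open>\<eta>\<close> positive also when
    \<open>T \<le> \<tau>\<close>.\<close>
  define \<eta> where "\<eta> = \<epsilon> / (2 * (\<bar>T - \<tau>\<bar> + 1))"
  have "2 * \<eta> * d \<le> \<epsilon>" if "0 \<le> d" "\<eta> = \<epsilon> / (2 * (d + 1))" for d
  proof -
    have "2 * \<eta> * d + 2 * \<eta> = \<epsilon>" using that by (simp add: field_simps)
    moreover have "0 \<le> \<eta>" unfolding that(2) using that(1) \<epsilon> by simp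
    ultimately show ?thesis by linarith
  qed
  then have \<eta>: "0 < \<eta>" "2 * \<eta> * \<bar>T - \<tau>\<bar> \<le> \<epsilon>"
    using \<epsilon> by (auto simp: \<eta>_def intro!: divide_pos_pos add_nonneg_pos)
  have "continuous_on {\<tau>..T} (\<lambda>t. M / (2 * sqrt t) + \<eta>)"
    using \<tau> by (intro continuous_intros) auto
  from Stone_Weierstrass_real_polynomial_function[OF compact_Icc this \<eta>(1)]
  obtain q where q: "real_polynomial_function q"
    "\<And>t. t \<in> {\<tau>..T} \<Longrightarrow> \<bar>M / (2 * sqrt t) + \<eta> - q t\<bar> < \<eta>" by blast
  obtain a n where an: "q = (\<lambda>t. \<Sum>i\<le>n. a i * t ^ i)"
    using q(1) unfolding real_polynomial_function_iff_sum by blast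
  define P where "P = (\<Sum>i\<le>n. monom (a i / real (Suc i)) (Suc i))"
  have "pderiv (\<Sum>i\<le>n. f i) = (\<Sum>i\<le>n. pderiv (f i))" for f :: "nat \<Rightarrow> real poly" and n
    by (induction n) (auto simp: pderiv_add)
  then have P': "poly (pderiv P) t = q t" for t
    by (simp add: P_def an pderiv_monom poly_sum poly_monom del: of_nat_Suc)
  define p where "p = P + [:M * sqrt \<tau> - poly P \<tau>:]"
  have p': "poly (pderiv p) t = q t" and p\<tau>: "poly p \<tau> = M * sqrt \<tau>" for t
    by (simp_all add: p_def pderiv_add P' pderiv_pCons)
  have le: "M / (2 * sqrt t) \<le> q t" "q t \<le> M / (2 * sqrt t) + 2 * \<eta>" if "t \<in> {\<tau>..T}" for t
    using q(2)[OF that] unfolding abs_less_iff by linarith+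
  have D: "((\<lambda>t. poly p t - M * sqrt t) has_real_derivative q t - M / (2 * sqrt t)) (at t)" if "t \<in> {\<tau>..T}" for t
  proof -
    have "0 < t" using that \<tau> by auto
    then show ?thesis
      using p'[of t] by (auto intro!: derivative_eq_intros poly_DERIV[THEN DERIV_cong] simp: field_simps)
  qed
  show ?thesis
  proof
    fix t assume t: "t \<in> {\<tau>..T}"
    show "M / (2 * sqrt t) \<le> poly (pderiv p) t"
      using le[OF t] p' by simp
    have "poly p \<tau> - M * sqrt \<tau> \<le> poly p t - M * sqrt t"
    proof (rule DERIV_nonneg_imp_nondecreasing[where f = "\<lambda>t. poly p t - M * sqrt t"])
      fix s assume "\<tau> \<le> s" "s \<le> t"
      then have "s \<in> {\<tau>..T}" using t by auto
      from D[OF this] le(1)[OF this]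
      show "\<exists>y. ((\<lambda>t. poly p t - M * sqrt t) has_real_derivative y) (at s) \<and> 0 \<le> y"
        by (intro exI conjI) auto
    qed (use t in auto)
    then show "M * sqrt t \<le> poly p t" using p\<tau> by simp
    have "2 * \<eta> * \<tau> - (poly p \<tau> - M * sqrt \<tau>) \<le> 2 * \<eta> * t - (poly p t - M * sqrt t)"
    proof (rule DERIV_nonneg_imp_nondecreasing[where f = "\<lambda>t. 2 * \<eta> * t - (poly p t - M * sqrt t)"])
      fix s assume "\<tau> \<le> s" "s \<le> t"
      then have s: "s \<in> {\<tau>..T}" using t by auto
      have "((\<lambda>t. 2 * \<eta> * t - (poly p t - M * sqrt t)) has_real_derivative 2 * \<eta> * 1 - (q s - M / (2 * sqrt s))) (at s)"
        by (intro DERIV_diff DERIV_cmult DERIV_ident D[OF s])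
      with le(2)[OF s]
      show "\<exists>y. ((\<lambda>t. 2 * \<eta> * t - (poly p t - M * sqrt t)) has_real_derivative y) (at s) \<and> 0 \<le> y"
        by (intro exI conjI) auto
    qed (use t in auto)
    moreover have "2 * \<eta> * (t - \<tau>) \<le> 2 * \<eta> * \<bar>T - \<tau>\<bar>"
      using t \<eta>(1) by (intro mult_left_mono) auto
    ultimately show "poly p t \<le> M * sqrt t + \<epsilon>"
      using p\<tau> \<eta>(2) by (simp add: algebra_simps)
  qed
qed

text \<open>Measurability of \<open>u\<close> is known only on the half space, which contains the
  strip. The uniform bound of the L1 norms over a bounded time interval then makes the iterated
  integral of the absolute value finite.\<close>

lemma integrable_strip:
  fixes u :: field2
  assumes u: "set_borel_measurable lborel half_space (\<lambda>(t, x). u t x)"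
    and C: "AE t in lborel. 0 < t \<longrightarrow> t < T \<longrightarrow> integrable lborel (u t) \<and> L1_norm (u t) \<le> C"
  shows "integrable lborel (\<lambda>z. indicator {0<..<T} (fst z) * u (fst z) (snd z))"
proof -
  let ?f = "\<lambda>z. indicator {0<..<T} (fst z) * u (fst z) (snd z)"
  have W: "(\<lambda>z. indicator half_space z *\<^sub>R (case z of (t, x) \<Rightarrow> u t x)) \<in> borel_measurable borel"
    using u by (simp add: set_borel_measurable_def)
  have "(fst :: real \<times> real \<times> real \<Rightarrow> real) \<in> borel_measurable borel"
    by (intro borel_measurable_continuous_onI continuous_intros)
  then have "(\<lambda>z :: real \<times> real \<times> real. indicator {0<..<T} (fst z) :: real) \<in> borel_measurable borel"
    by (rule measurable_compose) simp
  from borel_measurable_times[OF this W]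
  have "(\<lambda>z. indicator {0<..<T} (fst z) * (indicator half_space z *\<^sub>R (case z of (t, x) \<Rightarrow> u t x))) \<in> borel_measurable borel" .
  moreover have "(\<lambda>z. indicator {0<..<T} (fst z) * (indicator half_space z *\<^sub>R (case z of (t, x) \<Rightarrow> u t x))) = ?f"
    by (auto simp: indicator_def half_space_def fun_eq_iff split: prod.splits)
  ultimately have f: "?f \<in> borel_measurable borel" by simp
  then have [measurable]: "?f \<in> borel_measurable (lborel \<Otimes>\<^sub>M lborel)"
    by (simp add: lborel_prod)
  have "integrable (lborel \<Otimes>\<^sub>M lborel) ?f"
  proof (rule lborel_pair.Fubini_integrable)
    show "integrable lborel (\<lambda>t. \<integral>x. norm (?f (t, x)) \<partial>lborel)"
    proof (rule Bochner_Integration.integrable_bound)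
      show "integrable lborel (\<lambda>t. indicator {0<..<T} t * C)"
        by (intro integrable_mult_left integrable_real_indicator emeasure_bounded_finite) auto
      show "(\<lambda>t. \<integral>x. norm (?f (t, x)) \<partial>lborel) \<in> borel_measurable lborel" by measurable
      show "AE t in lborel. norm (\<integral>x. norm (?f (t, x)) \<partial>lborel) \<le> norm (indicator {0<..<T} t * C)"
        using C by eventually_elim (auto simp: indicator_def abs_mult)
    qed
    show "AE t in lborel. integrable lborel (\<lambda>x. ?f (t, x))"
      using C by eventually_elim (auto simp: indicator_def)
  qed measurable
  then show ?thesis by (simp add: lborel_prod)
qed

text \<open>\<open>kruzhkov_solution\<close> provides continuity in time with values in L1 but no
  bound on the norms; compactness of the time interval supplies one.\<close>

lemma kruzhkov_L1_bounded:
  assumes w: "kruzhkov_solution b w"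
  obtains C where "\<And>t. t \<in> {0..T} \<Longrightarrow> L1_norm (w t) \<le> C"
proof -
  have i: "integrable lborel (w t)" if "0 \<le> t" for t
    using w that unfolding kruzhkov_solution_def by blast
  have "continuous_on {0..} (\<lambda>t. L1_norm (w t))"
    unfolding continuous_on_def
  proof
    fix t :: real assume t: "t \<in> {0..}"
    have lim: "((\<lambda>s. L1_norm (\<lambda>x. w s x - w t x)) \<longlongrightarrow> 0) (at t within {0..})"
      using w t unfolding kruzhkov_solution_def by auto
    have "\<forall>\<^sub>F s in at t within {0..}. norm (L1_norm (w s) - L1_norm (w t)) \<le> L1_norm (\<lambda>x. w s x - w t x)"
    proof -
      have "norm (L1_norm (w s) - L1_norm (w t)) \<le> L1_norm (\<lambda>x. w s x - w t x)" if "0 \<le> s" for s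
      proof -
        have "L1_norm (w s) - L1_norm (w t) = (\<integral>x. \<bar>w s x\<bar> - \<bar>w t x\<bar> \<partial>lborel)"
          using i that t by (subst Bochner_Integration.integral_diff) auto
        also have "norm \<dots> \<le> (\<integral>x. norm (\<bar>w s x\<bar> - \<bar>w t x\<bar>) \<partial>lborel)"
          by (rule integral_norm_bound)
        also have "\<dots> \<le> L1_norm (\<lambda>x. w s x - w t x)"
          using i that t by (intro integral_mono) auto
        finally show ?thesis .
      qed
      then show ?thesis by (auto simp: eventually_at_filter)
    qed
    then have "((\<lambda>s. L1_norm (w s) - L1_norm (w t)) \<longlongrightarrow> 0) (at t within {0..})"
      by (rule Lim_null_comparison) (rule lim)
    then show "((\<lambda>s. L1_norm (w s)) \<longlongrightarrow> L1_norm (w t)) (at t within {0..})"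
      by (simp add: LIM_zero_iff)
  qed
  then have "continuous_on {0..T} (\<lambda>t. L1_norm (w t))"
    by (rule continuous_on_subset) auto
  then have "bounded ((\<lambda>t. L1_norm (w t)) ` {0..T})"
    by (intro compact_imp_bounded compact_continuous_image) auto
  then obtain C where "\<forall>y\<in>(\<lambda>t. L1_norm (w t)) ` {0..T}. norm y \<le> C"
    unfolding bounded_iff by blast
  then show ?thesis
    using that[of C] by auto
qed

text \<open>The steepness 1/n makes the slope O(1/n), so the flux terms in which a derivative falls
  on this cutoff disappear in the limit. The price is the limit \<open>(flat 1)\<^sup>2\<close> in
  place of 1. It is positive and only multiplies an integral that turns out to be zero.\<close>

definition wide_bump :: "nat \<Rightarrow> real \<Rightarrow> real" where
  "wide_bump n = bump (- real n) (real n) (1 / real n)"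

definition wide_bump' :: "nat \<Rightarrow> real \<Rightarrow> real" where
  "wide_bump' n = bump' (- real n) (real n) (1 / real n)"

lemma wide_bump_nonneg [simp]: "0 \<le> wide_bump n x" and wide_bump_le_1 [simp]: "wide_bump n x \<le> 1"
  by (simp_all add: wide_bump_def)

lemma wide_bump_DERIV: "(wide_bump n has_real_derivative wide_bump' n x) (at x)"
  unfolding wide_bump_def wide_bump'_def by (rule bump_DERIV)

lemmas wide_bump_DERIV_chain [derivative_intros] = DERIV_chain'[OF _ wide_bump_DERIV]

lemma wide_bump'_abs_le: "\<bar>wide_bump' n x\<bar> \<le> 4 / real n"
  unfolding wide_bump'_def using bump'_abs_le[of "- real n" "real n" "1 / real n" x] by simp

lemma wide_bump_borel [measurable]: "wide_bump n \<in> borel_measurable borel"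
  unfolding wide_bump_def by measurable

lemma wide_bump_tendsto: "(\<lambda>n. wide_bump n x) \<longlonglongrightarrow> (flat 1)\<^sup>2"
proof -
  have "(\<lambda>n. flat (1 + x / real n) * flat (1 - x / real n)) \<longlonglongrightarrow> flat (1 + 0) * flat (1 - 0)"
    by (intro tendsto_intros isCont_tendsto_compose[OF DERIV_isCont[OF flat_DERIV]] lim_const_over_n)
  moreover have "\<forall>\<^sub>F n in sequentially. flat (1 + x / real n) * flat (1 - x / real n) = wide_bump n x"
    using eventually_gt_at_top[of 0] by eventually_elim (simp add: wide_bump_def bump_def field_simps)
  ultimately show ?thesis
    using Lim_transform_eventually by (fastforce simp: power2_eq_square)
qed

text \<open>
  The factors cut off small times, large times, the region behind the front \<open>x\<^sub>1 = X t\<close> (on the side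
  given by the sign \<open>\<sigma>\<close>), and large \<open>x\<close>.
\<close>

definition cutoff :: "nat \<Rightarrow> real \<Rightarrow> real \<Rightarrow> real poly \<Rightarrow> real \<times> real \<times> real \<Rightarrow> real" where
  "cutoff n T \<sigma> X z = flat (real n * fst z - 1) * flat (T - fst z) *
     flat (\<sigma> * fst (snd z) - poly X (fst z)) * (wide_bump n (fst (snd z)) * wide_bump n (snd (snd z)))"

lemma cutoff_nonneg: "0 \<le> cutoff n T \<sigma> X z"
  by (simp add: cutoff_def)

lemma C_k_coordinates:
  "C_k k (\<lambda>z :: real \<times> real \<times> real. fst z)" "C_k k (\<lambda>z :: real \<times> real \<times> real. fst (snd z))"
  "C_k k (\<lambda>z :: real \<times> real \<times> real. snd (snd z))"
  by (auto intro!: C_k_bounded_linear bounded_linear_fst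
      bounded_linear_compose[OF bounded_linear_fst bounded_linear_snd]
      bounded_linear_compose[OF bounded_linear_snd bounded_linear_snd])

lemma test_function_cutoff:
  assumes "1 \<le> n" shows "test_function (cutoff n T \<sigma> X)"
proof (rule test_functionI)
  show "C_k k (cutoff n T \<sigma> X)" for k
    unfolding cutoff_def[abs_def] wide_bump_def
    by (intro C_k_mult C_k_flat C_k_diff C_k_const C_k_bump C_k_poly C_k_coordinates)
  show "0 < 1 / real n" using assms by simp
  fix t x y assume "cutoff n T \<sigma> X (t, x, y) \<noteq> 0"
  then have "0 < real n * t - 1" "0 < T - t" "wide_bump n x \<noteq> 0" "wide_bump n y \<noteq> 0"
    by (auto simp: cutoff_def not_le)
  moreover have "x \<in> {- real n..real n}" if "wide_bump n x \<noteq> 0" for x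
  proof -
    have "\<not> (x \<le> - real n \<or> real n \<le> x)"
      using that bump_outside[of "1 / real n" x "- real n" "real n"] assms unfolding wide_bump_def by auto
    then show ?thesis by auto
  qed
  ultimately show "t \<in> {1 / real n..T} \<and> x \<in> {- real n..real n} \<and> y \<in> {- real n..real n}"
    using assms by (auto simp: field_simps)
qed

lemma cutoff_derivatives:
  fixes T \<sigma> t x y :: real and X :: "real poly"
  assumes "1 \<le> n"
  defines "A \<equiv> flat (real n * t - 1)" and "D \<equiv> flat (T - t)"
    and "F \<equiv> flat (\<sigma> * x - poly X t)" and "F' \<equiv> flat' (\<sigma> * x - poly X t)"
  shows "dt (cutoff n T \<sigma> X) (t, x, y) =
      ((real n * flat' (real n * t - 1) * D - A * flat' (T - t)) * F
        - A * D * F' * poly (pderiv X) t) * (wide_bump n x * wide_bump n y)"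
    and "fst (grad_x (cutoff n T \<sigma> X) (t, x, y)) =
      A * D * (\<sigma> * F' * wide_bump n x + F * wide_bump' n x) * wide_bump n y"
    and "snd (grad_x (cutoff n T \<sigma> X) (t, x, y)) = A * D * F * (wide_bump n x * wide_bump' n y)"
proof -
  note test = test_function_cutoff[OF assms(1), of T \<sigma> X]
  have "((\<lambda>s. cutoff n T \<sigma> X (s, x, y)) has_real_derivative
      ((real n * flat' (real n * t - 1) * D - A * flat' (T - t)) * F
        - A * D * F' * poly (pderiv X) t) * (wide_bump n x * wide_bump n y)) (at t)"
    unfolding cutoff_def A_def D_def F_def F'_def fst_conv snd_conv
    by (auto intro!: derivative_eq_intros simp: algebra_simps)
  from DERIV_unique[OF test_function_partial_derivatives(1)[OF test] this]
  show "dt (cutoff n T \<sigma> X) (t, x, y) =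
      ((real n * flat' (real n * t - 1) * D - A * flat' (T - t)) * F
        - A * D * F' * poly (pderiv X) t) * (wide_bump n x * wide_bump n y)" .
  have "((\<lambda>s. cutoff n T \<sigma> X (t, s, y)) has_real_derivative
      A * D * (\<sigma> * F' * wide_bump n x + F * wide_bump' n x) * wide_bump n y) (at x)"
    unfolding cutoff_def A_def D_def F_def F'_def fst_conv snd_conv
    by (auto intro!: derivative_eq_intros simp: algebra_simps)
  from DERIV_unique[OF test_function_partial_derivatives(2)[OF test] this]
  show "fst (grad_x (cutoff n T \<sigma> X) (t, x, y)) =
      A * D * (\<sigma> * F' * wide_bump n x + F * wide_bump' n x) * wide_bump n y" .
  have "((\<lambda>s. cutoff n T \<sigma> X (t, x, s)) has_real_derivative A * D * F * (wide_bump n x * wide_bump' n y)) (at y)"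
    unfolding cutoff_def A_def D_def F_def F'_def fst_conv snd_conv
    by (auto intro!: derivative_eq_intros simp: algebra_simps)
  from DERIV_unique[OF test_function_partial_derivatives(3)[OF test] this]
  show "snd (grad_x (cutoff n T \<sigma> X) (t, x, y)) = A * D * F * (wide_bump n x * wide_bump' n y)" .
qed

text \<open>Multiplied by |w|, the left side is the integrand of the entropy inequality for
  \<open>k = 0\<close>. Differentiating the front factor produces a nonnegative factor times
  \<open>\<sigma> * w / 2 - X'\<close>, which is nonpositive because the front is at least as fast
  as the transport. There remain the kernel at small times, bounded by its part beyond
  \<open>\<rho>\<close>, the kernel at the final time with its favourable sign, and the slopes
  \<open>4 / n\<close> of the wide bumps weighted by \<open>C / 2\<close> and
  \<open>C\<^sup>2 / 3\<close>, which explain the last constant.\<close>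

lemma cutoff_entropy_pointwise:
  fixes T \<sigma> t x y M \<rho> C w :: real and X :: "real poly"
  assumes n: "1 \<le> n" and \<sigma>: "\<bar>\<sigma>\<bar> = 1" and t: "0 < t"
    and C: "\<bar>w\<bar> \<le> C" and M: "\<bar>w\<bar> \<le> M / sqrt t"
    and X': "t \<in> {1 / real n..T} \<Longrightarrow> M / (2 * sqrt t) \<le> poly (pderiv X) t"
    and X: "t \<in> {1 / real n..T} \<Longrightarrow> \<rho> \<le> poly X t"
  shows "dt (cutoff n T \<sigma> X) (t, x, y) + w / 2 * fst (grad_x (cutoff n T \<sigma> X) (t, x, y))
      + w\<^sup>2 / 3 * snd (grad_x (cutoff n T \<sigma> X) (t, x, y))
    \<le> indicator {0<..<T} t * (real n * flat' (real n * t - 1) * indicator {\<rho><..} (\<sigma> * x)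
      - flat (real n * t - 1) * flat' (T - t) * flat (\<sigma> * x - poly X t) * (wide_bump n x * wide_bump n y)
      + (2 * C + 4 / 3 * C\<^sup>2) / real n)" (is "?L \<le> _")
proof -
  define A D F F' K where "A = flat (real n * t - 1)" and "D = flat (T - t)"
    and "F = flat (\<sigma> * x - poly X t)" and "F' = flat' (\<sigma> * x - poly X t)" and "K = wide_bump n x * wide_bump n y"
  have C0: "0 \<le> C" using C by linarith
  have L: "?L = ((real n * flat' (real n * t - 1) * D - A * flat' (T - t)) * F - A * D * F' * poly (pderiv X) t) * K
      + w / 2 * (A * D * (\<sigma> * F' * wide_bump n x + F * wide_bump' n x) * wide_bump n y)
      + w\<^sup>2 / 3 * (A * D * F * (wide_bump n x * wide_bump' n y))"
    unfolding cutoff_derivatives[OF n] A_def D_def F_def F'_def K_def ..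
  consider "T \<le> t" | "t < T" "real n * t \<le> 1" | "t < T" "1 < real n * t" by linarith
  then show ?thesis
  proof cases
    case 1
    then have "D = 0" "flat' (T - t) = 0" by (simp_all add: D_def)
    then show ?thesis unfolding L using 1 by simp
  next
    case 2
    then have "A = 0" "flat' (real n * t - 1) = 0" by (simp_all add: A_def)
    then show ?thesis unfolding L A_def[symmetric] using C0 by simp
  next
    case 3
    then have tT: "t < T" and tn: "t \<in> {1 / real n..T}" using n by (auto simp: field_simps)
    have r: "0 \<le> A" "A \<le> 1" "0 \<le> D" "D \<le> 1" "0 \<le> F" "F \<le> 1" "0 \<le> F'" "0 \<le> K" "K \<le> 1"
      by (auto simp: A_def D_def F_def F'_def K_def mult_le_one)
    have 1: "real n * flat' (real n * t - 1) * (D * F * K) \<le>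
        real n * flat' (real n * t - 1) * indicator {\<rho><..} (\<sigma> * x)"
    proof (rule mult_left_mono)
      show "D * F * K \<le> indicator {\<rho><..} (\<sigma> * x)"
      proof (cases "\<rho> < \<sigma> * x")
        case True
        then show ?thesis using r by (auto intro!: mult_le_one)
      next
        case False
        then have "F = 0" using X[OF tn] by (simp add: F_def)
        then show ?thesis by simp
      qed
    qed simp
    have 2: "A * D * F' * K * (\<sigma> * w / 2 - poly (pderiv X) t) \<le> 0"
    proof (rule mult_nonneg_nonpos)
      have "\<sigma> * w \<le> \<bar>w\<bar>" using \<sigma> abs_ge_self[of "\<sigma> * w"] by (simp add: abs_mult)
      then show "\<sigma> * w / 2 - poly (pderiv X) t \<le> 0" using M X'[OF tn] by (simp add: field_simps)
    qed (use r in auto)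
    have s: "a * b \<le> c * (4 / real n)" if "\<bar>a\<bar> \<le> c" "\<bar>b\<bar> \<le> 4 / real n" for a b c
    proof -
      have "a * b \<le> \<bar>a\<bar> * \<bar>b\<bar>" by (metis abs_ge_self abs_mult)
      also have "\<dots> \<le> c * (4 / real n)" using that by (intro mult_mono) auto
      finally show ?thesis .
    qed
    have q: "\<bar>A * D * F * k\<bar> \<le> 1" if "0 \<le> k" "k \<le> 1" for k
      using r that by (simp add: abs_mult mult_le_one)
    have 3: "w / 2 * (A * D * F * wide_bump n y) * wide_bump' n x \<le> C / 2 * (4 / real n)"
    proof (rule s)
      show "\<bar>w / 2 * (A * D * F * wide_bump n y)\<bar> \<le> C / 2"
        using q[of "wide_bump n y"] C C0 mult_mono[of "\<bar>w / 2\<bar>" "C / 2" "\<bar>A * D * F * wide_bump n y\<bar>" 1]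
        by (simp add: abs_mult)
    qed (rule wide_bump'_abs_le)
    have 4: "w\<^sup>2 / 3 * (A * D * F * wide_bump n x) * wide_bump' n y \<le> C\<^sup>2 / 3 * (4 / real n)"
    proof (rule s)
      have "w\<^sup>2 \<le> C\<^sup>2" using C C0 abs_le_square_iff[of w C] by simp
      then show "\<bar>w\<^sup>2 / 3 * (A * D * F * wide_bump n x)\<bar> \<le> C\<^sup>2 / 3"
        using q[of "wide_bump n x"] mult_mono[of "w\<^sup>2 / 3" "C\<^sup>2 / 3" "\<bar>A * D * F * wide_bump n x\<bar>" 1]
        by (simp add: abs_mult)
    qed (rule wide_bump'_abs_le)
    have "?L = real n * flat' (real n * t - 1) * (D * F * K) - A * flat' (T - t) * F * K
      + A * D * F' * K * (\<sigma> * w / 2 - poly (pderiv X) t)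
      + w / 2 * (A * D * F * wide_bump n y) * wide_bump' n x + w\<^sup>2 / 3 * (A * D * F * wide_bump n x) * wide_bump' n y"
      unfolding L by (simp add: K_def algebra_simps)
    also have "\<dots> \<le> real n * flat' (real n * t - 1) * indicator {\<rho><..} (\<sigma> * x) - A * flat' (T - t) * F * K
      + 0 + C / 2 * (4 / real n) + C\<^sup>2 / 3 * (4 / real n)"
      using 1 2 3 4 by linarith
    also have "\<dots> = real n * flat' (real n * t - 1) * indicator {\<rho><..} (\<sigma> * x) - A * flat' (T - t) * F * K
      + (2 * C + 4 / 3 * C\<^sup>2) / real n"
      by (simp add: add_divide_distrib)
    finally show ?thesis
      using tT t by (simp add: A_def F_def K_def)
  qed
qed

lemma integrable_times_bounded:
  fixes S f :: "'a \<Rightarrow> real"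
  assumes "integrable M S" "f \<in> borel_measurable M" "\<And>z. \<bar>f z\<bar> \<le> B"
  shows "integrable M (\<lambda>z. S z * f z)"
proof (rule Bochner_Integration.integrable_bound)
  show "integrable M (\<lambda>z. S z * B)" using assms(1) by simp
  show "(\<lambda>z. S z * f z) \<in> borel_measurable M"
    using assms(2) borel_measurable_integrable[OF assms(1)] by simp
  show "AE z in M. norm (S z * f z) \<le> norm (S z * B)"
    using assms(3) by (intro AE_I2) (auto simp: abs_mult intro!: mult_left_mono order_trans[OF assms(3)])
qed

lemma coordinate_measurable [measurable]:
  "(fst :: real \<times> real \<times> real \<Rightarrow> real) \<in> borel_measurable borel"
  "(\<lambda>z :: real \<times> real \<times> real. fst (snd z)) \<in> borel_measurable borel"
  "(\<lambda>z :: real \<times> real \<times> real. snd (snd z)) \<in> borel_measurable borel"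
  by (intro borel_measurable_continuous_onI continuous_intros)+

lemma poly_borel [measurable]: "poly (p :: real poly) \<in> borel_measurable borel"
  by (intro borel_measurable_continuous_onI continuous_intros)

text \<open>The pointwise bound weighted with |w| and integrated: the mass found ahead of the front
  near the final time is at most the mass beyond \<open>\<rho>\<close> near the initial time, up to
  O(1/n).\<close>

lemma entropy_cutoff_estimate:
  fixes T \<sigma> M \<rho> C :: real and X :: "real poly" and w :: field2
  defines "S \<equiv> \<lambda>z. indicator {0<..<T} (fst z) * \<bar>w (fst z) (snd z)\<bar>"
  assumes w: "entropy_solution w"
    and C: "AE z in lborel. 0 < fst z \<longrightarrow> \<bar>w (fst z) (snd z)\<bar> \<le> C" and C0: "0 \<le> C"
    and M: "AE z in lborel. 0 < fst z \<longrightarrow> \<bar>w (fst z) (snd z)\<bar> \<le> M / sqrt (fst z)"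
    and S: "integrable lborel S"
    and n: "1 \<le> n" and \<sigma>: "\<bar>\<sigma>\<bar> = 1"
    and X': "\<And>t. t \<in> {1 / real n..T} \<Longrightarrow> M / (2 * sqrt t) \<le> poly (pderiv X) t"
    and X: "\<And>t. t \<in> {1 / real n..T} \<Longrightarrow> \<rho> \<le> poly X t"
  shows "(\<integral>z. S z * (flat (real n * fst z - 1) * flat' (T - fst z) *
        flat (\<sigma> * fst (snd z) - poly X (fst z)) * (wide_bump n (fst (snd z)) * wide_bump n (snd (snd z)))) \<partial>lborel)
    \<le> (\<integral>z. S z * (real n * flat' (real n * fst z - 1) * indicator {\<rho><..} (\<sigma> * fst (snd z))) \<partial>lborel)
      + (2 * C + 4 / 3 * C\<^sup>2) / real n * (\<integral>z. S z \<partial>lborel)" (is "(\<integral>z. S z * ?Q z \<partial>lborel) \<le> (\<integral>z. S z * ?P z \<partial>lborel) + ?e * _")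
proof -
  define \<phi> where "\<phi> = cutoff n T \<sigma> X"
  \<comment> \<open>At nonpositive times nothing is known about \<open>w\<close>, not even
    measurability; setting it to 0 there gives a Borel function on all of space-time.\<close>
  define W where "W z = indicator half_space z * w (fst z) (snd z)" for z
  define G where "G z = dt \<phi> z + W z / 2 * fst (grad_x \<phi> z) + (W z)\<^sup>2 / 3 * snd (grad_x \<phi> z)" for z
  have \<phi>: "test_function \<phi>" unfolding \<phi>_def by (rule test_function_cutoff) fact
  obtain B where B: "\<And>z. \<bar>dt \<phi> z\<bar> \<le> B" "\<And>z. \<bar>fst (grad_x \<phi> z)\<bar> \<le> B" "\<And>z. \<bar>snd (grad_x \<phi> z)\<bar> \<le> B"
    using test_function_derivatives_bounded[OF \<phi>] by blast
  have B0: "0 \<le> B" using B(1)[of 0] by linarith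
  have W_meas [measurable]: "W \<in> borel_measurable borel"
  proof -
    have "(\<lambda>z. indicator half_space z *\<^sub>R (case z of (t, x) \<Rightarrow> w t x)) = W"
      by (auto simp: W_def fun_eq_iff)
    then show ?thesis
      using w unfolding entropy_solution_def set_borel_measurable_def by simp
  qed
  have [measurable]: "dt \<phi> \<in> borel_measurable borel"
    "(\<lambda>z. fst (grad_x \<phi> z)) \<in> borel_measurable borel" "(\<lambda>z. snd (grad_x \<phi> z)) \<in> borel_measurable borel"
    using test_function_derivatives_continuous[OF \<phi>]
    by (auto intro!: borel_measurable_continuous_onI continuous_on_fst continuous_on_snd)
  have G_meas: "G \<in> borel_measurable borel"
    unfolding G_def[abs_def] by measurable
  have P: "integrable lborel (\<lambda>z. S z * ?P z)"
  proof (rule integrable_times_bounded[OF S])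
    show "\<bar>?P z\<bar> \<le> real n * 2" for z
      by (auto simp: indicator_def intro!: mult_left_mono flat'_le_2)
  qed measurable
  have Q: "integrable lborel (\<lambda>z. S z * ?Q z)"
  proof (rule integrable_times_bounded[OF S])
    show "\<bar>?Q z\<bar> \<le> 2" for z
    proof -
      have "flat (real n * fst z - 1) * flat' (T - fst z) * flat (\<sigma> * fst (snd z) - poly X (fst z)) * (wide_bump n (fst (snd z)) * wide_bump n (snd (snd z)))
        \<le> 1 * 2 * 1 * (1 * 1)"
        by (intro mult_mono flat'_le_2) (auto intro!: mult_nonneg_nonneg)
      then show ?thesis by simp
    qed
  qed measurable
  have "0 \<le> set_lebesgue_integral lborel half_space
          (\<lambda>(t, x). \<bar>w t x - 0\<bar> * dt \<phi> (t, x)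
             + sgn (w t x - 0) * ((flux (w t x) - flux 0) \<bullet> grad_x \<phi> (t, x)))"
    using w \<phi> cutoff_nonneg unfolding entropy_solution_def \<phi>_def by blast
  also have "\<dots> = (\<integral>z. \<bar>W z\<bar> * G z \<partial>lborel)"
    unfolding set_lebesgue_integral_def
  proof (rule Bochner_Integration.integral_cong[OF refl])
    fix z :: "real \<times> real \<times> real"
    \<comment> \<open>For \<open>k = 0\<close> the entropy flux is |v| times (v/2, v^2/3). The
      factor |v| can thus be taken out of the whole integrand, and what is left is the bracket of
      the pointwise lemma.\<close>
    have sgn: "sgn v * v\<^sup>2 = \<bar>v\<bar> * v" "sgn v * v ^ 3 = \<bar>v\<bar> * v\<^sup>2" for v :: real
      by (auto simp: sgn_if power2_eq_square power3_eq_cube)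
    obtain t x where z: "z = (t, x)" by (cases z)
    have "\<bar>v - 0\<bar> * d + sgn (v - 0) * ((flux v - flux 0) \<bullet> p) = \<bar>v\<bar> * (d + v / 2 * fst p + v\<^sup>2 / 3 * snd p)"
      for v d :: real and p :: "real \<times> real"
    proof -
      have "\<bar>v - 0\<bar> * d + sgn (v - 0) * ((flux v - flux 0) \<bullet> p) =
        \<bar>v\<bar> * d + (sgn v * v\<^sup>2) / 2 * fst p + (sgn v * v ^ 3) / 3 * snd p"
        by (simp add: flux_def inner_prod_def algebra_simps)
      also have "\<dots> = \<bar>v\<bar> * (d + v / 2 * fst p + v\<^sup>2 / 3 * snd p)"
        unfolding sgn by (simp add: algebra_simps)
      finally show ?thesis .
    qed
    then show "indicator half_space z *\<^sub>R (case z of (t, x) \<Rightarrow> \<bar>w t x - 0\<bar> * dt \<phi> (t, x)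
             + sgn (w t x - 0) * ((flux (w t x) - flux 0) \<bullet> grad_x \<phi> (t, x))) = \<bar>W z\<bar> * G z"
      by (simp add: z W_def G_def indicator_def)
  qed
  also have "\<dots> \<le> (\<integral>z. S z * ?P z - S z * ?Q z + S z * ?e \<partial>lborel)"
  proof (rule integral_mono_AE)
    show "integrable lborel (\<lambda>z. S z * ?P z - S z * ?Q z + S z * ?e)"
      using P Q S by simp
    have le: "AE z in lborel. \<bar>W z\<bar> * G z \<le> S z * ?P z - S z * ?Q z + S z * ?e"
      using C M
    proof eventually_elim
      case (elim z)
      obtain t x y where z: "z = (t, x, y)" by (cases z)
      show ?case
      proof (cases "0 < t")
        case True
        then have "G z \<le> indicator {0<..<T} t * (?P z - ?Q z + ?e)"
          using cutoff_entropy_pointwise[OF n \<sigma> True, of "w t (x, y)" C M T X \<rho> x y] elim X' X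
          by (simp add: G_def W_def z \<phi>_def half_space_def)
        then have "\<bar>W z\<bar> * G z \<le> \<bar>W z\<bar> * (indicator {0<..<T} t * (?P z - ?Q z + ?e))"
          by (rule mult_left_mono) simp
        also have "\<dots> = S z * ?P z - S z * ?Q z + S z * ?e"
          using True by (simp add: S_def W_def z half_space_def algebra_simps)
        finally show ?thesis .
      next
        case False
        then show ?thesis by (simp add: S_def W_def z half_space_def)
      qed
    qed
    then show "AE z in lborel. \<bar>W z\<bar> * G z \<le> S z * ?P z - S z * ?Q z + S z * ?e" .
    show "integrable lborel (\<lambda>z. \<bar>W z\<bar> * G z)"
    proof (rule Bochner_Integration.integrable_bound)
      show "integrable lborel (\<lambda>z. S z * (B + C / 2 * B + C\<^sup>2 / 3 * B))" using S by simp
      show "(\<lambda>z. \<bar>W z\<bar> * G z) \<in> borel_measurable lborel" using G_meas by simp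
      show "AE z in lborel. norm (\<bar>W z\<bar> * G z) \<le> norm (S z * (B + C / 2 * B + C\<^sup>2 / 3 * B))"
        using C
      proof eventually_elim
        case (elim z)
        obtain t x y where z: "z = (t, x, y)" by (cases z)
        show ?case
        proof (cases "0 < t \<and> t < T")
          case True
          then have Wz: "\<bar>W z\<bar> \<le> C" using elim C0 by (simp add: W_def z half_space_def)
          then have W2: "(W z)\<^sup>2 \<le> C\<^sup>2" using C0 abs_le_square_iff[of "W z" C] by simp
          have "\<bar>G z\<bar> \<le> \<bar>dt \<phi> z\<bar> + \<bar>W z\<bar> / 2 * \<bar>fst (grad_x \<phi> z)\<bar> + (W z)\<^sup>2 / 3 * \<bar>snd (grad_x \<phi> z)\<bar>"
            unfolding G_def by (simp add: abs_mult order_trans[OF abs_triangle_ineq add_mono] abs_triangle_ineq[THEN order_trans])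
          also have "\<dots> \<le> B + C / 2 * B + C\<^sup>2 / 3 * B"
            using B Wz W2 B0 C0 by (intro add_mono mult_mono) auto
          finally have "\<bar>W z\<bar> * \<bar>G z\<bar> \<le> \<bar>W z\<bar> * (B + C / 2 * B + C\<^sup>2 / 3 * B)"
            by (rule mult_left_mono) simp
          then show ?thesis
            using True B0 C0 by (simp add: S_def W_def z half_space_def abs_mult)
        next
          case False
          \<comment> \<open>Domination by \<open>S\<close> requires the left side to vanish off the
            strip. From time \<open>T\<close> on, the final cutoff and its derivative are both 0,
            and at nonpositive times \<open>W\<close> is 0.\<close>
          have "\<bar>W z\<bar> * G z = 0"
          proof (cases "0 < t")
            case True
            with False have 0: "flat (T - t) = 0" "flat' (T - t) = 0" by simp_all
            have "G z = 0"
              unfolding G_def z \<phi>_def cutoff_derivatives[OF n] 0 by simp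
            then show ?thesis by simp
          next
            case False
            then show ?thesis by (simp add: W_def z half_space_def)
          qed
          then have "norm (\<bar>W z\<bar> * G z) = 0" by simp
          then show ?thesis by (metis norm_ge_zero)
        qed
      qed
    qed
  qed
  also have "\<dots> = (\<integral>z. S z * ?P z \<partial>lborel) - (\<integral>z. S z * ?Q z \<partial>lborel) + ?e * (\<integral>z. S z \<partial>lborel)"
    using P Q S by (simp add: mult.commute)
  finally show ?thesis by simp
qed

section \<open>Finite speed of propagation\<close>

lemma integrable_flat': "integrable lborel flat'"
proof (rule integrableI_nonneg)
  have "(flat \<longlongrightarrow> 1) at_top" by (rule flat_tendsto_1) (rule filterlim_ident)
  then have "(\<integral>\<^sup>+x. ennreal (flat' x) * indicator {0..} x \<partial>lborel) = ennreal (1 - flat 0)"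
    by (intro nn_integral_FTC_atLeast flat_DERIV) auto
  moreover have "(\<integral>\<^sup>+x. ennreal (flat' x) * indicator {0..} x \<partial>lborel) = (\<integral>\<^sup>+x. ennreal (flat' x) \<partial>lborel)"
    by (intro nn_integral_cong) (auto simp: indicator_def)
  ultimately show "(\<integral>\<^sup>+x. ennreal (flat' x) \<partial>lborel) < \<infinity>" by simp
qed auto

text \<open>
  The kernels are the time derivatives of the cutoff at small times.
\<close>

lemma flat'_concentration:
  fixes h :: "real \<Rightarrow> real"
  assumes h [measurable]: "h \<in> borel_measurable borel" and E: "\<And>t. \<bar>h t\<bar> \<le> E"
    and lim: "(h \<longlongrightarrow> 0) (at_right 0)"
  shows "(\<lambda>n. \<integral>t. real n * flat' (real n * t - 1) * h t \<partial>lborel) \<longlonglongrightarrow> 0"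
proof -
  \<comment> \<open>The substitution \<open>t = (1 + s) / n\<close> turns the kernels into the fixed
    integrable weight \<open>flat' s\<close>. It charges only s > 0, so the argument of
    \<open>h\<close> tends to 0 from the right; its unbounded tail is why \<open>h\<close> is
    bounded at all times.\<close>
  have "(\<lambda>n. \<integral>s. flat' s * h ((1 + s) / real n) \<partial>lborel) \<longlonglongrightarrow> (\<integral>s. 0 \<partial>(lborel :: real measure))"
  proof (rule integral_dominated_convergence[where f = "\<lambda>_. 0" and w = "\<lambda>s. flat' s * E"
        and s = "\<lambda>n s. flat' s * h ((1 + s) / real n)"])
    show "integrable lborel (\<lambda>s. flat' s * E)" using integrable_flat' by simp
    show "AE s in lborel. (\<lambda>n. flat' s * h ((1 + s) / real n)) \<longlonglongrightarrow> 0"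
    proof (rule AE_I2)
      fix s :: real
      show "(\<lambda>n. flat' s * h ((1 + s) / real n)) \<longlonglongrightarrow> 0"
      proof (cases "s \<le> 0")
        case False
        have "filterlim (\<lambda>n. (1 + s) / real n) (at_right 0) sequentially"
          unfolding filterlim_at
        proof (intro conjI)
          show "\<forall>\<^sub>F n in sequentially. (1 + s) / real n \<in> {0<..} \<and> (1 + s) / real n \<noteq> 0"
            using eventually_gt_at_top[of 0] by eventually_elim (use False in auto)
        qed (rule lim_const_over_n)
        from filterlim_compose[OF lim this] show ?thesis
          by (intro tendsto_mult_right_zero)
      qed simp
    qed
    show "AE s in lborel. norm (flat' s * h ((1 + s) / real n)) \<le> flat' s * E" for n
      using E by (intro AE_I2) (simp add: abs_mult mult_left_mono)
  qed measurable
  moreover have "\<forall>\<^sub>F n in sequentially. (\<integral>s. flat' s * h ((1 + s) / real n) \<partial>lborel) =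
      (\<integral>t. real n * flat' (real n * t - 1) * h t \<partial>lborel)"
    using eventually_gt_at_top[of 0]
  proof eventually_elim
    case (elim n)
    have "(\<integral>t. real n * flat' (real n * t - 1) * h t \<partial>lborel) = \<bar>1 / real n\<bar> *\<^sub>R
      (\<integral>s. real n * flat' (real n * (1 / real n + 1 / real n * s) - 1) * h (1 / real n + 1 / real n * s) \<partial>lborel)"
      using elim by (intro lborel_integral_real_affine) simp
    also have "\<dots> = (\<integral>s. 1 / real n * (real n * flat' (real n * (1 / real n + 1 / real n * s) - 1) * h (1 / real n + 1 / real n * s)) \<partial>lborel)"
      by (simp only: real_scaleR_def abs_of_nonneg divide_nonneg_nonneg zero_le_one of_nat_0_le_iff)
         (rule integral_mult_right_zero[symmetric])
    also have "\<dots> = (\<integral>s. flat' s * h ((1 + s) / real n) \<partial>lborel)"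
    proof (rule Bochner_Integration.integral_cong[OF refl])
      fix s :: real
      have "real n * (1 / real n + 1 / real n * s) - 1 = s" "1 / real n + 1 / real n * s = (1 + s) / real n"
        using elim by (simp_all add: field_simps)
      then show "1 / real n * (real n * flat' (real n * (1 / real n + 1 / real n * s) - 1) * h (1 / real n + 1 / real n * s)) =
        flat' s * h ((1 + s) / real n)"
        using elim by simp
    qed
    finally show ?case by simp
  qed
  ultimately show ?thesis
    using Lim_transform_eventually by fastforce
qed

lemma kruzhkov_integrable_strip:
  assumes w: "kruzhkov_solution b w"
  shows "integrable lborel (\<lambda>z. indicator {0<..<T} (fst z) * w (fst z) (snd z))"
proof -
  obtain C where "\<And>t. t \<in> {0..T} \<Longrightarrow> L1_norm (w t) \<le> C"
    using kruzhkov_L1_bounded[OF w] by blast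
  then show ?thesis
    using w unfolding kruzhkov_solution_def entropy_solution_def
    by (intro integrable_strip[where C = C]) auto
qed

text \<open>Where the datum vanishes, |w t| equals |w t - w 0| almost everywhere, so L1 continuity
  at time 0 leaves no mass in \<open>A\<close>.\<close>

lemma kruzhkov_initial_layer:
  assumes w: "kruzhkov_solution b w" and b: "AE x in lborel. x \<in> A \<longrightarrow> b x = 0" and A: "A \<in> sets borel"
  shows "((\<lambda>t. \<integral>x. \<bar>w t x\<bar> * indicator A x \<partial>lborel) \<longlongrightarrow> 0) (at_right 0)"
proof (rule tendsto_sandwich[where f = "\<lambda>_. 0" and h = "\<lambda>t. L1_norm (\<lambda>x. w t x - w 0 x)"])
  have i: "integrable lborel (w t)" if "0 \<le> t" for t
    using w that unfolding kruzhkov_solution_def by blast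
  have "((\<lambda>s. L1_norm (\<lambda>x. w s x - w 0 x)) \<longlongrightarrow> 0) (at 0 within {0..})"
    using w unfolding kruzhkov_solution_def by auto
  then show "((\<lambda>s. L1_norm (\<lambda>x. w s x - w 0 x)) \<longlongrightarrow> 0) (at_right 0)"
    by (rule tendsto_within_subset) auto
  have w0: "AE x in lborel. x \<in> A \<longrightarrow> w 0 x = 0"
    using b w unfolding kruzhkov_solution_def by auto
  have "(\<integral>x. \<bar>w t x\<bar> * indicator A x \<partial>lborel) \<le> L1_norm (\<lambda>x. w t x - w 0 x)" if "0 < t" for t
  proof (rule integral_mono_AE)
    show "integrable lborel (\<lambda>x. \<bar>w t x\<bar> * indicator A x)"
      using i[of t] that A by (intro integrable_real_mult_indicator) auto
    show "integrable lborel (\<lambda>x. \<bar>w t x - w 0 x\<bar>)" using i that by simp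
    show "AE x in lborel. \<bar>w t x\<bar> * indicator A x \<le> \<bar>w t x - w 0 x\<bar>"
      using w0 by eventually_elim (auto simp: indicator_def)
  qed
  then show "\<forall>\<^sub>F t in at_right 0. (\<integral>x. \<bar>w t x\<bar> * indicator A x \<partial>lborel) \<le> L1_norm (\<lambda>x. w t x - w 0 x)"
    by (simp add: eventually_at_filter)
qed auto

text \<open>Letting n tend to infinity in the cutoff estimate, the initial term vanishes because the
  datum does beyond \<open>\<rho>\<close>, and so does the O(1/n) error. The integral of
  \<open>S * Q'\<close> is then at most 0, although \<open>Q'\<close> is positive ahead of the front
  at all times before \<open>T\<close>. Hence \<open>w\<close> vanishes there.\<close>

lemma kruzhkov_support_strip:
  fixes T \<sigma> M \<rho> :: real and w :: field2
  assumes w: "kruzhkov_solution b w"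
    and M: "AE z in lborel. 0 < fst z \<longrightarrow> \<bar>w (fst z) (snd z)\<bar> \<le> M / sqrt (fst z)" and M0: "0 \<le> M"
    and \<sigma>: "\<bar>\<sigma>\<bar> = 1" and b: "AE x in lborel. \<rho> < \<sigma> * fst x \<longrightarrow> b x = 0"
  shows "AE z in lborel. 0 < fst z \<longrightarrow> fst z < T \<longrightarrow> \<rho> + M * sqrt (fst z) < \<sigma> * fst (snd z) \<longrightarrow> w (fst z) (snd z) = 0"
proof -
  define S where "S = (\<lambda>z. indicator {0<..<T} (fst z) * \<bar>w (fst z) (snd z)\<bar>)"
  have ent: "entropy_solution w" using w unfolding kruzhkov_solution_def by blast
  obtain C' where C': "AE z in lborel. 0 < fst z \<longrightarrow> \<bar>w (fst z) (snd z)\<bar> \<le> C'"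
    using w unfolding kruzhkov_solution_def split_beta by auto
  define C where "C = max C' 0"
  have C: "AE z in lborel. 0 < fst z \<longrightarrow> \<bar>w (fst z) (snd z)\<bar> \<le> C" "0 \<le> C"
    using C' by (auto simp: C_def)
  have S_abs: "S z = \<bar>indicator {0<..<T} (fst z) * w (fst z) (snd z)\<bar>" for z
    by (simp add: S_def abs_mult)
  have S: "integrable lborel S"
    unfolding S_abs[abs_def] by (intro integrable_abs kruzhkov_integrable_strip[OF w])
  have S_nonneg: "0 \<le> S z" for z by (simp add: S_def)
  have S_meas [measurable]: "S \<in> borel_measurable borel"
    using borel_measurable_integrable[OF S] by simp
  \<comment> \<open>The front has unbounded speed at 0 and is therefore approximated only on
    \<open>{1 / n..T}\<close>, where the cutoff can be nonzero. The tolerance 1/n makes the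
    polynomials converge to the true front.\<close>
  have "\<exists>X. 1 \<le> n \<longrightarrow> (\<forall>t\<in>{1 / real n..T}. M / (2 * sqrt t) \<le> poly (pderiv X) t \<and>
      \<rho> + M * sqrt t \<le> poly X t \<and> poly X t \<le> \<rho> + M * sqrt t + 1 / real n)" for n :: nat
  proof (cases "1 \<le> n")
    case True
    then have "0 < 1 / real n" by simp
    from sqrt_upper_polynomial[OF this M0 this, of T] obtain p where
      "\<And>t. t \<in> {1 / real n..T} \<Longrightarrow> M / (2 * sqrt t) \<le> poly (pderiv p) t"
      "\<And>t. t \<in> {1 / real n..T} \<Longrightarrow> M * sqrt t \<le> poly p t"
      "\<And>t. t \<in> {1 / real n..T} \<Longrightarrow> poly p t \<le> M * sqrt t + 1 / real n" by blast
    then show ?thesis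
      by (intro exI[of _ "p + [:\<rho>:]"]) (simp add: pderiv_add pderiv_pCons algebra_simps)
  qed simp
  then obtain X where X: "\<And>n t. 1 \<le> n \<Longrightarrow> t \<in> {1 / real n..T} \<Longrightarrow> M / (2 * sqrt t) \<le> poly (pderiv (X n)) t"
      "\<And>n t. 1 \<le> n \<Longrightarrow> t \<in> {1 / real n..T} \<Longrightarrow> \<rho> + M * sqrt t \<le> poly (X n) t"
      "\<And>n t. 1 \<le> n \<Longrightarrow> t \<in> {1 / real n..T} \<Longrightarrow> poly (X n) t \<le> \<rho> + M * sqrt t + 1 / real n"
    by metis
  define Q where "Q n z = flat (real n * fst z - 1) * flat' (T - fst z) *
        flat (\<sigma> * fst (snd z) - poly (X n) (fst z)) * (wide_bump n (fst (snd z)) * wide_bump n (snd (snd z)))" for n z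
  define P where "P n z = real n * flat' (real n * fst z - 1) * indicator {\<rho><..} (\<sigma> * fst (snd z))"
    for n and z :: "real \<times> real \<times> real"
  define Q' where "Q' z = flat' (T - fst z) * flat (\<sigma> * fst (snd z) - (\<rho> + M * sqrt (fst z))) * ((flat 1)\<^sup>2 * (flat 1)\<^sup>2)"
    for z :: "real \<times> real \<times> real"
  have [measurable]: "Q n \<in> borel_measurable borel" "P n \<in> borel_measurable borel" "Q' \<in> borel_measurable borel" for n
    unfolding Q_def[abs_def] P_def[abs_def] Q'_def[abs_def] by measurable
  have est: "(\<integral>z. S z * Q n z \<partial>lborel) \<le> (\<integral>z. S z * P n z \<partial>lborel) + (2 * C + 4 / 3 * C\<^sup>2) / real n * (\<integral>z. S z \<partial>lborel)"
    if n: "1 \<le> n" for n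
  proof -
    have "\<rho> \<le> poly (X n) t" if t: "t \<in> {1 / real n..T}" for t
    proof -
      have "0 < 1 / real n" "1 / real n \<le> t" using n t by auto
      then have "0 \<le> t" by linarith
      then have "0 \<le> M * sqrt t" using M0 by simp
      then show ?thesis using X(2)[OF n t] by linarith
    qed
    then show ?thesis
      unfolding S_def Q_def P_def
      using S X(1)[OF n] by (intro entropy_cutoff_estimate[where M = M] ent C M n \<sigma>) (auto simp: S_def)
  qed
  have "(\<lambda>n. \<integral>z. S z * Q n z \<partial>lborel) \<longlonglongrightarrow> (\<integral>z. S z * Q' z \<partial>lborel)"
  proof (rule integral_dominated_convergence)
    show "integrable lborel (\<lambda>z. S z * 2)" using S by simp
    show "AE z in lborel. norm (S z * Q n z) \<le> S z * 2" for n
    proof (rule AE_I2)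
      fix z :: "real \<times> real \<times> real"
      have "Q n z \<le> 1 * 2 * 1 * (1 * 1)"
        unfolding Q_def by (intro mult_mono flat'_le_2) (auto intro!: mult_nonneg_nonneg)
      moreover have "0 \<le> Q n z"
        unfolding Q_def by (intro mult_nonneg_nonneg) auto
      ultimately show "norm (S z * Q n z) \<le> S z * 2"
        using S_nonneg by (simp add: abs_mult mult_left_mono)
    qed
    show "AE z in lborel. (\<lambda>n. S z * Q n z) \<longlonglongrightarrow> S z * Q' z"
    proof (rule AE_I2)
      fix z :: "real \<times> real \<times> real"
      show "(\<lambda>n. S z * Q n z) \<longlonglongrightarrow> S z * Q' z"
      proof (cases "0 < fst z \<and> fst z < T")
        case True
        then have t: "0 < fst z" by simp
        have "filterlim (\<lambda>n. real n * fst z) at_top sequentially"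
          using filterlim_tendsto_pos_mult_at_top[OF tendsto_const t filterlim_real_sequentially]
          by (simp add: mult.commute)
        then have top: "filterlim (\<lambda>n. real n * fst z - 1) at_top sequentially"
          using filterlim_tendsto_add_at_top[OF tendsto_const[of "-1"]] by fastforce
        have "\<forall>\<^sub>F n in sequentially. 1 \<le> n \<and> fst z \<in> {1 / real n..T}"
        proof -
          have "\<forall>\<^sub>F n in sequentially. 0 \<le> real n * fst z - 1"
            using top by (rule filterlim_at_top[THEN iffD1, rule_format])
          with eventually_ge_at_top[of 1] show ?thesis
            by eventually_elim (use True in \<open>auto simp: field_simps\<close>)
        qed
        then have "\<forall>\<^sub>F n in sequentially. \<rho> + M * sqrt (fst z) \<le> poly (X n) (fst z)"
          "\<forall>\<^sub>F n in sequentially. poly (X n) (fst z) \<le> \<rho> + M * sqrt (fst z) + 1 / real n"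
          by (auto elim!: eventually_mono intro: X)
        then have "(\<lambda>n. poly (X n) (fst z)) \<longlonglongrightarrow> \<rho> + M * sqrt (fst z)"
        proof (rule tendsto_sandwich)
          have "(\<lambda>n. \<rho> + M * sqrt (fst z) + 1 / real n) \<longlonglongrightarrow> \<rho> + M * sqrt (fst z) + 0"
            by (intro tendsto_intros lim_const_over_n)
          then show "(\<lambda>n. \<rho> + M * sqrt (fst z) + 1 / real n) \<longlonglongrightarrow> \<rho> + M * sqrt (fst z)" by simp
        qed simp
        then have "(\<lambda>n. Q n z) \<longlonglongrightarrow> 1 * flat' (T - fst z) * flat (\<sigma> * fst (snd z) - (\<rho> + M * sqrt (fst z))) *
            ((flat 1)\<^sup>2 * (flat 1)\<^sup>2)"
          unfolding Q_def
          by (intro tendsto_intros flat_tendsto_1[OF top] wide_bump_tendsto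
              isCont_tendsto_compose[OF DERIV_isCont[OF flat_DERIV]])
        then show ?thesis
          unfolding Q'_def by (intro tendsto_intros) simp
      next
        case False
        then have "S z = 0" by (auto simp: S_def indicator_def)
        then show ?thesis by simp
      qed
    qed
  qed measurable
  moreover have "(\<lambda>n. (\<integral>z. S z * P n z \<partial>lborel) + (2 * C + 4 / 3 * C\<^sup>2) / real n * (\<integral>z. S z \<partial>lborel)) \<longlonglongrightarrow> 0 + 0 * (\<integral>z. S z \<partial>lborel)"
  proof (intro tendsto_intros lim_const_over_n)
    \<comment> \<open>\<open>h t\<close> is the mass of |w t| beyond \<open>\<rho>\<close>, cut off
      at time \<open>T\<close>. Integrating in space first turns the initial term into the integral
      of \<open>h\<close> against the concentrating kernel.\<close>
    define h where "h t = (\<integral>x. S (t, x) * indicator {\<rho><..} (\<sigma> * fst x) \<partial>lborel)" for t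
    let ?A = "{x :: real \<times> real. \<rho> < \<sigma> * fst x}"
    have A: "?A \<in> sets borel"
      by (intro borel_open open_Collect_less continuous_intros)
    have h_eq: "h t = indicator {0<..<T} t * (\<integral>x. \<bar>w t x\<bar> * indicator ?A x \<partial>lborel)" for t
      unfolding h_def
      by (simp add: S_def mult.assoc indicator_def[of "?A"] indicator_def[of "{\<rho><..}"])
    have SP: "integrable lborel (\<lambda>z. S z * P n z)" for n
    proof (rule integrable_times_bounded[OF S])
      show "\<bar>P n z\<bar> \<le> real n * 2" for z
        by (auto simp: P_def indicator_def intro!: mult_left_mono flat'_le_2)
    qed measurable
    have "(\<integral>z. S z * P n z \<partial>lborel) = (\<integral>t. \<integral>x. S (t, x) * P n (t, x) \<partial>lborel \<partial>lborel)" for n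
      using lborel_pair.integral_fst'[of "\<lambda>z. S z * P n z"] SP[of n] by (simp add: lborel_prod)
    also have "\<dots> n = (\<integral>t. real n * flat' (real n * t - 1) * h t \<partial>lborel)" for n
      unfolding h_def P_def
      by (intro Bochner_Integration.integral_cong[OF refl])
         (simp add: mult_ac flip: integral_mult_right_zero)
    finally have eq: "(\<integral>z. S z * P n z \<partial>lborel) = (\<integral>t. real n * flat' (real n * t - 1) * h t \<partial>lborel)" for n .
    obtain K where K: "\<And>t. t \<in> {0..T} \<Longrightarrow> L1_norm (w t) \<le> K"
      using kruzhkov_L1_bounded[OF w] by blast
    have i: "integrable lborel (w t)" if "0 \<le> t" for t
      using w that unfolding kruzhkov_solution_def by blast
    show "(\<lambda>n. \<integral>z. S z * P n z \<partial>lborel) \<longlonglongrightarrow> 0"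
      unfolding eq
    proof (rule flat'_concentration)
      have "(\<lambda>z. S z * indicator {\<rho><..} (\<sigma> * fst (snd z))) \<in> borel_measurable borel" by measurable
      then have [measurable]: "(\<lambda>z. S z * indicator {\<rho><..} (\<sigma> * fst (snd z))) \<in> borel_measurable (lborel \<Otimes>\<^sub>M lborel)"
        by (simp add: lborel_prod)
      have "(\<lambda>t. \<integral>x. (\<lambda>z. S z * indicator {\<rho><..} (\<sigma> * fst (snd z))) (t, x) \<partial>lborel) \<in> borel_measurable lborel"
        by measurable
      then show "h \<in> borel_measurable borel" by (simp add: h_def[abs_def])
      show "\<bar>h t\<bar> \<le> \<bar>K\<bar>" for t
      proof (cases "0 < t \<and> t < T")
        case True
        have "(\<integral>x. \<bar>w t x\<bar> * indicator ?A x \<partial>lborel) \<le> L1_norm (w t)"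
          using i[of t] True A
          by (intro integral_mono integrable_real_mult_indicator) (auto simp: indicator_def)
        moreover have "0 \<le> (\<integral>x. \<bar>w t x\<bar> * indicator ?A x \<partial>lborel)" by simp
        ultimately show ?thesis using K[of t] True unfolding h_eq by simp
      next
        case False
        then show ?thesis by (auto simp: h_eq)
      qed
      have "((\<lambda>t. \<integral>x. \<bar>w t x\<bar> * indicator ?A x \<partial>lborel) \<longlongrightarrow> 0) (at_right 0)"
        using b by (intro kruzhkov_initial_layer[OF w _ A]) simp
      then show "(h \<longlongrightarrow> 0) (at_right 0)"
        by (rule tendsto_0_le[where K = 1]) (auto simp: h_eq indicator_def)
    qed
  qed
  ultimately have "(\<integral>z. S z * Q' z \<partial>lborel) \<le> 0 + 0 * (\<integral>z. S z \<partial>lborel)"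
    by (rule LIMSEQ_le) (use est in blast)
  moreover have SQ': "integrable lborel (\<lambda>z. S z * Q' z)"
  proof (rule integrable_times_bounded[OF S])
    show "\<bar>Q' z\<bar> \<le> 2" for z
    proof -
      have "Q' z \<le> 2 * 1 * (1\<^sup>2 * 1\<^sup>2)"
        unfolding Q'_def by (intro mult_mono flat'_le_2 power_mono) (auto intro!: mult_nonneg_nonneg)
      moreover have "0 \<le> Q' z"
        unfolding Q'_def by (intro mult_nonneg_nonneg) auto
      ultimately show ?thesis by simp
    qed
  qed measurable
  moreover have nn: "0 \<le> S z * Q' z" for z
    using S_nonneg by (auto simp: Q'_def)
  moreover have "0 \<le> (\<integral>z. S z * Q' z \<partial>lborel)"
    by (intro integral_nonneg_AE AE_I2 nn)
  ultimately have "(\<integral>z. S z * Q' z \<partial>lborel) = 0" by simp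
  then have "AE z in lborel. S z * Q' z = 0"
    using SQ' nn by (subst (asm) integral_nonneg_eq_0_iff_AE) auto
  then show ?thesis
  proof eventually_elim
    case (elim z)
    show ?case
    proof (intro impI)
      assume "0 < fst z" "fst z < T" "\<rho> + M * sqrt (fst z) < \<sigma> * fst (snd z)"
      then have "0 < Q' z" unfolding Q'_def by (intro mult_pos_pos flat'_pos) auto
      with elim \<open>0 < fst z\<close> \<open>fst z < T\<close> show "w (fst z) (snd z) = 0"
        by (auto simp: S_def)
    qed
  qed
qed

text \<open>The final times T = 0, 1, 2, ... and the two signs of \<open>\<sigma>\<close> give
  countably many null sets, which are discarded together.\<close>

lemma kruzhkov_support:
  fixes M \<rho> :: real and w :: field2
  assumes w: "kruzhkov_solution b w"
    and M: "AE z in lborel. 0 < fst z \<longrightarrow> \<bar>w (fst z) (snd z)\<bar> \<le> M / sqrt (fst z)" and M0: "0 \<le> M"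
    and b: "AE x in lborel. \<rho> < \<bar>fst x\<bar> \<longrightarrow> b x = 0"
  shows "AE z in lborel. 0 < fst z \<longrightarrow> \<rho> + M * sqrt (fst z) < \<bar>fst (snd z)\<bar> \<longrightarrow> w (fst z) (snd z) = 0"
proof -
  have "AE z in lborel. 0 < fst z \<longrightarrow> fst z < real k \<longrightarrow> \<rho> + M * sqrt (fst z) < 1 * fst (snd z) \<longrightarrow> w (fst z) (snd z) = 0" for k :: nat
    using b by (intro kruzhkov_support_strip[OF w M M0]) (auto elim: eventually_mono)
  moreover have "AE z in lborel. 0 < fst z \<longrightarrow> fst z < real k \<longrightarrow> \<rho> + M * sqrt (fst z) < (-1) * fst (snd z) \<longrightarrow> w (fst z) (snd z) = 0" for k :: nat
    using b by (intro kruzhkov_support_strip[OF w M M0]) (auto elim: eventually_mono)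
  ultimately have "AE z in lborel. \<forall>k. (0 < fst z \<longrightarrow> fst z < real k \<longrightarrow> \<rho> + M * sqrt (fst z) < 1 * fst (snd z) \<longrightarrow> w (fst z) (snd z) = 0)
    \<and> (0 < fst z \<longrightarrow> fst z < real k \<longrightarrow> \<rho> + M * sqrt (fst z) < (-1) * fst (snd z) \<longrightarrow> w (fst z) (snd z) = 0)"
    unfolding AE_all_countable by (auto intro: AE_conjI)
  then show ?thesis
  proof eventually_elim
    case (elim z)
    obtain k where "fst z < real k" using reals_Archimedean2 by blast
    with elim show ?case by (auto simp: abs_if split: if_splits)
  qed
qed

section \<open>Passage to the limit\<close>

text \<open>The dispersive estimate bounds each time slice almost everywhere; by Tonelli the
  exceptional set is null in space-time, once it is seen to be measurable, hence the Borel version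
  \<open>W\<close>. The absolute value is taken since \<open>dispersive_estimate\<close> fixes no
  sign of \<open>c\<close>; in the end only its square enters.\<close>

lemma dispersive_space_time_bound:
  assumes c: "dispersive_estimate c" and b: "L1_Linf b" "L1_norm b \<le> m" and w: "kruzhkov_solution b w"
  shows "AE z in lborel. 0 < fst z \<longrightarrow> \<bar>w (fst z) (snd z)\<bar> \<le> \<bar>c\<bar> * m powr (1 / 4) / sqrt (fst z)"
proof -
  define M where "M = \<bar>c\<bar> * m powr (1 / 4)"
  define W where "W z = indicator half_space z * w (fst z) (snd z)" for z
  have [measurable]: "W \<in> borel_measurable borel"
  proof -
    have "(\<lambda>z. indicator half_space z *\<^sub>R (case z of (t, x) \<Rightarrow> w t x)) = W"
      by (auto simp: W_def fun_eq_iff)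
    then show ?thesis
      using w unfolding kruzhkov_solution_def entropy_solution_def set_borel_measurable_def by simp
  qed
  have b0: "0 \<le> L1_norm b" by simp
  have slice: "AE x in lborel. \<bar>w t x\<bar> \<le> M / sqrt t" if t: "0 < t" for t
  proof -
    have "Lp_norm \<infinity> (w t) \<le> ereal (c * t powr (- 1 / 2) * L1_norm b powr (1 / 4))"
      using c b(1) w t unfolding dispersive_estimate_def by blast
    also have "c * t powr (- 1 / 2) * L1_norm b powr (1 / 4) \<le> \<bar>c\<bar> * t powr (- 1 / 2) * m powr (1 / 4)"
    proof (rule mult_mono[OF mult_right_mono[OF abs_ge_self]])
      show "L1_norm b powr (1 / 4) \<le> m powr (1 / 4)" using b(2) b0 by (intro powr_mono2) auto
    qed auto
    also have "\<bar>c\<bar> * t powr (- 1 / 2) * m powr (1 / 4) = M / sqrt t"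
    proof -
      have "t powr (- 1 / 2) = inverse (t powr (1 / 2))" using powr_minus[of t "1 / 2"] by simp
      then show ?thesis using t by (simp only: powr_half_sqrt) (simp add: M_def field_simps)
    qed
    finally have le: "esssup lborel (\<lambda>x. ereal \<bar>w t x\<bar>) \<le> ereal (M / sqrt t)"
      by (simp add: Lp_norm_def)
    have "AE x in lborel. ereal \<bar>w t x\<bar> \<le> esssup lborel (\<lambda>x. ereal \<bar>w t x\<bar>)"
      by (rule esssup_AE)
    then show ?thesis
    proof eventually_elim
      case (elim x)
      from order_trans[OF elim le] show ?case by simp
    qed
  qed
  have "AE z in lborel \<Otimes>\<^sub>M lborel. 0 < fst z \<longrightarrow> \<bar>W z\<bar> \<le> M / sqrt (fst z)"
  proof (rule lborel_pair.AE_pair_measure)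
    have "{z \<in> space borel. 0 < fst z \<longrightarrow> \<bar>W z\<bar> \<le> M / sqrt (fst z)} \<in> sets borel"
      by measurable
    then show "{z \<in> space (lborel \<Otimes>\<^sub>M lborel). 0 < fst z \<longrightarrow> \<bar>W z\<bar> \<le> M / sqrt (fst z)} \<in> sets (lborel \<Otimes>\<^sub>M lborel)"
      unfolding lborel_prod by simp
    show "AE t in lborel. AE x in lborel. 0 < fst (t, x) \<longrightarrow> \<bar>W (t, x)\<bar> \<le> M / sqrt (fst (t, x))"
    proof (rule AE_I2)
      fix t :: real
      show "AE x in lborel. 0 < fst (t, x) \<longrightarrow> \<bar>W (t, x)\<bar> \<le> M / sqrt (fst (t, x))"
      proof (cases "0 < t")
        case True
        then show ?thesis using slice[OF True] by (simp add: W_def half_space_def)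
      qed simp
    qed
  qed
  then have "AE z in lborel. 0 < fst z \<longrightarrow> \<bar>W z\<bar> \<le> M / sqrt (fst z)"
    unfolding lborel_prod .
  then show ?thesis
    by eventually_elim (auto simp: W_def half_space_def M_def indicator_def)
qed

section \<open>Integrals of bumps over the cone of propagation\<close>

lemma bump_integrable:
  assumes "0 < s" shows "integrable lborel (bump c d s)"
proof (rule Bochner_Integration.integrable_bound)
  show "integrable lborel (indicator {c<..<d} :: real \<Rightarrow> real)"
    by (intro integrable_real_indicator emeasure_bounded_finite) auto
  show "AE x in lborel. norm (bump c d s x) \<le> norm (indicator {c<..<d} x :: real)"
    using bump_le_indicator[OF assms] by (intro AE_I2) simp
qed simp

lemma bump_integral_le:
  assumes "0 < s" "c \<le> d" shows "integral\<^sup>L lborel (bump c d s) \<le> d - c"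
proof -
  have "integral\<^sup>L lborel (bump c d s) \<le> (\<integral>x. indicator {c<..<d} x \<partial>lborel)"
    using assms by (intro integral_mono bump_integrable bump_le_indicator integrable_real_indicator emeasure_bounded_finite) auto
  then show ?thesis using assms by simp
qed

lemma bump_integral_pos:
  assumes "0 < s" "c < d" shows "0 < integral\<^sup>L lborel (bump c d s)"
proof -
  have "integral\<^sup>L lborel (bump c d s) \<noteq> 0"
  proof
    assume "integral\<^sup>L lborel (bump c d s) = 0"
    then have "AE x in lborel. bump c d s x = 0"
      using bump_integrable[OF assms(1)] by (subst (asm) integral_nonneg_eq_0_iff_AE) auto
    then have "AE x in lborel. x \<notin> {c<..<d}"
    proof eventually_elim
      case (elim x)
      then show ?case using bump_pos[OF assms(1), of c x d] by auto
    qed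
    then have "emeasure lborel {c<..<d} = 0"
      by (subst (asm) AE_iff_measurable[of "{c<..<d}"]) auto
    then show False using assms by simp
  qed
  moreover have "0 \<le> integral\<^sup>L lborel (bump c d s)" by simp
  ultimately show ?thesis by linarith
qed

lemma test_function_bumps:
  assumes "0 < t0" "0 < s"
  shows "test_function (\<lambda>z. bump t0 t1 1 (fst z) * (bump (- real n) (real n) 1 (fst (snd z)) * bump p q s (snd (snd z))))"
proof (rule test_functionI[OF _ assms(1)])
  show "C_k k (\<lambda>z :: real \<times> real \<times> real. bump t0 t1 1 (fst z) * (bump (- real n) (real n) 1 (fst (snd z)) * bump p q s (snd (snd z))))" for k
    by (intro C_k_mult C_k_bump C_k_coordinates)
  have *: "x \<in> {c..d}" if "bump c d r x \<noteq> 0" "0 < r" for c d r x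
    using that bump_outside[of r x c d] by fastforce
  show "t \<in> {t0..t1} \<and> x \<in> {- real n..real n} \<and> y \<in> {p..q}"
    if "bump t0 t1 1 (fst (t, x, y)) * (bump (- real n) (real n) 1 (fst (snd (t, x, y))) * bump p q s (snd (snd (t, x, y)))) \<noteq> 0" for t x y
    using that assms(2) *[of t0 t1 1 t] *[of "- real n" "real n" 1 x] *[of p q s y] by simp
qed

text \<open>At time t the height \<open>M / sqrt t\<close> times the width
  \<open>2 * (\<rho> + M * sqrt t)\<close> is
  \<open>2 * M\<^sup>2 + 2 * M * \<rho> / sqrt t\<close>. The first term does not depend on t. The
  second decreases in t and is replaced by its value at \<open>t0\<close>, before which the time
  bump vanishes.\<close>

lemma nn_integral_cone:
  fixes M \<rho> :: real
  assumes M: "0 \<le> M" and \<rho>: "0 \<le> \<rho>" and t0: "0 < t0" and s: "0 < s"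
  shows "(\<integral>\<^sup>+z. ennreal (bump t0 t1 1 (fst z) * (M / sqrt (fst z)) *
      (indicator {- (\<rho> + M * sqrt (fst z))..\<rho> + M * sqrt (fst z)} (fst (snd z)) * bump p q s (snd (snd z)))) \<partial>lborel)
    \<le> ennreal ((2 * M\<^sup>2 + 2 * M * \<rho> / sqrt t0) * integral\<^sup>L lborel (bump t0 t1 1) * integral\<^sup>L lborel (bump p q s))"
    (is "?I \<le> _")
proof -
  define \<Theta> \<Psi> where "\<Theta> = integral\<^sup>L lborel (bump t0 t1 1)" and "\<Psi> = integral\<^sup>L lborel (bump p q s)"
  define A where "A t = bump t0 t1 1 t * (M / sqrt t)" for t
  define r where "r t = \<rho> + M * sqrt t" for t
  have nn\<Theta>: "(\<integral>\<^sup>+t. ennreal (bump t0 t1 1 t) \<partial>lborel) = ennreal \<Theta>"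
    unfolding \<Theta>_def by (intro nn_integral_eq_integral bump_integrable) auto
  have nn\<Psi>: "(\<integral>\<^sup>+y. ennreal (bump p q s y) \<partial>lborel) = ennreal \<Psi>"
    unfolding \<Psi>_def using s by (intro nn_integral_eq_integral bump_integrable) auto
  have \<Theta>\<Psi>: "0 \<le> \<Theta>" "0 \<le> \<Psi>" by (simp_all add: \<Theta>_def \<Psi>_def)
  have A_zero: "A t = 0" if "t \<le> t0" for t using that by (simp add: A_def bump_outside)
  have A_nn: "0 \<le> A t" for t
    using A_zero[of t] t0 M by (cases "t \<le> t0") (auto simp: A_def)
  have [measurable]: "A \<in> borel_measurable borel" unfolding A_def[abs_def] by measurable
  have [measurable]: "r \<in> borel_measurable borel" unfolding r_def[abs_def] by measurable
  have "(\<lambda>z::real \<times> real \<times> real. indicator {z. - r (fst z) \<le> fst (snd z) \<and> fst (snd z) \<le> r (fst z)} z :: real) \<in> borel_measurable borel"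
    by measurable
  also have "(\<lambda>z::real \<times> real \<times> real. indicator {z. - r (fst z) \<le> fst (snd z) \<and> fst (snd z) \<le> r (fst z)} z :: real) =
    (\<lambda>z. indicator {- r (fst z)..r (fst z)} (fst (snd z)))"
    by (auto simp: indicator_def fun_eq_iff)
  finally have [measurable]: "(\<lambda>z::real \<times> real \<times> real. indicator {- r (fst z)..r (fst z)} (fst (snd z)) :: real) \<in> borel_measurable borel" .
  let ?f = "\<lambda>z. ennreal (A (fst z) * (indicator {- r (fst z)..r (fst z)} (fst (snd z)) * bump p q s (snd (snd z))))"
  have f: "?f \<in> borel_measurable (lborel \<Otimes>\<^sub>M lborel)"
    unfolding lborel_prod by measurable
  have "?I = (\<integral>\<^sup>+z. ?f z \<partial>(lborel \<Otimes>\<^sub>M lborel))"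
    unfolding lborel_prod A_def r_def by simp
  also have "\<dots> = (\<integral>\<^sup>+t. \<integral>\<^sup>+x. ?f (t, x) \<partial>lborel \<partial>lborel)"
    by (rule lborel.nn_integral_fst[OF f, symmetric])
  also have "\<dots> = (\<integral>\<^sup>+t. ennreal (A t) * (\<integral>\<^sup>+x. ennreal (indicator {- r t..r t} (fst x)) * ennreal (bump p q s (snd x)) \<partial>lborel) \<partial>lborel)"
  proof (rule nn_integral_cong)
    fix t
    have m: "(\<lambda>x. ennreal (indicator {- r t..r t} (fst x)) * ennreal (bump p q s (snd x))) \<in> borel_measurable (lborel :: (real \<times> real) measure)"
      unfolding lborel_prod[symmetric] by measurable
    show "(\<integral>\<^sup>+x. ?f (t, x) \<partial>lborel) = ennreal (A t) * (\<integral>\<^sup>+x. ennreal (indicator {- r t..r t} (fst x)) * ennreal (bump p q s (snd x)) \<partial>lborel)"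
      using A_nn by (subst nn_integral_cmult[OF m, symmetric]) (simp add: ennreal_mult)
  qed
  also have "\<dots> = (\<integral>\<^sup>+t. ennreal (A t) * (ennreal \<Psi> * emeasure lborel {- r t..r t}) \<partial>lborel)"
  proof (rule nn_integral_cong)
    fix t
    have "(\<integral>\<^sup>+x. ennreal (indicator {- r t..r t} (fst x)) * ennreal (bump p q s (snd x)) \<partial>lborel) =
      (\<integral>\<^sup>+x. \<integral>\<^sup>+y. ennreal (indicator {- r t..r t} x) * ennreal (bump p q s y) \<partial>lborel \<partial>lborel)"
      unfolding lborel_prod[symmetric] by (subst lborel.nn_integral_fst[symmetric]) auto
    also have "\<dots> = (\<integral>\<^sup>+x. ennreal \<Psi> * indicator {- r t..r t} x \<partial>lborel)"
      by (simp add: nn_integral_cmult nn_integral_multc nn\<Psi> ennreal_indicator mult.commute)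
    also have "\<dots> = ennreal \<Psi> * emeasure lborel {- r t..r t}"
      by (simp add: nn_integral_cmult_indicator)
    finally show "ennreal (A t) * (\<integral>\<^sup>+x. ennreal (indicator {- r t..r t} (fst x)) * ennreal (bump p q s (snd x)) \<partial>lborel) =
      ennreal (A t) * (ennreal \<Psi> * emeasure lborel {- r t..r t})" by simp
  qed
  also have "\<dots> \<le> (\<integral>\<^sup>+t. ennreal ((2 * M\<^sup>2 + 2 * M * \<rho> / sqrt t0) * \<Psi>) * ennreal (bump t0 t1 1 t) \<partial>lborel)"
  proof (rule nn_integral_mono)
    fix t
    show "ennreal (A t) * (ennreal \<Psi> * emeasure lborel {- r t..r t}) \<le>
      ennreal ((2 * M\<^sup>2 + 2 * M * \<rho> / sqrt t0) * \<Psi>) * ennreal (bump t0 t1 1 t)"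
    proof (cases "t \<le> t0")
      case True
      then show ?thesis by (simp add: A_zero)
    next
      case False
      then have t: "t0 < t" "0 < t" using t0 by auto
      have r: "0 \<le> r t" using M \<rho> t by (simp add: r_def)
      have "A t * (\<Psi> * (2 * r t)) = (2 * M\<^sup>2 + 2 * M * \<rho> / sqrt t) * \<Psi> * bump t0 t1 1 t"
      proof -
        have "M / sqrt t * (2 * r t) = 2 * M\<^sup>2 + 2 * M * \<rho> / sqrt t"
          using t by (simp add: r_def field_simps power2_eq_square)
        moreover have "A t * (\<Psi> * (2 * r t)) = (M / sqrt t * (2 * r t)) * \<Psi> * bump t0 t1 1 t"
          by (simp add: A_def)
        ultimately show ?thesis by simp
      qed
      also have "\<dots> \<le> (2 * M\<^sup>2 + 2 * M * \<rho> / sqrt t0) * \<Psi> * bump t0 t1 1 t"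
        using t t0 M \<rho> \<Theta>\<Psi> by (intro mult_right_mono add_mono divide_left_mono) auto
      finally have "ennreal (A t * (\<Psi> * (2 * r t))) \<le> ennreal ((2 * M\<^sup>2 + 2 * M * \<rho> / sqrt t0) * \<Psi> * bump t0 t1 1 t)"
        by (rule ennreal_leI)
      moreover have "emeasure lborel {- r t..r t} = ennreal (2 * r t)"
        using r by (simp add: emeasure_lborel_Icc)
      ultimately show ?thesis
        using A_nn \<Theta>\<Psi> r M \<rho> t0 by (simp add: ennreal_mult' ennreal_mult)
    qed
  qed
  also have "\<dots> = ennreal ((2 * M\<^sup>2 + 2 * M * \<rho> / sqrt t0) * \<Psi>) * ennreal \<Theta>"
    by (simp add: nn_integral_cmult nn\<Theta>)
  also have "\<dots> = ennreal ((2 * M\<^sup>2 + 2 * M * \<rho> / sqrt t0) * \<Theta> * \<Psi>)"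
    using M \<rho> t0 \<Theta>\<Psi> by (simp add: ennreal_mult'[symmetric] ennreal_mult[symmetric] mult_ac)
  finally show ?thesis unfolding \<Theta>_def \<Psi>_def .
qed

text \<open>The complement of the essential support is a union of possibly uncountably many open
  sets on each of which \<open>f\<close> vanishes almost everywhere; the Lindelof property leaves
  countably many.\<close>

lemma ess_support_AE:
  assumes "ess_support f \<subseteq> A" "closed A"
  shows "AE x in lborel. x \<notin> A \<longrightarrow> f x = 0"
proof -
  define \<F> where "\<F> = {U. open U \<and> (AE x in lborel. x \<in> U \<longrightarrow> f x = 0)}"
  obtain \<F>' where \<F>': "\<F>' \<subseteq> \<F>" "countable \<F>'" "\<Union>\<F>' = \<Union>\<F>"
    using Lindelof[of \<F>] unfolding \<F>_def by blast
  have "AE x in lborel. \<forall>U\<in>\<F>'. x \<in> U \<longrightarrow> f x = 0"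
    using \<F>' by (subst AE_ball_countable) (auto simp: \<F>_def)
  moreover have "- A \<subseteq> \<Union>\<F>'"
    using assms(1) unfolding \<F>'(3) ess_support_def \<F>_def by blast
  ultimately show ?thesis
    by (auto elim!: eventually_mono)
qed

text \<open>The finite speed of propagation replaces the bump in x1 by the indicator of the cone,
  which makes the bound independent of \<open>n\<close>.\<close>

lemma kruzhkov_bump_integral_le:
  fixes M \<rho> :: real and w :: field2
  assumes w: "kruzhkov_solution b w"
    and M: "AE z in lborel. 0 < fst z \<longrightarrow> \<bar>w (fst z) (snd z)\<bar> \<le> M / sqrt (fst z)" and M0: "0 \<le> M"
    and b: "AE x in lborel. \<rho> < \<bar>fst x\<bar> \<longrightarrow> b x = 0"
    and \<rho>: "0 \<le> \<rho>" and t0: "0 < t0" and s: "0 < s"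
  shows "\<bar>set_lebesgue_integral lborel half_space (\<lambda>(t, x). w t x *
      (bump t0 t1 1 t * (bump (- real n) (real n) 1 (fst x) * bump p q s (snd x))))\<bar>
    \<le> (2 * M\<^sup>2 + 2 * M * \<rho> / sqrt t0) * integral\<^sup>L lborel (bump t0 t1 1) * integral\<^sup>L lborel (bump p q s)"
    (is "\<bar>?I\<bar> \<le> ?B")
proof -
  let ?\<phi> = "\<lambda>z. bump t0 t1 1 (fst z) * (bump (- real n) (real n) 1 (fst (snd z)) * bump p q s (snd (snd z)))"
  define F where "F z = indicator half_space z *\<^sub>R (w (fst z) (snd z) * ?\<phi> z)" for z
  have I: "?I = integral\<^sup>L lborel F"
    unfolding set_lebesgue_integral_def F_def by (simp add: split_beta)
  have B0: "0 \<le> ?B" using M0 \<rho> t0 by simp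
  have F_le: "AE z in lborel. ennreal (norm (F z)) \<le> ennreal (bump t0 t1 1 (fst z) * (M / sqrt (fst z)) *
      (indicator {- (\<rho> + M * sqrt (fst z))..\<rho> + M * sqrt (fst z)} (fst (snd z)) * bump p q s (snd (snd z))))"
    using M kruzhkov_support[OF w M M0 b]
  proof eventually_elim
    case (elim z)
    obtain t x y where z: "z = (t, x, y)" by (cases z)
    show ?case
    proof (cases "t0 < t \<and> \<bar>x\<bar> \<le> \<rho> + M * sqrt t")
      case True
      then have t: "0 < t" using t0 by auto
      have "\<bar>w t (x, y)\<bar> * (bump t0 t1 1 t * (bump (- real n) (real n) 1 x * bump p q s y)) \<le>
        M / sqrt t * (bump t0 t1 1 t * (1 * bump p q s y))"
        using elim t M0 by (intro mult_mono) (auto simp: z)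
      moreover have "indicator {- (\<rho> + M * sqrt t)..\<rho> + M * sqrt t} x = (1::real)"
        using True by (auto simp: indicator_def abs_le_iff)
      ultimately show ?thesis
        using t by (intro ennreal_leI) (simp add: F_def z half_space_def abs_mult mult_ac)
    next
      case False
      then have "F z = 0"
        using elim t0 by (cases "t0 < t") (auto simp: F_def z bump_outside not_le)
      then show ?thesis by simp
    qed
  qed
  show ?thesis
  \<comment> \<open>A nonintegrable \<open>F\<close> would have integral 0 by convention, which
    satisfies the bound as well.\<close>
  proof (cases "integrable lborel F")
    case True
    have "ennreal (norm (integral\<^sup>L lborel F)) \<le> (\<integral>\<^sup>+z. ennreal (norm (F z)) \<partial>lborel)"
      using True by (rule integral_norm_bound_ennreal)
    also have "\<dots> \<le> ennreal ?B"
      by (rule order_trans[OF nn_integral_mono_AE[OF F_le] nn_integral_cone[OF M0 \<rho> t0 s]])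
    finally show ?thesis using B0 unfolding I by (simp add: ennreal_le_iff)
  next
    case False
    then show ?thesis using B0 unfolding I by (simp add: not_integrable_integral_eq)
  qed
qed

text \<open>In contrast to \<open>wide_bump\<close> the steepness stays 1. No derivative falls on
  this cutoff, and its limit has to be exactly 1 for the constant to survive.\<close>

lemma bump_wide_tendsto: "(\<lambda>n. bump (- real n) (real n) 1 x) \<longlonglongrightarrow> 1"
proof -
  have n: "filterlim real at_top sequentially" by (rule filterlim_real_sequentially)
  have "filterlim (\<lambda>n. x + real n) at_top sequentially" "filterlim (\<lambda>n. - x + real n) at_top sequentially"
    by (intro filterlim_tendsto_add_at_top[OF tendsto_const n])+
  from tendsto_mult[OF this[THEN flat_tendsto_1]] show ?thesis
    by (simp add: bump_def)
qed

text \<open>Distributional convergence needs compact support, so m tends to infinity first with the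
  bump in x1 fixed, which removes the term with \<open>\<rho> = 1 / m\<close>. Only then is that
  bump opened, by dominated convergence for the limit \<open>u\<close> itself.\<close>

lemma distributional_limit_bump_le:
  fixes u :: field2 and um :: "nat \<Rightarrow> field2"
  assumes lim: "distributional_limit um u"
    and u: "set_borel_measurable lborel half_space (\<lambda>(t, x). u t x)"
    and C: "AE t in lborel. 0 < t \<longrightarrow> integrable lborel (u t) \<and> L1_norm (u t) \<le> C"
    and um: "\<And>m. 1 \<le> m \<Longrightarrow> kruzhkov_solution (am m) (um m)"
    and M: "\<And>m. 1 \<le> m \<Longrightarrow> AE z in lborel. 0 < fst z \<longrightarrow> \<bar>um m (fst z) (snd z)\<bar> \<le> M / sqrt (fst z)" and M0: "0 \<le> M"
    and am: "\<And>m. 1 \<le> m \<Longrightarrow> AE x in lborel. 1 / real m < \<bar>fst x\<bar> \<longrightarrow> am m x = 0"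
    and t0: "0 < t0" and s: "0 < s"
  shows "integrable lborel (\<lambda>t. bump t0 t1 1 t * (\<integral>x. u t x * bump p q s (snd x) \<partial>lborel))"
    and "\<bar>\<integral>t. bump t0 t1 1 t * (\<integral>x. u t x * bump p q s (snd x) \<partial>lborel) \<partial>lborel\<bar> \<le>
      2 * M\<^sup>2 * integral\<^sup>L lborel (bump t0 t1 1) * integral\<^sup>L lborel (bump p q s)"
proof -
  define \<Theta> \<Psi> where "\<Theta> = integral\<^sup>L lborel (bump t0 t1 1)" and "\<Psi> = integral\<^sup>L lborel (bump p q s)"
  \<comment> \<open>Cutting at \<open>t1\<close>, where the time bump ends, makes \<open>u\<close>
    integrable over space-time. This supplies the majorant for the limit in \<open>n\<close> and
    permits Fubini.\<close>
  define U where "U z = indicator {0<..<t1} (fst z) * u (fst z) (snd z)" for z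
  have U: "integrable lborel U"
    unfolding U_def[abs_def] using C by (intro integrable_strip[OF u, where C = C]) (auto elim: eventually_mono)
  then have [measurable]: "U \<in> borel_measurable borel"
    using borel_measurable_integrable[OF U] by simp
  define \<theta> where "\<theta> z = bump t0 t1 1 (fst z) * bump p q s (snd (snd z))" for z :: "real \<times> real \<times> real"
  have U\<theta>: "integrable lborel (\<lambda>z. U z * \<theta> z)"
  proof (rule integrable_times_bounded[OF U])
    show "\<theta> \<in> borel_measurable lborel" unfolding \<theta>_def[abs_def] by measurable
    show "\<bar>\<theta> z\<bar> \<le> 1" for z by (simp add: \<theta>_def mult_le_one)
  qed
  define I where "I n = (\<integral>z. U z * (bump t0 t1 1 (fst z) * (bump (- real n) (real n) 1 (fst (snd z)) * bump p q s (snd (snd z)))) \<partial>lborel)" for n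
  have I_eq: "set_lebesgue_integral lborel half_space (\<lambda>(t, x). u t x *
      (bump t0 t1 1 t * (bump (- real n) (real n) 1 (fst x) * bump p q s (snd x)))) = I n" for n
    unfolding set_lebesgue_integral_def I_def
  proof (rule Bochner_Integration.integral_cong[OF refl])
    fix z :: "real \<times> real \<times> real"
    have "t < t1" if "bump t0 t1 1 t \<noteq> 0" for t
      using that bump_outside[of 1 t t0 t1] by fastforce
    then show "indicator half_space z *\<^sub>R (case z of (t, x) \<Rightarrow> u t x *
      (bump t0 t1 1 t * (bump (- real n) (real n) 1 (fst x) * bump p q s (snd x)))) =
      U z * (bump t0 t1 1 (fst z) * (bump (- real n) (real n) 1 (fst (snd z)) * bump p q s (snd (snd z))))"
      by (cases z) (auto simp: U_def half_space_def indicator_def)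
  qed
  have I_le: "\<bar>I n\<bar> \<le> 2 * M\<^sup>2 * \<Theta> * \<Psi>" for n
  proof -
    let ?J = "\<lambda>m. set_lebesgue_integral lborel half_space (\<lambda>(t, x). um m t x *
      (bump t0 t1 1 t * (bump (- real n) (real n) 1 (fst x) * bump p q s (snd x))))"
    have le: "\<bar>?J m\<bar> \<le> (2 * M\<^sup>2 + 2 * M * (1 / real m) / sqrt t0) * \<Theta> * \<Psi>" if "1 \<le> m" for m
      unfolding \<Theta>_def \<Psi>_def using that by (intro kruzhkov_bump_integral_le[where b = "am m"] um M M0 am t0 s) auto
    have "?J \<longlonglongrightarrow> I n"
      using lim[unfolded distributional_limit_def, rule_format, OF test_function_bumps[OF t0 s, of t1 n p q]]
      unfolding I_eq[symmetric] by (simp only: fst_conv snd_conv)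
    then have "(\<lambda>m. \<bar>?J m\<bar>) \<longlonglongrightarrow> \<bar>I n\<bar>" by (rule tendsto_rabs)
    moreover have "(\<lambda>m. (2 * M\<^sup>2 + 2 * M * (1 / real m) / sqrt t0) * \<Theta> * \<Psi>) \<longlonglongrightarrow> (2 * M\<^sup>2 + 2 * M * 0 / sqrt t0) * \<Theta> * \<Psi>"
      using t0 by (intro tendsto_intros lim_const_over_n) auto
    ultimately have "\<bar>I n\<bar> \<le> (2 * M\<^sup>2 + 2 * M * 0 / sqrt t0) * \<Theta> * \<Psi>"
      by (rule LIMSEQ_le) (use le in blast)
    then show ?thesis by simp
  qed
  have "I \<longlonglongrightarrow> (\<integral>z. U z * \<theta> z \<partial>lborel)"
    unfolding I_def[abs_def]
  proof (rule integral_dominated_convergence)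
    show "integrable lborel (\<lambda>z. \<bar>U z\<bar>)" using U by simp
    show "AE z in lborel. (\<lambda>n. U z * (bump t0 t1 1 (fst z) * (bump (- real n) (real n) 1 (fst (snd z)) * bump p q s (snd (snd z))))) \<longlonglongrightarrow> U z * \<theta> z"
    proof (rule AE_I2)
      fix z :: "real \<times> real \<times> real"
      have "(\<lambda>n. U z * (bump t0 t1 1 (fst z) * (bump (- real n) (real n) 1 (fst (snd z)) * bump p q s (snd (snd z))))) \<longlonglongrightarrow>
        U z * (bump t0 t1 1 (fst z) * (1 * bump p q s (snd (snd z))))"
        by (intro tendsto_intros bump_wide_tendsto)
      then show "(\<lambda>n. U z * (bump t0 t1 1 (fst z) * (bump (- real n) (real n) 1 (fst (snd z)) * bump p q s (snd (snd z))))) \<longlonglongrightarrow> U z * \<theta> z"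
        by (simp add: \<theta>_def)
    qed
    show "AE z in lborel. norm (U z * (bump t0 t1 1 (fst z) * (bump (- real n) (real n) 1 (fst (snd z)) * bump p q s (snd (snd z))))) \<le> \<bar>U z\<bar>" for n
      by (intro AE_I2) (simp add: abs_mult mult_left_le mult_le_one)
    show "(\<lambda>z. U z * \<theta> z) \<in> borel_measurable lborel"
      by (rule borel_measurable_integrable[OF U\<theta>])
  qed measurable
  then have le: "\<bar>\<integral>z. U z * \<theta> z \<partial>lborel\<bar> \<le> 2 * M\<^sup>2 * \<Theta> * \<Psi>"
    using I_le by (intro LIMSEQ_le_const2[OF tendsto_rabs]) auto
  have inner: "(\<integral>x. U (t, x) * \<theta> (t, x) \<partial>lborel) = bump t0 t1 1 t * (\<integral>x. u t x * bump p q s (snd x) \<partial>lborel)" for t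
  proof (cases "t0 < t \<and> t < t1")
    case True
    then have "(\<integral>x. U (t, x) * \<theta> (t, x) \<partial>lborel) = (\<integral>x. bump t0 t1 1 t * (u t x * bump p q s (snd x)) \<partial>lborel)"
      using t0 by (intro Bochner_Integration.integral_cong) (auto simp: U_def \<theta>_def)
    then show ?thesis by simp
  next
    case False
    then have "bump t0 t1 1 t = 0" by (auto intro!: bump_outside)
    then show ?thesis by (simp add: \<theta>_def)
  qed
  have "integrable (lborel \<Otimes>\<^sub>M lborel) (\<lambda>z. U z * \<theta> z)" using U\<theta> by (simp add: lborel_prod)
  from lborel_pair.integrable_fst'[OF this] lborel_pair.integral_fst'[OF this] le
  show "integrable lborel (\<lambda>t. bump t0 t1 1 t * (\<integral>x. u t x * bump p q s (snd x) \<partial>lborel))"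
    and "\<bar>\<integral>t. bump t0 t1 1 t * (\<integral>x. u t x * bump p q s (snd x) \<partial>lborel) \<partial>lborel\<bar> \<le>
      2 * M\<^sup>2 * integral\<^sup>L lborel (bump t0 t1 1) * integral\<^sup>L lborel (bump p q s)"
    by (simp_all add: inner lborel_prod \<Theta>_def \<Psi>_def)
qed

text \<open>Only time averages of \<open>J\<close> are controlled. Near 0, \<open>J\<close> is
  within \<open>e\<close> of \<open>l\<close> at almost every time, so averaging over a short
  interval next to 0 and dividing by the positive mass of the bump passes the bound on to
  \<open>l\<close>.\<close>

lemma ess_limit_le:
  fixes J :: "real \<Rightarrow> real"
  assumes lim: "(J \<longlongrightarrow> l) (inf (at_right 0) (ae_filter lborel))"
    and int: "\<And>t0 t1. 0 < t0 \<Longrightarrow> integrable lborel (\<lambda>t. bump t0 t1 1 t * J t)"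
    and le: "\<And>t0 t1. 0 < t0 \<Longrightarrow> \<bar>\<integral>t. bump t0 t1 1 t * J t \<partial>lborel\<bar> \<le> c * integral\<^sup>L lborel (bump t0 t1 1)"
  shows "\<bar>l\<bar> \<le> c"
proof (rule field_le_epsilon)
  fix e :: real assume "0 < e"
  with lim have "\<forall>\<^sub>F t in inf (at_right 0) (ae_filter lborel). dist (J t) l < e"
    by (rule tendstoD)
  then obtain Q R where Q: "\<forall>\<^sub>F t in at_right (0::real). Q t" and R: "AE t in lborel. R t"
    and QR: "\<And>t. Q t \<Longrightarrow> R t \<Longrightarrow> dist (J t) l < e"
    unfolding eventually_inf by blast
  obtain \<delta> where \<delta>: "0 < \<delta>" "\<And>t. 0 < t \<Longrightarrow> t < \<delta> \<Longrightarrow> Q t"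
    using Q eventually_at_right[of 0 "1::real" Q] by auto
  let ?b = "bump (\<delta> / 2) \<delta> 1"
  have b: "integrable lborel ?b" by (rule bump_integrable) simp
  have \<Theta>: "0 < integral\<^sup>L lborel ?b" using \<delta> by (intro bump_integral_pos) auto
  note J = int[of "\<delta> / 2" \<delta>] le[of "\<delta> / 2" \<delta>]
  have "AE t in lborel. norm (?b t * J t - l * ?b t) \<le> e * ?b t"
    using R
  proof eventually_elim
    case (elim t)
    show ?case
    proof (cases "\<delta> / 2 < t \<and> t < \<delta>")
      case True
      then have "\<bar>J t - l\<bar> \<le> e" using \<delta> QR[OF _ elim] by (simp add: dist_real_def less_imp_le)
      then have "?b t * \<bar>J t - l\<bar> \<le> ?b t * e" by (rule mult_left_mono) simp
      moreover have "?b t * J t - l * ?b t = ?b t * (J t - l)" by (simp add: algebra_simps)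
      ultimately show ?thesis by (simp add: abs_mult mult.commute)
    next
      case False
      then have "?b t = 0" by (auto intro!: bump_outside)
      then show ?thesis by simp
    qed
  qed
  moreover have "integrable lborel (\<lambda>t. ?b t * J t - l * ?b t)"
    using b J(1) \<delta> by simp
  ultimately have "(\<integral>t. norm (?b t * J t - l * ?b t) \<partial>lborel) \<le> (\<integral>t. e * ?b t \<partial>lborel)"
    using b by (intro integral_mono_AE integrable_norm) simp_all
  then have "norm (\<integral>t. ?b t * J t - l * ?b t \<partial>lborel) \<le> (\<integral>t. e * ?b t \<partial>lborel)"
    by (rule order_trans[OF integral_norm_bound])
  moreover have "(\<integral>t. ?b t * J t - l * ?b t \<partial>lborel) = (\<integral>t. ?b t * J t \<partial>lborel) - l * integral\<^sup>L lborel ?b"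
    using b J(1) \<delta> by (subst Bochner_Integration.integral_diff) auto
  moreover have "\<bar>l * integral\<^sup>L lborel ?b\<bar> = \<bar>l\<bar> * integral\<^sup>L lborel ?b"
    using \<Theta> by (simp add: abs_mult)
  ultimately have "\<bar>l\<bar> * integral\<^sup>L lborel ?b \<le> c * integral\<^sup>L lborel ?b + e * integral\<^sup>L lborel ?b"
    using J(2) \<delta> by simp
  then have "\<bar>l\<bar> * integral\<^sup>L lborel ?b \<le> (c + e) * integral\<^sup>L lborel ?b" by (simp add: algebra_simps)
  then show "\<bar>l\<bar> \<le> c + e" using \<Theta> by simp
qed

lemma signed_integral_bump_le:
  assumes c: "dispersive_estimate c" and g: "signed_measure g"
    and u: "admissible_solution (delta_axis g) u"
    and am: "approximate_data (delta_axis g) am"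
    and um: "\<And>m. 1 \<le> m \<Longrightarrow> kruzhkov_solution (am m) (um m)"
    and lim: "distributional_limit um u" and s: "0 < s"
  shows "\<bar>signed_integral g (bump p q s)\<bar> \<le>
    2 * (\<bar>c\<bar> * tv_norm g powr (1 / 4))\<^sup>2 * integral\<^sup>L lborel (bump p q s)"
proof (rule ess_limit_le)
  \<comment> \<open>One \<open>M\<close> serves all \<open>m\<close>, because the mass of the
    approximate data is bounded by the total variation of the datum.\<close>
  define M where "M = \<bar>c\<bar> * tv_norm g powr (1 / 4)"
  have M0: "0 \<le> M" by (simp add: M_def)
  let ?J = "\<lambda>t. \<integral>x. u t x * bump p q s (snd x) \<partial>lborel"
  \<comment> \<open>This function is constant in x1, hence not compactly supported unless it is
    zero; narrow convergence admits every bounded continuous function.\<close>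
  have cont: "continuous_on UNIV (\<lambda>x::real \<times> real. bump p q s (snd x))"
    by (intro continuous_on_compose2[OF bump_continuous[of UNIV]] continuous_intros) auto
  moreover have "bounded (range (\<lambda>x::real \<times> real. bump p q s (snd x)))"
    by (intro boundedI[of _ 1]) auto
  ultimately have "(?J \<longlongrightarrow> signed_integral (delta_axis g) (\<lambda>x. bump p q s (snd x))) (inf (at_right 0) (ae_filter lborel))"
    using u unfolding admissible_solution_def narrow_lim_def by blast
  then show "(?J \<longlongrightarrow> signed_integral g (bump p q s)) (inf (at_right 0) (ae_filter lborel))"
    using signed_integral_delta_axis[OF g borel_measurable_continuous_onI[OF cont]] by simp
  obtain C where C: "AE t in lborel. 0 < t \<longrightarrow> integrable lborel (u t) \<and> L1_norm (u t) \<le> C"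
    using u unfolding admissible_solution_def by blast
  have u': "set_borel_measurable lborel half_space (\<lambda>(t, x). u t x)"
    using u unfolding admissible_solution_def entropy_solution_def by blast
  have M: "AE z in lborel. 0 < fst z \<longrightarrow> \<bar>um m (fst z) (snd z)\<bar> \<le> M / sqrt (fst z)" if "1 \<le> m" for m
    unfolding M_def using c that am um[OF that]
    by (intro dispersive_space_time_bound[where b = "am m"]) (auto simp: approximate_data_def tv_norm_delta_axis[OF g])
  have supp: "AE x in lborel. 1 / real m < \<bar>fst x\<bar> \<longrightarrow> am m x = 0" if "1 \<le> m" for m
  proof -
    have "ess_support (am m) \<subseteq> {- 1 / real m..1 / real m} \<times> UNIV"
      using am that unfolding approximate_data_def by blast
    then have "AE x in lborel. x \<notin> {- 1 / real m..1 / real m} \<times> UNIV \<longrightarrow> am m x = 0"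
      by (rule ess_support_AE) (intro closed_Times closed_atLeastAtMost closed_UNIV)
    then show ?thesis by (auto elim!: eventually_mono)
  qed
  fix t0 t1 :: real assume t0: "0 < t0"
  note * = distributional_limit_bump_le[OF lim u' C um M M0 supp t0 s, of t1 p q]
  show "integrable lborel (\<lambda>t. bump t0 t1 1 t * ?J t)"
    by (rule *(1))
  show "\<bar>\<integral>t. bump t0 t1 1 t * ?J t \<partial>lborel\<bar> \<le>
      2 * (\<bar>c\<bar> * tv_norm g powr (1 / 4))\<^sup>2 * integral\<^sup>L lborel (bump p q s) * integral\<^sup>L lborel (bump t0 t1 1)"
    using *(2) unfolding M_def by (simp add: mult_ac)
qed

section \<open>The density of the datum\<close>

text \<open>Bumps of steepness n tend to the indicator of the open interval, whose length bounds
  their integrals. Half-open intervals, on which Stieltjes measures are determined, are decreasing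
  intersections of open ones.\<close>

lemma signed_measure_interval_le:
  assumes g: "signed_measure g" and L: "0 \<le> L"
    and bump: "\<And>p q s. 0 < s \<Longrightarrow> \<bar>signed_integral g (bump p q s)\<bar> \<le> L * integral\<^sup>L lborel (bump p q s)"
    and pq: "p \<le> q"
  shows "\<bar>g {p<..q}\<bar> \<le> L * (q - p)"
proof -
  let ?P = "pos_variation g" and ?N = "neg_variation g"
  have P: "finite_measure ?P" and N: "finite_measure ?N"
    using finite_measure_pos_variation g signed_measure_uminus[OF g] by (auto simp: neg_variation_def)
  have Ioo: "\<bar>g {p<..<r}\<bar> \<le> L * (r - p)" if "p \<le> r" for r
  proof -
    have *: "filterlim (\<lambda>n. real n * c) at_top sequentially" if "0 < c" for c
      using filterlim_tendsto_pos_mult_at_top[OF tendsto_const that filterlim_real_sequentially]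
      by (simp add: mult.commute)
    have pw: "(\<lambda>n. bump p r (real n) x) \<longlonglongrightarrow> indicator {p<..<r} x" for x
    proof (cases "x \<in> {p<..<r}")
      case True
      then have "0 < x - p" "0 < r - x" by auto
      then have "filterlim (\<lambda>n. real n * (x - p)) at_top sequentially" "filterlim (\<lambda>n. real n * (r - x)) at_top sequentially"
        by (auto intro!: *)
      from tendsto_mult[OF this[THEN flat_tendsto_1]] True show ?thesis
        by (simp add: bump_def)
    next
      case False
      have "\<forall>\<^sub>F n in sequentially. 0 = bump p r (real n) x"
        using eventually_gt_at_top[of 0] by eventually_elim (use False in \<open>auto simp: not_less intro!: bump_outside\<close>)
      then show ?thesis using False by (auto intro: Lim_transform_eventually[OF tendsto_const])
    qed
    have lim: "(\<lambda>n. \<integral>x. bump p r (real n) x \<partial>\<mu>) \<longlonglongrightarrow> measure \<mu> {p<..<r}"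
      if "finite_measure \<mu>" and [measurable_cong]: "sets \<mu> = sets borel" for \<mu> :: "real measure"
    proof -
      interpret finite_measure \<mu> by fact
      have "(\<lambda>n. \<integral>x. bump p r (real n) x \<partial>\<mu>) \<longlonglongrightarrow> (\<integral>x. indicator {p<..<r} x \<partial>\<mu>)"
        using pw by (intro integral_dominated_convergence[where w = "\<lambda>_. 1"]) auto
      then show ?thesis using sets_eq_imp_space_eq[OF that(2)] by simp
    qed
    have "(\<lambda>n. signed_integral g (bump p r (real n))) \<longlonglongrightarrow> measure ?P {p<..<r} - measure ?N {p<..<r}"
      unfolding signed_integral_def using P N by (intro tendsto_diff lim) auto
    then have "(\<lambda>n. signed_integral g (bump p r (real n))) \<longlonglongrightarrow> g {p<..<r}"
      by (simp add: signed_measure_eq_variations[OF g])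
    then have "(\<lambda>n. \<bar>signed_integral g (bump p r (real n))\<bar>) \<longlonglongrightarrow> \<bar>g {p<..<r}\<bar>"
      by (rule tendsto_rabs)
    moreover have "\<bar>signed_integral g (bump p r (real n))\<bar> \<le> L * (r - p)" if "1 \<le> n" for n
      using bump[of "real n" p r] mult_left_mono[OF bump_integral_le[of "real n" p r] L] that \<open>p \<le> r\<close> by simp
    ultimately show ?thesis
      by (intro LIMSEQ_le_const2) auto
  qed
  define r where "r n = q + inverse (real (Suc n))" for n
  have r: "r \<longlonglongrightarrow> q"
    unfolding r_def using tendsto_add[OF tendsto_const[of q] LIMSEQ_inverse_real_of_nat] by simp
  have dec: "decseq (\<lambda>n. {p<..<r n})"
  proof (rule antimonoI)
    fix m n :: nat assume "m \<le> n"
    then have "r n \<le> r m" unfolding r_def by (intro add_left_mono le_imp_inverse_le) auto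
    then show "{p<..<r n} \<subseteq> {p<..<r m}" by auto
  qed
  have INT_eq: "(\<Inter>n. {p<..<r n}) = {p<..q}"
  proof (intro equalityI subsetI)
    fix x assume "x \<in> (\<Inter>n. {p<..<r n})"
    then have "p < x" "\<And>n. x \<le> r n" by (auto intro: less_imp_le)
    then show "x \<in> {p<..q}" using LIMSEQ_le_const[OF r, of x] by auto
  next
    have "q < r n" for n by (simp add: r_def)
    then have "x \<in> {p<..<r n}" if "x \<in> {p<..q}" for x n
      using that order.strict_trans1[of x q "r n"] by simp
    then show "x \<in> (\<Inter>n. {p<..<r n})" if "x \<in> {p<..q}" for x
      using that by blast
  qed
  have lim: "(\<lambda>n. measure \<mu> {p<..<r n}) \<longlonglongrightarrow> measure \<mu> {p<..q}"
    if "finite_measure \<mu>" and "sets \<mu> = sets borel" for \<mu> :: "real measure"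
  proof -
    have "range (\<lambda>n. {p<..<r n}) \<subseteq> sets \<mu>"
      unfolding that(2) by (intro image_subsetI) simp
    then have "(\<lambda>n. measure \<mu> {p<..<r n}) \<longlonglongrightarrow> measure \<mu> (\<Inter>n. {p<..<r n})"
      using dec by (rule finite_measure.finite_Lim_measure_decseq[OF that(1)])
    then show ?thesis by (simp only: INT_eq)
  qed
  have "(\<lambda>n. measure ?P {p<..<r n} - measure ?N {p<..<r n}) \<longlonglongrightarrow> measure ?P {p<..q} - measure ?N {p<..q}"
    by (intro tendsto_diff lim P N sets_pos_variation sets_neg_variation)
  then have "(\<lambda>n. g {p<..<r n}) \<longlonglongrightarrow> g {p<..q}"
    by (simp add: signed_measure_eq_variations[OF g])
  then have "(\<lambda>n. \<bar>g {p<..<r n}\<bar>) \<longlonglongrightarrow> \<bar>g {p<..q}\<bar>"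
    by (rule tendsto_rabs)
  moreover have "(\<lambda>n. L * (r n - p)) \<longlonglongrightarrow> L * (q - p)"
    by (intro tendsto_intros r)
  moreover have "\<bar>g {p<..<r n}\<bar> \<le> L * (r n - p)" for n
    using pq by (intro Ioo) (simp add: r_def add_increasing2)
  ultimately show ?thesis
    by (intro LIMSEQ_le) auto
qed

text \<open>
  The set function \<open>A \<mapsto> L \<lambda>(A) + g A\<close> agrees on bounded intervals with a Stieltjes measure, hence on all
  bounded Borel sets, and is therefore nonnegative there.
\<close>

lemma signed_measure_lower_bound:
  assumes g: "signed_measure g" and L: "0 \<le> L"
    and Ioc: "\<And>p q. p \<le> q \<Longrightarrow> - (L * (q - p)) \<le> g {p<..q}"
    and A: "A \<in> sets borel"
  shows "- (L * measure lborel (A \<inter> {- real k<..real k})) \<le> g (A \<inter> {- real k<..real k})"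
proof -
  let ?P = "pos_variation g" and ?N = "neg_variation g" and ?I = "{- real k<..real k}"
  interpret P: finite_borel_measure ?P
    using finite_measure_pos_variation[OF g] by (simp add: finite_borel_measure_def finite_borel_measure_axioms_def)
  interpret N: finite_borel_measure ?N
    using finite_measure_pos_variation[OF signed_measure_uminus[OF g]]
    by (simp add: finite_borel_measure_def finite_borel_measure_axioms_def neg_variation_def)
  \<comment> \<open>The increment of \<open>F\<close> over \<open>{p<..q}\<close> is
    \<open>L * (q - p) + g {p<..q}\<close>, so the assumption on intervals says precisely that
    \<open>F\<close> is nondecreasing, and the distribution functions make it
    right-continuous.\<close>
  define F where "F x = L * x + (cdf ?P x - cdf ?N x)" for x
  have F_diff: "F q - F p = L * (q - p) + g {p<..q}" if "p \<le> q" for p q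
  proof (cases "p = q")
    case True
    then show ?thesis by (simp add: signed_measure_empty[OF g])
  next
    case False
    then have "p < q" using that by simp
    then show ?thesis
      using P.cdf_diff_eq[of p q] N.cdf_diff_eq[of p q]
      by (simp add: F_def signed_measure_eq_variations[OF g] algebra_simps)
  qed
  have mono: "F p \<le> F q" if "p \<le> q" for p q
    using F_diff[OF that] Ioc[OF that] by linarith
  have cont: "continuous (at_right a) F" for a
    unfolding F_def[abs_def]
    by (intro continuous_intros P.cdf_is_right_cont N.cdf_is_right_cont)
  let ?\<mu> = "interval_measure F"
  have \<mu>: "emeasure ?\<mu> {p<..q} = ennreal (F q - F p)" if "p \<le> q" for p q
    by (rule emeasure_interval_measure_Ioc[OF that mono cont])
  have \<mu>': "measure ?\<mu> {p<..q} = L * measure lborel {p<..q} + g {p<..q}" for p q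
  proof (cases "p \<le> q")
    case True
    then show ?thesis using \<mu>[OF True] mono[OF True] F_diff[OF True] by (simp add: measure_def)
  next
    case False
    then show ?thesis by (simp add: signed_measure_empty[OF g])
  qed
  have fin: "emeasure ?\<mu> (B \<inter> ?I) < \<infinity>" "emeasure lborel (B \<inter> ?I) < \<infinity>" for B
    using emeasure_mono[of "B \<inter> ?I" ?I ?\<mu>] emeasure_mono[of "B \<inter> ?I" ?I lborel] \<mu>[of "- real k" "real k"]
    by (auto simp: le_less_trans)
  \<comment> \<open>The identity is kept inside the window \<open>{- k<..k}\<close>: the complement
    step subtracts measures and needs them finite, which Lebesgue measure is only locally.\<close>
  have "measure ?\<mu> (A \<inter> ?I) = L * measure lborel (A \<inter> ?I) + g (A \<inter> ?I)"
  proof -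
    have "Int_stable (range (\<lambda>(a, b). {a<..b::real}))"
      by (auto simp: Int_stable_def)
    moreover have "range (\<lambda>(a, b). {a<..b::real}) \<subseteq> Pow UNIV" by simp
    moreover have "A \<in> sigma_sets UNIV (range (\<lambda>(a, b). {a<..b::real}))"
      using A unfolding borel_sigma_sets_Ioc by (simp add: sets_measure_of)
    ultimately show ?thesis
    proof (induction rule: sigma_sets_induct_disjoint)
      case (basic B)
      then obtain a b where "B = {a<..b}" by auto
      then have "B \<inter> ?I = {max a (- real k)<..min b (real k)}" by auto
      then show ?case using \<mu>' by simp
    next
      case empty
      then show ?case by (simp add: signed_measure_empty[OF g])
    next
      case (compl B)
      have B: "B \<in> sets borel"
        using compl(1) unfolding borel_sigma_sets_Ioc by (simp add: sets_measure_of)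
      have eq: "(UNIV - B) \<inter> ?I = ?I - B \<inter> ?I" by auto
      have d1: "measure ?\<mu> (?I - B \<inter> ?I) = measure ?\<mu> ?I - measure ?\<mu> (B \<inter> ?I)"
        using B fin(1)[of UNIV] by (intro measure_Diff) auto
      have d2: "measure lborel (?I - B \<inter> ?I) = measure lborel ?I - measure lborel (B \<inter> ?I)"
        using B fin(2)[of UNIV] by (intro measure_Diff) auto
      have d3: "g (?I - B \<inter> ?I) = g ?I - g (B \<inter> ?I)"
        using B by (intro signed_measure_Diff[OF g]) auto
      show ?case
        unfolding eq d1 d2 d3 compl(2) \<mu>' by (simp only: right_diff_distrib)
    next
      case (union B)
      have B: "B i \<in> sets borel" for i
        using union(2) unfolding borel_sigma_sets_Ioc by (auto simp: sets_measure_of)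
      have dj: "disjoint_family (\<lambda>i. B i \<inter> ?I)"
        using union(1) by (auto simp: disjoint_family_on_def)
      have UN: "(\<Union>i. B i \<inter> ?I) = (\<Union>i. B i) \<inter> ?I" by auto
      have f: "emeasure ?\<mu> (\<Union>i. B i \<inter> ?I) \<noteq> \<infinity>" "emeasure lborel (\<Union>i. B i \<inter> ?I) \<noteq> \<infinity>"
        unfolding UN using fin[of "\<Union>i. B i"] by auto
      have 1: "(\<lambda>i. measure ?\<mu> (B i \<inter> ?I)) sums measure ?\<mu> (\<Union>i. B i \<inter> ?I)"
        by (rule measure_UNION[OF _ dj f(1)]) (use B in auto)
      have 2: "(\<lambda>i. measure lborel (B i \<inter> ?I)) sums measure lborel (\<Union>i. B i \<inter> ?I)"
        by (rule measure_UNION[OF _ dj f(2)]) (use B in auto)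
      have 3: "(\<lambda>i. g (B i \<inter> ?I)) sums g (\<Union>i. B i \<inter> ?I)"
        using B dj by (intro signed_measure_sums[OF g]) auto
      have "(\<lambda>i. measure ?\<mu> (B i \<inter> ?I)) sums (L * measure lborel (\<Union>i. B i \<inter> ?I) + g (\<Union>i. B i \<inter> ?I))"
        unfolding union(3) by (intro sums_add sums_mult 2 3)
      from sums_unique2[OF 1 this] show ?case unfolding UN .
    qed
  qed
  then show ?thesis using measure_nonneg[of ?\<mu> "A \<inter> ?I"] by linarith
qed

lemma signed_measure_abs_bound:
  assumes g: "signed_measure g" and L: "0 \<le> L"
    and Ioc: "\<And>p q. p \<le> q \<Longrightarrow> \<bar>g {p<..q}\<bar> \<le> L * (q - p)"
    and A: "A \<in> sets borel"
  shows "\<bar>g (A \<inter> {- real k<..real k})\<bar> \<le> L * measure lborel (A \<inter> {- real k<..real k})"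
proof -
  have "- (L * (q - p)) \<le> g {p<..q}" "- (L * (q - p)) \<le> - g {p<..q}" if "p \<le> q" for p q
    using Ioc[OF that] by linarith+
  from signed_measure_lower_bound[OF g L this(1) A, of k]
    signed_measure_lower_bound[OF signed_measure_uminus[OF g] L this(2) A, of k]
  show ?thesis by simp
qed

text \<open>Every Borel subset of a null set is null, so \<open>g\<close> vanishes on all
  competitors in the supremum and the positive variation is absolutely continuous. Finiteness of
  that measure makes its Radon-Nikodym derivative finite almost everywhere, hence replaceable by a
  real function.\<close>

lemma pos_variation_density:
  fixes g :: "real set \<Rightarrow> real"
  assumes g: "signed_measure g"
    and null: "\<And>A. A \<in> null_sets lborel \<Longrightarrow> g A = 0"
  obtains D where "integrable lborel D" "\<And>x. 0 \<le> D x"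
    "\<And>A. A \<in> sets borel \<Longrightarrow> measure (pos_variation g) A = (LINT y:A|lborel. D y)"
proof -
  let ?P = "pos_variation g"
  interpret P: finite_measure ?P by (rule finite_measure_pos_variation) fact
  have ac: "absolutely_continuous lborel ?P"
    unfolding absolutely_continuous_def
  proof
    fix A assume A: "A \<in> null_sets (lborel :: real measure)"
    have "measure ?P A \<le> 0"
    proof (rule pos_variation_least[OF g])
      fix B assume "B \<in> sets borel" "B \<subseteq> A"
      then have "B \<in> null_sets lborel" by (intro null_sets_subset[OF A]) auto
      then show "g B \<le> 0" using null by simp
    qed (use A in auto)
    then show "A \<in> null_sets ?P"
      using A by (auto simp: null_sets_def P.emeasure_eq_measure measure_le_0_iff)
  qed
  have RN_fin: "AE x in lborel. RN_deriv lborel ?P x \<noteq> \<infinity>"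
    by (rule sigma_finite_measure.RN_deriv_finite[OF lborel.sigma_finite_measure_axioms P.sigma_finite_measure_axioms ac]) simp
  define D where "D x = enn2real (RN_deriv lborel ?P x)" for x
  have D: "D \<in> borel_measurable lborel" "AE x in lborel. RN_deriv lborel ?P x = ennreal (D x)" "\<And>x. 0 \<le> D x"
    using RN_fin by (auto simp: D_def[abs_def] less_top elim!: eventually_mono)
  have "density lborel (\<lambda>x. ennreal (D x)) = density lborel (RN_deriv lborel ?P)"
    using D by (intro density_cong) (auto elim: eventually_mono)
  also have "\<dots> = ?P"
    by (rule sigma_finite_measure.density_RN_deriv[OF lborel.sigma_finite_measure_axioms ac]) simp
  finally have P_eq: "?P = density lborel (\<lambda>x. ennreal (D x))" by simp
  have em: "(\<integral>\<^sup>+x. ennreal (D x * indicator A x) \<partial>lborel) = emeasure ?P A" if "A \<in> sets borel" for A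
    using that D(1,3) by (subst P_eq) (auto simp: emeasure_density ennreal_mult'' ennreal_indicator intro!: nn_integral_cong)
  have int: "integrable lborel D"
  proof (rule integrableI_nonneg)
    show "(\<integral>\<^sup>+x. ennreal (D x) \<partial>lborel) < \<infinity>"
      using em[of UNIV] P.emeasure_finite[of UNIV] less_top[of "emeasure ?P UNIV"] by (simp del: P.emeasure_finite)
  qed (use D in auto)
  moreover have "measure ?P A = (LINT y:A|lborel. D y)" if A: "A \<in> sets borel" for A
  proof -
    have "ennreal (LINT y:A|lborel. D y) = (\<integral>\<^sup>+x. ennreal (D x * indicator A x) \<partial>lborel)"
      unfolding set_lebesgue_integral_def using int A D(3)
      by (subst nn_integral_eq_integral) (auto simp: mult.commute intro: integrable_real_mult_indicator)
    also have "\<dots> = ennreal (measure ?P A)"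
      using em[OF A] by (simp add: P.emeasure_eq_measure)
    finally show ?thesis
      using D(3) by (subst (asm) ennreal_inj) (auto simp: set_lebesgue_integral_def intro!: integral_nonneg_AE)
  qed
  ultimately show ?thesis using that D(3) by blast
qed

text \<open>The bound in windows yields absolute continuity, and the density is the difference of
  those of the two variations. Where \<open>h\<close> or \<open>-h\<close> exceeds \<open>L\<close>
  inside a window, integration contradicts the bound unless that set is null.\<close>

lemma signed_measure_density:
  assumes g: "signed_measure g" and L: "0 \<le> L"
    and Ioc: "\<And>p q. p \<le> q \<Longrightarrow> \<bar>g {p<..q}\<bar> \<le> L * (q - p)"
  obtains h where "integrable lborel h" "\<And>A. A \<in> sets borel \<Longrightarrow> g A = (LINT y:A|lborel. h y)"
    "AE y in lborel. \<bar>h y\<bar> \<le> L"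
proof -
  have bound: "\<bar>g (A \<inter> {- real k<..real k})\<bar> \<le> L * measure lborel (A \<inter> {- real k<..real k})"
    if "A \<in> sets borel" for A k
    by (rule signed_measure_abs_bound[OF g L _ that]) (rule Ioc)
  have null: "g A = 0" if A: "A \<in> null_sets lborel" for A
  proof -
    \<comment> \<open>The shells between consecutive windows partition \<open>A\<close> into bounded
      pieces, to each of which the bound applies.\<close>
    define B where "B k = A \<inter> ({- real (Suc k)<..real (Suc k)} - {- real k<..real k})" for k
    have B: "B k \<in> null_sets lborel" for k
      using null_sets_subset[OF A, of "B k"] A by (auto simp: B_def)
    have "g (B k) = 0" for k
    proof -
      have "B k \<inter> {- real (Suc k)<..real (Suc k)} = B k" by (auto simp: B_def)
      then show ?thesis
        using bound[of "B k" "Suc k"] B[of k] by (auto simp: null_sets_def measure_def)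
    qed
    moreover have "(\<lambda>k. g (B k)) sums g (\<Union>k. B k)"
    proof (rule signed_measure_sums[OF g])
      show "range B \<subseteq> sets borel" using null_setsD2[OF B] by auto
      have "B m \<inter> B n = {}" if "m < n" for m n
      proof -
        have "real (Suc m) \<le> real n" using that by simp
        then show ?thesis by (auto simp: B_def)
      qed
      then show "disjoint_family B"
        unfolding disjoint_family_on_def by (metis Int_commute linorder_neqE_nat)
    qed
    moreover have "(\<Union>k. B k) = A"
    proof (intro equalityI subsetI)
      fix x assume x: "x \<in> A"
      obtain n where n: "\<bar>x\<bar> < real n" using reals_Archimedean2 by blast
      \<comment> \<open>The shell containing x belongs to the smallest window containing it. Window
        0 is empty, so the smallest index is a successor.\<close>
      define m where "m = (LEAST n. x \<in> {- real n<..real n})"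
      have m: "x \<in> {- real m<..real m}"
      proof -
        have "x \<in> {- real n<..real n}" using n by auto
        then show ?thesis unfolding m_def by (rule LeastI)
      qed
      then obtain k where k: "m = Suc k" by (cases m) auto
      then have "k < (LEAST n. x \<in> {- real n<..real n})" unfolding m_def by simp
      then have "x \<notin> {- real k<..real k}" by (rule not_less_Least)
      with m k x show "x \<in> (\<Union>k. B k)" by (auto simp: B_def)
    qed (auto simp: B_def)
    ultimately have "(\<lambda>k. 0) sums g A" by simp
    from sums_unique2[OF this sums_zero] show ?thesis .
  qed
  obtain p where p: "integrable lborel p" "\<And>x. 0 \<le> p x"
    "\<And>A. A \<in> sets borel \<Longrightarrow> measure (pos_variation g) A = (LINT y:A|lborel. p y)"
    using pos_variation_density[OF g null] by blast
  obtain n where n: "integrable lborel n" "\<And>x. 0 \<le> n x"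
    "\<And>A. A \<in> sets borel \<Longrightarrow> measure (neg_variation g) A = (LINT y:A|lborel. n y)"
    using pos_variation_density[OF signed_measure_uminus[OF g]] null unfolding neg_variation_def by auto
  define h where "h y = p y - n y" for y
  have h: "integrable lborel h" using p(1) n(1) by (simp add: h_def[abs_def])
  then have [measurable]: "h \<in> borel_measurable borel" using borel_measurable_integrable[of lborel h] by simp
  have set_int: "set_integrable lborel A f" if "A \<in> sets borel" "integrable lborel f" for A and f :: "real \<Rightarrow> real"
    using that integrable_mult_indicator[of A lborel f] by (simp add: set_integrable_def)
  have g_eq: "g A = (LINT y:A|lborel. h y)" if A: "A \<in> sets borel" for A
    using A p n set_int[OF A] by (simp add: signed_measure_eq_variations[OF g] h_def set_integral_diff)
  have le: "AE y in lborel. y \<in> {- real k<..real k} \<longrightarrow> \<sigma> * h y \<le> L" if \<sigma>: "\<bar>\<sigma>\<bar> = 1" for k \<sigma>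
  proof -
    let ?I = "{- real k<..real k}"
    \<comment> \<open>On the set where the claim fails, the excess \<open>\<sigma> * h - L\<close>
      is positive, while its integral over the window is \<open>\<sigma> * g\<close> minus
      \<open>L\<close> times the measure, which is at most 0.\<close>
    define A where "A = {y \<in> space borel. L < \<sigma> * h y}"
    have A: "A \<in> sets borel" unfolding A_def by measurable
    have AI: "emeasure lborel (A \<inter> ?I) < \<infinity>"
    proof (rule emeasure_bounded_finite)
      show "bounded (A \<inter> ?I)" by (rule bounded_subset[of "{- real k..real k}"]) auto
    qed
    define f where "f y = indicator (A \<inter> ?I) y * (\<sigma> * h y - L)" for y
    have i1: "integrable lborel (\<lambda>y. indicator (A \<inter> ?I) y * h y)"
      using set_int[of "A \<inter> ?I" h] A h by (simp add: set_integrable_def)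
    have i2: "integrable lborel (\<lambda>y. indicator (A \<inter> ?I) y * L)"
      using A AI by (intro integrable_mult_left integrable_real_indicator) auto
    have f_eq: "f y = \<sigma> * (indicator (A \<inter> ?I) y * h y) - indicator (A \<inter> ?I) y * L" for y
      by (simp add: f_def algebra_simps)
    have f_int: "integrable lborel f"
      unfolding f_eq[abs_def] using i1 i2 by simp
    have f_nn: "0 \<le> f y" for y by (auto simp: f_def A_def indicator_def)
    have "(\<integral>y. f y \<partial>lborel) = \<sigma> * (\<integral>y. indicator (A \<inter> ?I) y * h y \<partial>lborel) - (\<integral>y. indicator (A \<inter> ?I) y * L \<partial>lborel)"
      unfolding f_eq using i1 i2 by simp
    also have "(\<integral>y. indicator (A \<inter> ?I) y * h y \<partial>lborel) = g (A \<inter> ?I)"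
      using g_eq[of "A \<inter> ?I"] A by (simp add: set_lebesgue_integral_def)
    also have "(\<integral>y. indicator (A \<inter> ?I) y * L \<partial>lborel) = measure lborel (A \<inter> ?I) * L"
      by simp
    also have "\<sigma> * g (A \<inter> ?I) - measure lborel (A \<inter> ?I) * L \<le> 0"
    proof -
      have "\<sigma> * g (A \<inter> ?I) \<le> \<bar>g (A \<inter> ?I)\<bar>"
        using abs_ge_self[of "\<sigma> * g (A \<inter> ?I)"] \<sigma> by (simp add: abs_mult)
      then show ?thesis using bound[OF A, of k] by (simp add: mult.commute)
    qed
    finally have "(\<integral>y. f y \<partial>lborel) \<le> 0" .
    moreover have "0 \<le> (\<integral>y. f y \<partial>lborel)" by (intro integral_nonneg_AE AE_I2 f_nn)
    ultimately have "(\<integral>y. f y \<partial>lborel) = 0" by simp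
    then have "AE y in lborel. f y = 0"
      using f_int f_nn by (subst (asm) integral_nonneg_eq_0_iff_AE) auto
    then show ?thesis
      by eventually_elim (auto simp: f_def A_def indicator_def not_less)
  qed
  have "AE y in lborel. \<forall>k::nat. (y \<in> {- real k<..real k} \<longrightarrow> 1 * h y \<le> L) \<and> (y \<in> {- real k<..real k} \<longrightarrow> (- 1) * h y \<le> L)"
    unfolding AE_all_countable using le[of 1] le[of "- 1"] by (auto intro: AE_conjI)
  then have "AE y in lborel. \<bar>h y\<bar> \<le> L"
  proof eventually_elim
    case (elim y)
    obtain k where "\<bar>y\<bar> < real k" using reals_Archimedean2 by blast
    then have "y \<in> {- real k<..real k}" by auto
    with elim show ?case by (auto simp: abs_le_iff)
  qed
  with h g_eq that show ?thesis by blast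
qed

text \<open>The density bound comes with the total variation and the conclusion with the L1 norm of
  \<open>h\<close>. The bound increases with the mass, so this direction is the one that is called
  for.\<close>

lemma tv_norm_density_le:
  fixes g :: "real set \<Rightarrow> real"
  assumes g: "signed_measure g" and h: "integrable lborel h"
    and g_eq: "\<And>A. A \<in> sets borel \<Longrightarrow> g A = (LINT y:A|lborel. h y)"
  shows "tv_norm g \<le> L1_norm h"
proof -
  have le: "measure (pos_variation \<nu>) UNIV \<le> (\<integral>y. max (f y) 0 \<partial>lborel)"
    if \<nu>: "signed_measure \<nu>" and f: "integrable lborel f" and eq: "\<And>A. A \<in> sets borel \<Longrightarrow> \<nu> A = (LINT y:A|lborel. f y)"
    for \<nu> and f :: "real \<Rightarrow> real"
  proof (rule pos_variation_least[OF \<nu>])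
    show "0 \<le> (\<integral>y. max (f y) 0 \<partial>lborel)" by simp
    fix B :: "real set" assume B: "B \<in> sets borel"
    show "\<nu> B \<le> (\<integral>y. max (f y) 0 \<partial>lborel)"
      unfolding eq[OF B] set_lebesgue_integral_def
    proof (rule integral_mono)
      show "integrable lborel (\<lambda>y. indicator B y *\<^sub>R f y)"
        using f B by (intro integrable_mult_indicator) auto
      show "integrable lborel (\<lambda>y. max (f y) 0)" using f by simp
    qed (auto simp: indicator_def)
  qed simp
  have "measure (pos_variation g) UNIV \<le> (\<integral>y. max (h y) 0 \<partial>lborel)"
    by (rule le[OF g h g_eq])
  moreover have "measure (neg_variation g) UNIV \<le> (\<integral>y. max (- h y) 0 \<partial>lborel)"
    unfolding neg_variation_def
    using h g_eq by (intro le[OF signed_measure_uminus[OF g]]) (auto simp: set_lebesgue_integral_def)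
  moreover have "(\<integral>y. max (h y) 0 \<partial>lborel) + (\<integral>y. max (- h y) 0 \<partial>lborel) = L1_norm h"
  proof -
    have "(\<integral>y. max (h y) 0 \<partial>lborel) + (\<integral>y. max (- h y) 0 \<partial>lborel) = (\<integral>y. max (h y) 0 + max (- h y) 0 \<partial>lborel)"
      using h by (intro Bochner_Integration.integral_add[symmetric]) auto
    also have "\<dots> = L1_norm h"
      by (intro Bochner_Integration.integral_cong) auto
    finally show ?thesis .
  qed
  ultimately show ?thesis by (simp add: tv_norm_def)
qed

text \<open>With N the L1 norm and r the finite exponent, |h|^r is at most (K N^(1/2))^(r - 1) |h|,
  so its integral is at most K^(r - 1) N^((r - 1)/2 + 1). Taking the r-th root gives the exponents 1
  - 1/r of K and (1 + 1/r)/2 of N. For \<open>p = \<infinity>\<close> the claim is the supremum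
  bound itself.\<close>

lemma Lp_norm_interpolation:
  fixes h :: "real \<Rightarrow> real"
  assumes h: "integrable lborel h" and K: "0 \<le> K"
    and bound: "AE y in lborel. \<bar>h y\<bar> \<le> K * L1_norm h powr (1 / 2)"
    and p: "1 < p" and p': "1 / p + 1 / p' = 1"
  shows "Lp_norm p h \<le> ereal (K powr real_of_ereal (1 / p') * L1_norm h powr (1 / 2 * (1 + real_of_ereal (1 / p))))"
proof (cases "p = \<infinity>")
  case True
  then have "1 / p' = 1" using p' by (simp add: zero_ereal_def[symmetric])
  have "h \<in> borel_measurable lborel" using h by (rule borel_measurable_integrable)
  then have "esssup lborel (\<lambda>y. ereal \<bar>h y\<bar>) \<le> ereal (K * L1_norm h powr (1 / 2))"
    using bound by (intro esssup_I) auto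
  then show ?thesis
    using True \<open>1 / p' = 1\<close> K by (simp add: Lp_norm_def)
next
  case False
  then obtain r where r: "p = ereal r" "1 < r" using p by (cases p) auto
  have p_eq: "1 / p = ereal (1 / r)" using r by (simp add: one_ereal_def)
  \<comment> \<open>The conclusion contains \<open>p'\<close> only through \<open>1 / p'\<close>, so
    the relation is solved for this quotient, which is a finite number.\<close>
  define q where "q = 1 / p'"
  have "q = ereal (1 - 1 / r)"
    using p' unfolding p_eq q_def[symmetric] by (cases q) (auto simp: one_ereal_def)
  then have q: "real_of_ereal (1 / p') = 1 - 1 / r" unfolding q_def by simp
  define N where "N = L1_norm h"
  have N: "0 \<le> N" by (simp add: N_def)
  have hm [measurable]: "h \<in> borel_measurable borel" using borel_measurable_integrable[OF h] by simp
  have "(\<integral>\<^sup>+y. ennreal (\<bar>h y\<bar> powr r) \<partial>lborel) \<le> (\<integral>\<^sup>+y. ennreal ((K * N powr (1 / 2)) powr (r - 1)) * ennreal \<bar>h y\<bar> \<partial>lborel)"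
  proof (rule nn_integral_mono_AE)
    show "AE y in lborel. ennreal (\<bar>h y\<bar> powr r) \<le> ennreal ((K * N powr (1 / 2)) powr (r - 1)) * ennreal \<bar>h y\<bar>"
      using bound
    proof eventually_elim
      case (elim y)
      have "\<bar>h y\<bar> powr r = \<bar>h y\<bar> powr (r - 1) * \<bar>h y\<bar>"
        using powr_add[of "\<bar>h y\<bar>" "r - 1" 1] by (cases "h y = 0") auto
      also have "\<dots> \<le> (K * N powr (1 / 2)) powr (r - 1) * \<bar>h y\<bar>"
        using elim r by (intro mult_right_mono powr_mono2) (auto simp: N_def)
      finally show ?case by (simp add: ennreal_mult[symmetric] ennreal_leI)
    qed
  qed
  also have "\<dots> = ennreal ((K * N powr (1 / 2)) powr (r - 1)) * ennreal N"
    unfolding N_def using h by (subst nn_integral_cmult) (auto simp: nn_integral_eq_integral)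
  also have "\<dots> = ennreal ((K * N powr (1 / 2)) powr (r - 1) * N)"
    using N by (simp add: ennreal_mult)
  finally have le: "(\<integral>\<^sup>+y. ennreal (\<bar>h y\<bar> powr r) \<partial>lborel) \<le> ennreal ((K * N powr (1 / 2)) powr (r - 1) * N)" .
  define I where "I = (\<integral>\<^sup>+y. ennreal (\<bar>h y\<bar> powr r) \<partial>lborel)"
  have fin: "I \<noteq> \<infinity>" using le unfolding I_def by (auto simp: top_unique)
  have "enn2real I \<le> (K * N powr (1 / 2)) powr (r - 1) * N"
    using le N unfolding I_def by (intro enn2real_leI) auto
  then have "enn2real I powr (1 / r) \<le> ((K * N powr (1 / 2)) powr (r - 1) * N) powr (1 / r)"
    using r by (intro powr_mono2) auto
  also have "\<dots> = (K powr (r - 1) * N powr ((r - 1) / 2) * N powr 1) powr (1 / r)"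
    using N K by (simp add: powr_mult powr_powr)
  also have "\<dots> = K powr ((r - 1) / r) * (N powr ((r - 1) / (2 * r)) * N powr (1 / r))"
    using N K r by (simp add: powr_mult powr_powr field_simps)
  also have "\<dots> = K powr (1 - 1 / r) * N powr (1 / 2 * (1 + 1 / r))"
  proof -
    have "(r - 1) / r = 1 - 1 / r" "(r - 1) / (2 * r) + 1 / r = 1 / 2 * (1 + 1 / r)"
      using r by (simp_all add: field_simps)
    then show ?thesis by (simp only: powr_add[symmetric])
  qed
  finally show ?thesis
    using fin False r unfolding q p_eq Lp_norm_def I_def N_def by (simp add: Let_def)
qed

theorem proposition5p1:
  fixes g :: "real set \<Rightarrow> real"
    and a :: "(real \<times> real) set \<Rightarrow> real"
    and c_inf :: real
    and u :: field2
    and am :: "nat \<Rightarrow> real \<times> real \<Rightarrow> real"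
    and um :: "nat \<Rightarrow> field2"
  assumes "dispersive_estimate c_inf"
    and "signed_measure g"
    and "a = delta_axis g"
    and "unique_admissible_solution a u"
    and "approximate_data a am"
    and "\<And>m. m \<ge> 1 \<Longrightarrow> kruzhkov_solution (am m) (um m)"
    and "distributional_limit um u"
  shows "self_similar u \<and>
    (\<exists>h :: real \<Rightarrow> real. integrable lborel h \<and>
       (\<forall>A \<in> sets borel. g A = (LINT y:A|lborel. h y)) \<and>
       (\<forall>p p' :: ereal. 1 < p \<longrightarrow> 1 / p + 1 / p' = 1 \<longrightarrow>
          Lp_norm p h \<le> ereal ((2 * c_inf\<^sup>2) powr real_of_ereal (1 / p') *
            L1_norm h powr (1 / 2 * (1 + real_of_ereal (1 / p))))))"
proof
  note g = assms(2)
  show "self_similar u"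
    using unique_admissible_solution_self_similar assms(2,3,4) by blast
  \<comment> \<open>This is \<open>2 * M\<^sup>2\<close> with the total variation as mass. It has to
    be stated with \<open>tv_norm\<close> at first, because no density exists yet whose L1 norm
    could appear.\<close>
  define L where "L = 2 * (\<bar>c_inf\<bar> * tv_norm g powr (1 / 4))\<^sup>2"
  have L0: "0 \<le> L" by (simp add: L_def)
  have "\<bar>signed_integral g (bump p q s)\<bar> \<le> L * integral\<^sup>L lborel (bump p q s)" if "0 < s" for p q s
    unfolding L_def using assms that unfolding unique_admissible_solution_def
    by (intro signed_integral_bump_le[where u = u and am = am and um = um]) auto
  then have "\<bar>g {p<..q}\<bar> \<le> L * (q - p)" if "p \<le> q" for p q
    using that by (intro signed_measure_interval_le[OF g L0])
  then obtain h where h: "integrable lborel h" and g_eq: "\<And>A. A \<in> sets borel \<Longrightarrow> g A = (LINT y:A|lborel. h y)"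
    and h_le: "AE y in lborel. \<bar>h y\<bar> \<le> L"
    using signed_measure_density[OF g L0] by blast
  have tv: "tv_norm g \<le> L1_norm h" by (rule tv_norm_density_le[OF g h g_eq])
  have tv0: "0 \<le> tv_norm g" by (simp add: tv_norm_def)
  have "L = 2 * c_inf\<^sup>2 * tv_norm g powr (1 / 2)"
  proof -
    have "(tv_norm g powr (1 / 4))\<^sup>2 = tv_norm g powr (1 / 2)"
      by (simp add: power2_eq_square powr_add[symmetric])
    then show ?thesis by (simp add: L_def power_mult_distrib)
  qed
  also have "\<dots> \<le> 2 * c_inf\<^sup>2 * L1_norm h powr (1 / 2)"
    using tv tv0 by (intro mult_left_mono powr_mono2) auto
  finally have "AE y in lborel. \<bar>h y\<bar> \<le> 2 * c_inf\<^sup>2 * L1_norm h powr (1 / 2)"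
    using h_le by (auto elim!: eventually_mono)
  then show "\<exists>h :: real \<Rightarrow> real. integrable lborel h \<and>
       (\<forall>A \<in> sets borel. g A = (LINT y:A|lborel. h y)) \<and>
       (\<forall>p p' :: ereal. 1 < p \<longrightarrow> 1 / p + 1 / p' = 1 \<longrightarrow>
          Lp_norm p h \<le> ereal ((2 * c_inf\<^sup>2) powr real_of_ereal (1 / p') *
            L1_norm h powr (1 / 2 * (1 + real_of_ereal (1 / p)))))"
    using h g_eq by (intro exI[of _ h] conjI ballI allI impI Lp_norm_interpolation) auto
qed

end
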